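(* Let $X$ be a DIFF open $n$-manifold. If an end $\epsilon$ of $X$ is not Mittag-Leffler, then for every exhausting Morse function $\varphi$ on $X$ and every $t\in\mathbb{R}$, there are infinitely many critical points of index $n-1$ in the component of $\varphi^{-1}(t,\infty)$ containing $\epsilon$ (i.e. the component that is a neighborhood of $\epsilon$). In particular, if $X$ admits an exhausting Morse function with only finitely many index-$(n-1)$ critical points, then all of its ends are Mittag-Leffler.
   Context: DIFF denotes the smooth category. Manifolds are Hausdorff with countable basis. An open manifold is one with no boundary and no compact components. A Morse function is exhausting if it is proper and bounded below. Ends. A neighborhood of infinity in $X$ is the complement of a compact set. A neighborhood system of infinity is a nested sequence $U_1\supset U_2\supset\cdots$ of neighborhoods of infinity with empty intersection and with $\overline{U_{i+1}}\subset U_i$. The space of ends is $\mathcal{E}(X)=\varprojlim\pi_0(U_i)$; an end $\epsilon$ is a sequence $V_1\supset V_2\supset\cdots$ with $V_i$ a component of $U_i$, and a neighborhood of $\epsilon$ is an open subset of $X$ containing some $V_i$. A singular ray is a proper continuous map $\gamma\colon[0,\infty)\to X$; it determines an end $\epsilon_\gamma$ (the components of the $U_i$ containing $\gamma([k,\infty))$ for large $k$). Mittag-Leffler. An inverse sequence of groups $G_1\leftarrow G_2\leftarrow\cdots$ is Mittag-Leffler if for each $i$ there is $j\ge i$ such that all $G_k$ with $k\ge j$ have the same image in $G_i$. Given a singular ray $\gamma$, parametrized so that $\gamma([i,\infty))\subset U_i$, the fundamental progroup of $X$ based at $\gamma$ is the inverse sequence $\pi_1(U_i,\gamma(i))$,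 with bonding maps given by inclusion followed by transport of the base point along $\gamma|[i,i+1]$. An end is Mittag-Leffler if the fundamental progroup based at a singular ray determining it is Mittag-Leffler (independent of the choice of ray). *)

theory Defs
  imports "HOL-Analysis.Analysis" "HOL-Algebra.Group"
begin

section \<open>Smooth manifolds\<close>

text \<open>
  A manifold is a Hausdorff, second countable type \<open>'a\<close> with a smooth atlas, so its underlying
  space is \<open>UNIV :: 'a set\<close>. Charts take values in a Euclidean space \<open>'e\<close>, and the dimension of the
  manifold is \<open>DIM('e)\<close>.  A chart is a pair \<open>(D, f)\<close> of an open set \<open>D\<close> and a homeomorphism \<open>f\<close> of
  \<open>D\<close> onto an open subset of \<open>'e\<close>; the values of \<open>f\<close> outside \<open>D\<close> are irrelevant.
\<close>

type_synonym ('a, 'e) chart = "'a set \<times> ('a \<Rightarrow> 'e)"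

text \<open>For open \<open>S\<close>: all iterated directional derivatives of order at most \<open>k\<close> exist and are
  continuous on \<open>S\<close>.\<close>

fun Ck_on :: "nat \<Rightarrow> 'b::real_normed_vector set \<Rightarrow> ('b \<Rightarrow> 'c::real_normed_vector) \<Rightarrow> bool" where
  "Ck_on 0 S f \<longleftrightarrow> continuous_on S f"
| "Ck_on (Suc k) S f \<longleftrightarrow>
     (\<forall>x\<in>S. f differentiable (at x)) \<and>
     (\<forall>v. Ck_on k S (\<lambda>x. frechet_derivative f (at x) v))"

definition smooth_on :: "'b::real_normed_vector set \<Rightarrow> ('b \<Rightarrow> 'c::real_normed_vector) \<Rightarrow> bool" where
  "smooth_on S f \<longleftrightarrow> (\<forall>k. Ck_on k S f)"

definition is_chart :: "('a::topological_space, 'e::euclidean_space) chart \<Rightarrow> bool" where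
  "is_chart c \<longleftrightarrow> (case c of (D, f) \<Rightarrow>
     open D \<and> open (f ` D) \<and> homeomorphism D (f ` D) f (inv_into D f))"

definition smooth_atlas :: "('a::topological_space, 'e::euclidean_space) chart set \<Rightarrow> bool" where
  "smooth_atlas A \<longleftrightarrow>
     (\<forall>c\<in>A. is_chart c) \<and>
     (\<Union>c\<in>A. fst c) = UNIV \<and>
     (\<forall>(D, f)\<in>A. \<forall>(E, g)\<in>A. smooth_on (f ` (D \<inter> E)) (g \<circ> inv_into D f))"

text \<open>There is no boundary because charts are onto open subsets of Euclidean space.\<close>

definition smooth_open_manifold ::
    "('a::{t2_space,second_countable_topology}, 'e::euclidean_space) chart set \<Rightarrow> bool" where
  "smooth_open_manifold A \<longleftrightarrow>
     smooth_atlas A \<and> (\<forall>C\<in>components (UNIV :: 'a set). \<not> compact C)"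

section \<open>Exhausting Morse functions\<close>

definition smooth_function ::
    "('a::topological_space, 'e::euclidean_space) chart set \<Rightarrow> ('a \<Rightarrow> real) \<Rightarrow> bool" where
  "smooth_function A \<phi> \<longleftrightarrow> (\<forall>(D, f)\<in>A. smooth_on (f ` D) (\<phi> \<circ> inv_into D f))"

text \<open>
  Critical points, nondegeneracy and the index are read off in one chosen chart around each point;
  for a smooth function they do not depend on that choice.
\<close>

definition chart_at :: "('a, 'e) chart set \<Rightarrow> 'a \<Rightarrow> ('a, 'e) chart" where
  "chart_at A p = (SOME c. c \<in> A \<and> p \<in> fst c)"

definition coords_at :: "('a, 'e) chart set \<Rightarrow> 'a \<Rightarrow> 'e" where
  "coords_at A p = snd (chart_at A p) p"

definition local_rep :: "('a, 'e) chart set \<Rightarrow> ('a \<Rightarrow> real) \<Rightarrow> 'a \<Rightarrow> 'e \<Rightarrow> real" where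
  "local_rep A \<phi> p = \<phi> \<circ> inv_into (fst (chart_at A p)) (snd (chart_at A p))"

definition critical_point ::
    "('a, 'e::euclidean_space) chart set \<Rightarrow> ('a \<Rightarrow> real) \<Rightarrow> 'a \<Rightarrow> bool" where
  "critical_point A \<phi> p \<longleftrightarrow> (local_rep A \<phi> p has_derivative (\<lambda>v. 0)) (at (coords_at A p))"

definition hessian ::
    "('a, 'e::euclidean_space) chart set \<Rightarrow> ('a \<Rightarrow> real) \<Rightarrow> 'a \<Rightarrow> 'e \<Rightarrow> 'e \<Rightarrow> real" where
  "hessian A \<phi> p v w =
     frechet_derivative (\<lambda>x. frechet_derivative (local_rep A \<phi> p) (at x) w) (at (coords_at A p)) v"

definition nondegenerate ::
    "('a, 'e::euclidean_space) chart set \<Rightarrow> ('a \<Rightarrow> real) \<Rightarrow> 'a \<Rightarrow> bool" where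
  "nondegenerate A \<phi> p \<longleftrightarrow> (\<forall>v. (\<forall>w. hessian A \<phi> p v w = 0) \<longrightarrow> v = 0)"

definition morse_index ::
    "('a, 'e::euclidean_space) chart set \<Rightarrow> ('a \<Rightarrow> real) \<Rightarrow> 'a \<Rightarrow> nat" where
  "morse_index A \<phi> p =
     Max {dim W | W. subspace W \<and> (\<forall>w\<in>W. w \<noteq> 0 \<longrightarrow> hessian A \<phi> p w w < 0)}"

definition critical_points_of_index ::
    "('a, 'e::euclidean_space) chart set \<Rightarrow> ('a \<Rightarrow> real) \<Rightarrow> nat \<Rightarrow> 'a set" where
  "critical_points_of_index A \<phi> k = {p. critical_point A \<phi> p \<and> morse_index A \<phi> p = k}"

definition morse_function ::
    "('a::topological_space, 'e::euclidean_space) chart set \<Rightarrow> ('a \<Rightarrow> real) \<Rightarrow> bool" where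
  "morse_function A \<phi> \<longleftrightarrow>
     smooth_function A \<phi> \<and> (\<forall>p. critical_point A \<phi> p \<longrightarrow> nondegenerate A \<phi> p)"

definition exhausting :: "('a::topological_space \<Rightarrow> real) \<Rightarrow> bool" where
  "exhausting \<phi> \<longleftrightarrow> proper_map euclidean euclidean \<phi> \<and> bdd_below (range \<phi>)"

section \<open>Ends\<close>

definition neighborhood_system :: "(nat \<Rightarrow> 'a::topological_space set) \<Rightarrow> bool" where
  "neighborhood_system U \<longleftrightarrow>
     (\<forall>i. compact (- U i)) \<and>
     (\<forall>i. U (Suc i) \<subseteq> U i) \<and>
     (\<Inter>i. U i) = {} \<and>
     (\<forall>i. closure (U (Suc i)) \<subseteq> U i)"

text \<open>The inverse limit of the sets \<open>\<pi>\<^sub>0 (U i)\<close>. Up to canonical bijection it does not depend on the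
  neighborhood system \<open>U\<close>.\<close>

definition ends :: "(nat \<Rightarrow> 'a::topological_space set) \<Rightarrow> (nat \<Rightarrow> 'a set) set" where
  "ends U = {V. (\<forall>i. V i \<in> components (U i)) \<and> (\<forall>i. V (Suc i) \<subseteq> V i)}"

definition end_neighborhood :: "(nat \<Rightarrow> 'a::topological_space set) \<Rightarrow> 'a set \<Rightarrow> bool" where
  "end_neighborhood V N \<longleftrightarrow> open N \<and> (\<exists>i. V i \<subseteq> N)"

definition end_component ::
    "(nat \<Rightarrow> 'a::topological_space set) \<Rightarrow> 'a set \<Rightarrow> 'a set \<Rightarrow> bool" where
  "end_component V S C \<longleftrightarrow> C \<in> components S \<and> end_neighborhood V C"

lemma end_component_unique:
  assumes "V \<in> ends U" "end_component V S C" "end_component V S C'"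
  shows "C = C'"
proof -
  obtain i j where ij: "V i \<subseteq> C" "V j \<subseteq> C'"
    using assms by (auto simp: end_component_def end_neighborhood_def)
  have "antimono V"
    using assms(1) by (auto simp: ends_def intro: decseq_SucI)
  then have "V (max i j) \<subseteq> V i \<inter> V j"
    by (simp add: antimonoD)
  moreover have "V (max i j) \<noteq> {}"
    using assms(1) in_components_nonempty by (fastforce simp: ends_def)
  ultimately have "C \<inter> C' \<noteq> {}"
    using ij by blast
  moreover have "C \<in> components S" "C' \<in> components S"
    using assms by (auto simp: end_component_def)
  ultimately show ?thesis
    using components_eq by blast
qed

text \<open>Only the restriction of a ray to \<open>{0..}\<close> is relevant.\<close>

definition singular_ray :: "(real \<Rightarrow> 'a::topological_space) \<Rightarrow> bool" where
  "singular_ray \<gamma> \<longleftrightarrow> continuous_on {0..} \<gamma> \<and> proper_map (top_of_set {0..}) euclidean \<gamma>"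

definition determines_end :: "(real \<Rightarrow> 'a) \<Rightarrow> (nat \<Rightarrow> 'a set) \<Rightarrow> bool" where
  "determines_end \<gamma> V \<longleftrightarrow> (\<forall>i. \<exists>k\<ge>0. \<gamma> ` {k..} \<subseteq> V i)"

section \<open>Inverse sequences of groups\<close>

definition inverse_sequence :: "(nat \<Rightarrow> 'g monoid) \<Rightarrow> (nat \<Rightarrow> 'g \<Rightarrow> 'g) \<Rightarrow> bool" where
  "inverse_sequence G f \<longleftrightarrow> (\<forall>i. group (G i) \<and> f i \<in> hom (G (Suc i)) (G i))"

text \<open>\<open>bonding f i d\<close> is the composite map from \<open>G (i + d)\<close> to \<open>G i\<close>.\<close>

fun bonding :: "(nat \<Rightarrow> 'g \<Rightarrow> 'g) \<Rightarrow> nat \<Rightarrow> nat \<Rightarrow> 'g \<Rightarrow> 'g" where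
  "bonding f i 0 = id"
| "bonding f i (Suc d) = bonding f i d \<circ> f (i + d)"

definition mittag_leffler :: "(nat \<Rightarrow> 'g monoid) \<Rightarrow> (nat \<Rightarrow> 'g \<Rightarrow> 'g) \<Rightarrow> bool" where
  "mittag_leffler G f \<longleftrightarrow>
     (\<forall>i. \<exists>j\<ge>i. \<forall>k\<ge>j.
        bonding f i (k - i) ` carrier (G k) = bonding f i (j - i) ` carrier (G j))"

section \<open>The fundamental progroup\<close>

definition path_class :: "'a::topological_space set \<Rightarrow> (real \<Rightarrow> 'a) \<Rightarrow> (real \<Rightarrow> 'a) set" where
  "path_class S g = {h. homotopic_paths S g h}"

definition loops_at :: "'a::topological_space set \<Rightarrow> 'a \<Rightarrow> (real \<Rightarrow> 'a) set" where
  "loops_at S x = {g. path g \<and> path_image g \<subseteq> S \<and> pathstart g = x \<and> pathfinish g = x}"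

text \<open>The unions below range over representatives of homotopy classes; all of them give the same
  class.\<close>

definition fundamental_group :: "'a::topological_space set \<Rightarrow> 'a \<Rightarrow> (real \<Rightarrow> 'a) set monoid" where
  "fundamental_group S x =
     \<lparr>carrier = path_class S ` loops_at S x,
      mult = (\<lambda>P Q. \<Union>g\<in>P. \<Union>h\<in>Q. path_class S (g +++ h)),
      one = path_class S (\<lambda>_. x)\<rparr>"

definition transport ::
    "'a::topological_space set \<Rightarrow> (real \<Rightarrow> 'a) \<Rightarrow> (real \<Rightarrow> 'a) set \<Rightarrow> (real \<Rightarrow> 'a) set" where
  "transport S c P = (\<Union>g\<in>P. path_class S (c +++ (g +++ reversepath c)))"

definition progroup ::
    "(nat \<Rightarrow> 'a::topological_space set) \<Rightarrow> (real \<Rightarrow> 'a) \<Rightarrow> nat \<Rightarrow> (real \<Rightarrow> 'a) set monoid" where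
  "progroup U \<gamma> i = fundamental_group (U i) (\<gamma> (real i))"

text \<open>The path \<open>\<lambda>s. \<gamma> (real i + s)\<close> on \<open>{0..1}\<close> is the restriction of \<open>\<gamma>\<close> to \<open>{i..i+1}\<close>.\<close>

definition progroup_bond ::
    "(nat \<Rightarrow> 'a::topological_space set) \<Rightarrow> (real \<Rightarrow> 'a) \<Rightarrow> nat \<Rightarrow> (real \<Rightarrow> 'a) set \<Rightarrow> (real \<Rightarrow> 'a) set" where
  "progroup_bond U \<gamma> i = transport (U i) (\<lambda>s. \<gamma> (real i + s))"

text \<open>
  The Mittag-Leffler property of an end does not depend on the ray. It is required of every
  admissible ray, so failing it means that the progroup based at some ray is not Mittag-Leffler.
  On a manifold every end is determined by such a ray.
\<close>

definition end_mittag_leffler ::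
    "(nat \<Rightarrow> 'a::topological_space set) \<Rightarrow> (nat \<Rightarrow> 'a set) \<Rightarrow> bool" where
  "end_mittag_leffler U V \<longleftrightarrow>
     (\<forall>\<gamma>. singular_ray \<gamma> \<and> (\<forall>i. \<gamma> ` {real i..} \<subseteq> U i) \<and> determines_end \<gamma> V \<longrightarrow>
        mittag_leffler (progroup U \<gamma>) (progroup_bond U \<gamma>))"

subsection \<open>The progroup is an inverse sequence of groups\<close>

lemma homotopic_paths_const_right:
  assumes "path p" "path_image p \<subseteq> S" "pathfinish p = x"
  shows "homotopic_paths S (p +++ (\<lambda>_. x)) p"
proof (rule homotopic_paths_sym, rule homotopic_paths_reparametrize[OF assms(1,2)])
  show "continuous_on {0..1} (\<lambda>t::real. min (2 * t) 1)"
    by (intro continuous_intros)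
qed (use assms in \<open>auto simp: joinpaths_def pathfinish_def min_def\<close>)

lemma homotopic_paths_const_left:
  assumes "path p" "path_image p \<subseteq> S" "pathstart p = x"
  shows "homotopic_paths S ((\<lambda>_. x) +++ p) p"
proof (rule homotopic_paths_sym, rule homotopic_paths_reparametrize[OF assms(1,2)])
  show "continuous_on {0..1} (\<lambda>t::real. max (2 * t - 1) 0)"
    by (intro continuous_intros)
qed (use assms in \<open>auto simp: joinpaths_def pathstart_def max_def\<close>)

lemma homotopic_paths_right_inverse:
  assumes "path p" "path_image p \<subseteq> S" "pathstart p = x"
  shows "homotopic_paths S (p +++ reversepath p) (\<lambda>_. x)"
proof -
  let ?k = "\<lambda>y::real \<times> real. (1 - fst y) * (1 - \<bar>2 * snd y - 1\<bar>)"
  have k: "?k \<in> {0..1} \<times> {0..1} \<rightarrow> {0..1}"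
  proof
    fix y :: "real \<times> real" assume "y \<in> {0..1} \<times> {0..1}"
    then have "0 \<le> 1 - fst y" "1 - fst y \<le> 1" "0 \<le> 1 - \<bar>2 * snd y - 1\<bar>" "1 - \<bar>2 * snd y - 1\<bar> \<le> 1"
      by auto
    then show "?k y \<in> {0..1}"
      unfolding atLeastAtMost_iff by (blast intro: mult_nonneg_nonneg mult_le_one)
  qed
  have p: "continuous_on {0..1} p"
    using assms(1) by (simp add: path_def)
  have "continuous_on ({0..1} \<times> {0..1}) (\<lambda>y. p (?k y))"
  proof (rule continuous_on_compose2[OF p])
    show "continuous_on ({0..1} \<times> {0..1}) ?k"
      by (intro continuous_intros)
    show "?k ` ({0..1} \<times> {0..1}) \<subseteq> {0..1}"
      using k by (simp only: image_subset_iff_funcset)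
  qed
  moreover have "(\<lambda>y. p (?k y)) \<in> {0..1} \<times> {0..1} \<rightarrow> S"
    using k assms(2) unfolding path_image_def by (simp only: Pi_iff image_subset_iff) blast
  moreover have "p (?k (0, s)) = (p +++ reversepath p) s" for s
  proof -
    have "?k (0, s) = (if s \<le> 1/2 then 2 * s else 1 - (2 * s - 1))"
      by simp
    then show ?thesis
      by (simp add: joinpaths_def reversepath_def)
  qed
  moreover have "p (?k (1, s)) = x" "p (?k (s, 0)) = x" "p (?k (s, 1)) = x" for s
    using assms(3) by (simp_all add: pathstart_def)
  ultimately have "homotopic_paths S (\<lambda>s. p (?k (0, s))) (\<lambda>_. x)"
    unfolding homotopic_paths
    by (intro exI[where x="\<lambda>y. p (?k y)"]) (simp add: pathstart_def pathfinish_def joinpaths_def reversepath_def)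
  then show ?thesis
    by (simp only: \<open>\<And>s. p (?k (0, s)) = (p +++ reversepath p) s\<close>)
qed

lemma homotopic_paths_left_inverse:
  assumes "path p" "path_image p \<subseteq> S" "pathfinish p = x"
  shows "homotopic_paths S (reversepath p +++ p) (\<lambda>_. x)"
  using homotopic_paths_right_inverse[of "reversepath p" S x] assms by simp

lemma path_class_eqI:
  assumes "homotopic_paths S g h"
  shows "path_class S g = path_class S h"
  unfolding path_class_def
  using homotopic_paths_trans[OF assms] homotopic_paths_trans[OF homotopic_paths_sym[OF assms]]
  by (intro Collect_cong iffI)

lemma loops_at_join: "g \<in> loops_at S x \<Longrightarrow> h \<in> loops_at S x \<Longrightarrow> g +++ h \<in> loops_at S x"
  by (auto simp: loops_at_def subset_path_image_join dest!: subsetD[OF path_image_join_subset])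

lemma mult_path_class:
  assumes "g \<in> loops_at S x" "h \<in> loops_at S x"
  shows "path_class S g \<otimes>\<^bsub>fundamental_group S x\<^esub> path_class S h = path_class S (g +++ h)"
proof -
  have *: "path_class S (g' +++ h') = path_class S (g +++ h)"
    if "g' \<in> path_class S g" "h' \<in> path_class S h" for g' h'
    using that assms
    by (intro path_class_eqI homotopic_paths_sym[OF homotopic_paths_join])
       (auto simp: path_class_def loops_at_def)
  have "(\<Union>g'\<in>path_class S g. \<Union>h'\<in>path_class S h. path_class S (g' +++ h')) =
      (\<Union>g'\<in>path_class S g. \<Union>h'\<in>path_class S h. path_class S (g +++ h))"
    by (intro SUP_cong refl *)
  also have "\<dots> = path_class S (g +++ h)"
  proof -
    have "g \<in> path_class S g" "h \<in> path_class S h"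
      using assms by (auto simp: path_class_def loops_at_def)
    then show ?thesis
      by blast
  qed
  finally show ?thesis
    by (simp only: fundamental_group_def monoid.simps)
qed

lemma transport_path_class:
  assumes "g \<in> loops_at T y" "T \<subseteq> S" "path c" "path_image c \<subseteq> S" "pathfinish c = y"
  shows "transport S c (path_class T g) = path_class S (c +++ (g +++ reversepath c))"
proof -
  have *: "path_class S (c +++ (g' +++ reversepath c)) = path_class S (c +++ (g +++ reversepath c))"
    if "g' \<in> path_class T g" for g'
  proof -
    have "homotopic_paths S g g'"
      using that assms(2) by (auto simp: path_class_def intro: homotopic_paths_subset)
    then show ?thesis
      using assms
      by (intro path_class_eqI homotopic_paths_sym[OF homotopic_paths_join] homotopic_paths_join)
         (auto simp: loops_at_def)
  qed
  have "transport S c (path_class T g) =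
      (\<Union>g'\<in>path_class T g. path_class S (c +++ (g +++ reversepath c)))"
    unfolding transport_def by (intro SUP_cong refl *)
  also have "\<dots> = path_class S (c +++ (g +++ reversepath c))"
  proof -
    have "g \<in> path_class T g"
      using assms(1) by (auto simp: path_class_def loops_at_def)
    then show ?thesis
      by blast
  qed
  finally show ?thesis .
qed

lemma group_fundamental_group:
  assumes "x \<in> S"
  shows "group (fundamental_group S x)"
proof (rule groupI)
  let ?G = "fundamental_group S x"
  have carr: "carrier ?G = path_class S ` loops_at S x"
    and one: "\<one>\<^bsub>?G\<^esub> = path_class S (\<lambda>_. x)"
    by (simp_all add: fundamental_group_def)
  have const: "(\<lambda>_. x) \<in> loops_at S x"
    using assms by (auto simp: loops_at_def path_def path_image_def pathstart_def pathfinish_def)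
  show "\<one>\<^bsub>?G\<^esub> \<in> carrier ?G"
    using const by (auto simp: carr one)
  fix P assume "P \<in> carrier ?G"
  then obtain g where g: "g \<in> loops_at S x" "P = path_class S g"
    by (auto simp: carr)
  show "\<one>\<^bsub>?G\<^esub> \<otimes>\<^bsub>?G\<^esub> P = P"
    unfolding one g(2) mult_path_class[OF const g(1)]
    using g(1) by (intro path_class_eqI homotopic_paths_const_left) (auto simp: loops_at_def)
  have rg: "reversepath g \<in> loops_at S x"
    using g(1) by (auto simp: loops_at_def)
  show "\<exists>Q\<in>carrier ?G. Q \<otimes>\<^bsub>?G\<^esub> P = \<one>\<^bsub>?G\<^esub>"
  proof (rule bexI[of _ "path_class S (reversepath g)"])
    show "path_class S (reversepath g) \<otimes>\<^bsub>?G\<^esub> P = \<one>\<^bsub>?G\<^esub>"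
      unfolding one g(2) mult_path_class[OF rg g(1)]
      using g(1) by (intro path_class_eqI homotopic_paths_left_inverse) (auto simp: loops_at_def)
  qed (use rg in \<open>auto simp: carr\<close>)
  fix Q assume "Q \<in> carrier ?G"
  then obtain h where h: "h \<in> loops_at S x" "Q = path_class S h"
    by (auto simp: carr)
  show "P \<otimes>\<^bsub>?G\<^esub> Q \<in> carrier ?G"
    unfolding g(2) h(2) mult_path_class[OF g(1) h(1)] using loops_at_join[OF g(1) h(1)]
    by (auto simp: carr)
  fix R assume "R \<in> carrier ?G"
  then obtain k where k: "k \<in> loops_at S x" "R = path_class S k"
    by (auto simp: carr)
  show "P \<otimes>\<^bsub>?G\<^esub> Q \<otimes>\<^bsub>?G\<^esub> R = P \<otimes>\<^bsub>?G\<^esub> (Q \<otimes>\<^bsub>?G\<^esub> R)"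
    unfolding g(2) h(2) k(2) mult_path_class[OF g(1) h(1)] mult_path_class[OF h(1) k(1)]
      mult_path_class[OF loops_at_join[OF g(1) h(1)] k(1)]
      mult_path_class[OF g(1) loops_at_join[OF h(1) k(1)]]
    using g(1) h(1) k(1)
    by (intro path_class_eqI homotopic_paths_sym[OF homotopic_paths_assoc]) (auto simp: loops_at_def)
qed

lemma transport_hom:
  assumes "T \<subseteq> S" "path c" "path_image c \<subseteq> S" "pathstart c = x" "pathfinish c = y"
  shows "transport S c \<in> hom (fundamental_group T y) (fundamental_group S x)"
proof (rule homI)
  let ?r = "reversepath c"
  let ?t = "\<lambda>g. c +++ (g +++ ?r)"
  have carr: "carrier (fundamental_group R z) = path_class R ` loops_at R z" for R and z :: 'a
    by (simp add: fundamental_group_def)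
  have tl: "?t g \<in> loops_at S x" if "g \<in> loops_at T y" for g
  proof -
    have "path g" "path_image g \<subseteq> S" "pathstart g = y" "pathfinish g = y"
      using that assms(1) by (auto simp: loops_at_def)
    then show ?thesis
      using assms by (simp add: loops_at_def subset_path_image_join)
  qed
  note tr = transport_path_class[OF _ assms(1,2,3,5)]
  fix P assume "P \<in> carrier (fundamental_group T y)"
  then obtain g where g: "g \<in> loops_at T y" "P = path_class T g"
    by (auto simp: carr)
  show "transport S c P \<in> carrier (fundamental_group S x)"
    using tl[OF g(1)] by (auto simp: carr g(2) tr[OF g(1)])
  fix Q assume "Q \<in> carrier (fundamental_group T y)"
  then obtain h where h: "h \<in> loops_at T y" "Q = path_class T h"
    by (auto simp: carr)
  have p: "path g" "path_image g \<subseteq> S" "pathstart g = y" "pathfinish g = y"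
    "path h" "path_image h \<subseteq> S" "pathstart h = y" "pathfinish h = y"
    using g(1) h(1) assms(1) by (auto simp: loops_at_def)
  note ps = p assms subset_path_image_join
  have j: "homotopic_paths S (a +++ b) (a' +++ b')"
    if "homotopic_paths S a a'" "homotopic_paths S b b'" "pathfinish a = pathstart b" for a a' b b'
    using that by (rule homotopic_paths_join)
  have r: "homotopic_paths S q q" if "path q" "path_image q \<subseteq> S" for q
    using that by simp
  have 1: "homotopic_paths S (?r +++ (c +++ (h +++ ?r))) (h +++ ?r)"
  proof -
    have "homotopic_paths S (?r +++ (c +++ (h +++ ?r))) ((?r +++ c) +++ (h +++ ?r))"
      by (rule homotopic_paths_assoc) (simp_all add: ps)
    also have "homotopic_paths S \<dots> ((\<lambda>_. y) +++ (h +++ ?r))"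
      by (intro j homotopic_paths_left_inverse r) (simp_all add: ps)
    also have "homotopic_paths S \<dots> (h +++ ?r)"
      by (rule homotopic_paths_const_left) (simp_all add: ps)
    finally show ?thesis .
  qed
  have "homotopic_paths S (?t g +++ ?t h) (c +++ ((g +++ ?r) +++ ?t h))"
    by (rule homotopic_paths_sym, rule homotopic_paths_assoc) (simp_all add: ps)
  also have "homotopic_paths S \<dots> (c +++ (g +++ (?r +++ ?t h)))"
    by (intro j r homotopic_paths_sym[OF homotopic_paths_assoc]) (simp_all add: ps)
  also have "homotopic_paths S \<dots> (c +++ (g +++ (h +++ ?r)))"
    by (intro j r 1) (simp_all add: ps)
  also have "homotopic_paths S \<dots> (?t (g +++ h))"
    by (intro j r homotopic_paths_assoc) (simp_all add: ps)
  finally have "path_class S (?t g +++ ?t h) = path_class S (?t (g +++ h))"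
    by (rule path_class_eqI)
  then show "transport S c (P \<otimes>\<^bsub>fundamental_group T y\<^esub> Q) =
      transport S c P \<otimes>\<^bsub>fundamental_group S x\<^esub> transport S c Q"
    using g h by (simp add: mult_path_class[of _ T] loops_at_join tr tl mult_path_class[of _ S])
qed

lemma inverse_sequence_progroup:
  assumes "neighborhood_system U" "singular_ray \<gamma>" "\<And>i. \<gamma> ` {real i..} \<subseteq> U i"
  shows "inverse_sequence (progroup U \<gamma>) (progroup_bond U \<gamma>)"
proof -
  have "group (progroup U \<gamma> i)" for i
    unfolding progroup_def using assms(3)[of i] by (intro group_fundamental_group) auto
  moreover have "progroup_bond U \<gamma> i \<in> hom (progroup U \<gamma> (Suc i)) (progroup U \<gamma> i)" for i
    unfolding progroup_def progroup_bond_def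
  proof (rule transport_hom)
    show "U (Suc i) \<subseteq> U i"
      using assms(1) by (simp add: neighborhood_system_def)
    have "continuous_on {0..} \<gamma>"
      using assms(2) by (simp add: singular_ray_def)
    then show "path (\<lambda>s. \<gamma> (real i + s))"
      unfolding path_def by (rule continuous_on_compose2) (auto intro!: continuous_intros)
    show "path_image (\<lambda>s. \<gamma> (real i + s)) \<subseteq> U i"
      using assms(3)[of i] by (force simp: path_image_def)
  qed (simp_all add: pathstart_def pathfinish_def add.commute)
  ultimately show ?thesis
    by (simp add: inverse_sequence_def)
qed

end

theory Submission
  imports Defs
begin

text \<open>
  Suppose that the component \<open>C\<close> of \<open>{\<phi> > t}\<close> that contains the end \<open>V\<close> has only finitely many
  critical points of index \<open>n - 1\<close>. Raising \<open>t\<close> above their values leaves none. It then has to be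
  shown that \<open>V\<close> is Mittag-Leffler. The geometric core is a pushing statement: inside \<open>C\<close>, for levels
  \<open>t \<le> s < s'\<close>, every path in \<open>{\<phi> > s}\<close> whose end points lie above \<open>s'\<close> is homotopic relative to its end
  points, within \<open>{\<phi> > s}\<close>, to a path in \<open>{\<phi> > s'}\<close> (\<open>path_homotopic_above_level\<close>). In the language of
  handles, \<open>{\<phi> \<ge> s}\<close> arises from \<open>{\<phi> \<ge> s'}\<close> by attaching an \<open>(n - k)\<close>-handle for each critical point of
  index \<open>k\<close> in between. There are no 1-handles, handles of index at least 2 create no new loops, and
  0-handles only create components that are never joined to the end.

  Granted this, choose for given \<open>i\<close> a level \<open>s\<close> with \<open>{\<phi> > s} \<subseteq> U i\<close> and then \<open>j\<close> with
  \<open>U j \<subseteq> {\<phi> > s}\<close>. A loop in \<open>U j\<close>, transported along the ray to a base point far out, can be pushed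
  within \<open>{\<phi> > s}\<close>, hence within \<open>U i\<close>, into \<open>U k\<close> for any \<open>k \<ge> j\<close>. So the images of \<open>\<pi>\<^sub>1 (U j)\<close> and
  \<open>\<pi>\<^sub>1 (U k)\<close> in \<open>\<pi>\<^sub>1 (U i)\<close> agree, which is the Mittag-Leffler condition
  (\<open>mittag_leffler_if_loops_lift\<close>).

  The pushing statement is proved without gradient flows and without the Morse lemma. All that it uses
  about a point \<open>p\<close> is that \<open>p\<close> is either a strict local maximum or a limit of \<open>{\<phi> > \<phi> p}\<close> near which
  this set is connected (\<open>connected_above\<close>). The second alternative holds at regular points, where one
  moves along a direction of increase. It also holds at nondegenerate critical points of index
  \<open>k \<le> n - 2\<close>: the second derivative is positive definite on a subspace of dimension \<open>n - k \<ge> 2\<close>, points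
  of \<open>{\<phi> > \<phi> p}\<close> can be pushed up, away from the negative directions, to a sphere of that subspace, and
  this sphere is connected. For \<open>k = n - 1\<close> the sphere consists of two points, and this is exactly where
  the hypothesis enters. Points of index \<open>n\<close> are strict local maxima.

  To pass from \<open>{\<phi> > c - \<delta>}\<close> to \<open>{\<phi> > c}\<close> (\<open>raise_level\<close>), cut a path into pieces that lie in
  small simply connected neighborhoods of points of level \<open>c\<close> and replace each piece by one that runs
  in \<open>{\<phi> > c}\<close> between nearby points. Strict maxima of level \<open>c\<close> are no obstacle: a path that starts
  above \<open>c\<close> cannot come close to them without descending below \<open>c - \<delta>\<close>. A supremum argument over all
  levels between \<open>s\<close> and \<open>s'\<close> finishes the proof.
\<close>

section \<open>Homotoping a path into an open subset\<close>

definition path_trivial :: "'a::topological_space set \<Rightarrow> bool" where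
  "path_trivial N \<longleftrightarrow>
     (\<forall>g h. path g \<and> path_image g \<subseteq> N \<and> path h \<and> path_image h \<subseteq> N \<and>
        pathstart g = pathstart h \<and> pathfinish g = pathfinish h \<longrightarrow> homotopic_paths N g h)"

lemma path_trivialD:
  assumes "path_trivial N" "path g" "path_image g \<subseteq> N" "path h" "path_image h \<subseteq> N"
    "pathstart g = pathstart h" "pathfinish g = pathfinish h" "N \<subseteq> D"
  shows "homotopic_paths D g h"
  using assms by (meson path_trivial_def homotopic_paths_subset)

text \<open>
  \<open>W x\<close> is cut out, with respect to a finite subcover \<open>G\<close>, by the sets \<open>Q p\<close> and \<open>G p\<close> that contain
  \<open>x\<close> and by the complements of the sets \<open>F p\<close> that do not. If \<open>W x\<close> and \<open>W y\<close> have a common point \<open>z\<close>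
  and \<open>x \<in> G p\<close>, then \<open>z \<in> F p\<close>. So \<open>y\<close> cannot lie outside \<open>F p\<close>, and \<open>W y\<close> is contained in \<open>Q p\<close> as well.
\<close>

lemma star_refinement:
  fixes K :: "'a::topological_space set"
  assumes "compact K"
    and nested: "\<And>p. p \<in> K \<Longrightarrow>
      p \<in> G p \<and> open (G p) \<and> G p \<subseteq> F p \<and> closed (F p) \<and> F p \<subseteq> Q p \<and> open (Q p)"
  obtains W where "\<And>x. x \<in> K \<Longrightarrow> open (W x) \<and> x \<in> W x"
    and "\<And>x y. x \<in> K \<Longrightarrow> y \<in> K \<Longrightarrow> W x \<inter> W y \<noteq> {} \<Longrightarrow> \<exists>p\<in>K. W x \<union> W y \<subseteq> Q p"
proof -
  obtain I where I: "I \<subseteq> K" "finite I" "K \<subseteq> (\<Union>p\<in>I. G p)"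
    using compactE_image[OF assms(1), of K G] nested by blast
  define W where "W x = (\<Inter>p\<in>{p\<in>I. x \<in> Q p}. Q p) \<inter> (\<Inter>p\<in>{p\<in>I. x \<notin> F p}. - F p)
      \<inter> (\<Inter>p\<in>{p\<in>I. x \<in> G p}. G p)" for x
  show ?thesis
  proof
    fix x assume "x \<in> K"
    show "open (W x) \<and> x \<in> W x"
      unfolding W_def using I nested by (auto intro!: open_Int open_INT)
  next
    fix x y assume xy: "x \<in> K" "y \<in> K" "W x \<inter> W y \<noteq> {}"
    then obtain z where z: "z \<in> W x" "z \<in> W y" by blast
    obtain p where p: "p \<in> I" "x \<in> G p" using I xy by blast
    have "W x \<subseteq> G p" using p by (auto simp: W_def)
    moreover have "G p \<subseteq> F p" "F p \<subseteq> Q p" using p nested I by auto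
    moreover have "y \<in> F p"
    proof (rule ccontr)
      assume "y \<notin> F p"
      then have "W y \<subseteq> - F p" using p by (auto simp: W_def)
      then show False using z calculation by blast
    qed
    ultimately have "y \<in> Q p" by blast
    then have "W y \<subseteq> Q p" using p by (auto simp: W_def)
    then show "\<exists>p\<in>K. W x \<union> W y \<subseteq> Q p"
      using \<open>W x \<subseteq> G p\<close> \<open>G p \<subseteq> F p\<close> \<open>F p \<subseteq> Q p\<close> p I by blast
  qed
qed

lemma path_const: "path (\<lambda>_. x)" "path_image (\<lambda>_. x) = {x}" "pathstart (\<lambda>_. x) = x" "pathfinish (\<lambda>_. x) = x"
  by (auto simp: path_def path_image_def pathstart_def pathfinish_def)

text \<open>
  On the real line \<open>linepath a b\<close> is the affine parametrization of the interval from \<open>a\<close> to \<open>b\<close>, so this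
  is the restriction of \<open>\<gamma>\<close> to that interval, for a target space without linear structure.
\<close>

definition segment_of :: "(real \<Rightarrow> 'a) \<Rightarrow> real \<Rightarrow> real \<Rightarrow> real \<Rightarrow> 'a" where
  "segment_of \<gamma> a b = \<gamma> \<circ> linepath a b"

lemma segment_of_path:
  fixes \<gamma> :: "real \<Rightarrow> 'a::topological_space"
  assumes "continuous_on {a..b} \<gamma>" "a \<le> b"
  shows "path (segment_of \<gamma> a b)" "path_image (segment_of \<gamma> a b) = \<gamma> ` {a..b}"
    "pathstart (segment_of \<gamma> a b) = \<gamma> a" "pathfinish (segment_of \<gamma> a b) = \<gamma> b"
proof -
  have "path_image (linepath a b) = {a..b}"
    using assms(2) by (simp add: closed_segment_eq_real_ivl)
  then show "path (segment_of \<gamma> a b)" "path_image (segment_of \<gamma> a b) = \<gamma> ` {a..b}"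
    "pathstart (segment_of \<gamma> a b) = \<gamma> a" "pathfinish (segment_of \<gamma> a b) = \<gamma> b"
    using assms by (auto simp: segment_of_def pathstart_compose pathfinish_compose path_image_compose
        intro!: path_continuous_image)
qed

text \<open>
  The two parametrizations of \<open>{a..c}\<close> are homotopic within the interval because it is convex; \<open>\<gamma>\<close>
  carries this homotopy to \<open>D\<close>.
\<close>

lemma segment_of_join:
  fixes \<gamma> :: "real \<Rightarrow> 'a::topological_space"
  assumes "continuous_on {a..c} \<gamma>" "\<gamma> ` {a..c} \<subseteq> D" "a \<le> b" "b \<le> c"
  shows "homotopic_paths D (segment_of \<gamma> a b +++ segment_of \<gamma> b c) (segment_of \<gamma> a c)"
proof -
  have im: "path_image (linepath a b +++ linepath b c) \<subseteq> {a..c}"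
    using assms(3,4) by (simp add: path_image_join closed_segment_eq_real_ivl)
  have "homotopic_paths {a..c} (linepath a b +++ linepath b c) (linepath a c)"
  proof (rule homotopic_paths_linear)
    fix t :: real assume t: "t \<in> {0..1}"
    then have "(linepath a b +++ linepath b c) t \<in> {a..c}"
      using im unfolding path_image_def by (meson image_subset_iff)
    moreover have "linepath a c t \<in> {a..c}"
      using t assms(3,4) linepath_in_path[OF t, of a c] by (simp add: closed_segment_eq_real_ivl)
    ultimately show "closed_segment ((linepath a b +++ linepath b c) t) (linepath a c t) \<subseteq> {a..c}"
      by (rule closed_segment_subset) simp
  qed (auto intro: path_join_imp)
  then have "homotopic_paths D (\<gamma> \<circ> (linepath a b +++ linepath b c)) (\<gamma> \<circ> linepath a c)"
    using assms by (intro homotopic_paths_continuous_image) auto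
  moreover have "\<gamma> \<circ> (linepath a b +++ linepath b c) = segment_of \<gamma> a b +++ segment_of \<gamma> b c"
    by (auto simp: segment_of_def joinpaths_def)
  ultimately show ?thesis by (simp add: segment_of_def)
qed

text \<open>
  The points of \<open>\<gamma>\<close> outside \<open>V\<close> lie in the sets \<open>W x\<close>. Such a point \<open>\<gamma> u\<close> is joined to \<open>V\<close> by a
  connector \<open>\<beta>\<close> inside one \<open>W x\<close>. For a short piece of \<open>\<gamma>\<close>, the piece and the connectors at its two
  ends lie in a union of two intersecting sets \<open>W x\<close>, hence in a path-trivial \<open>N\<close>, where the detour
  connector--piece--connector may be exchanged for a path within \<open>N \<inter> V\<close>. This replacement is
  compatible with concatenation, so \<open>Bolzano\<close> extends it from short pieces to all of \<open>\<gamma>\<close>. At the end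
  points, which lie in \<open>V\<close>, the connectors are constant.
\<close>

lemma path_homotopic_into_open:
  fixes D V :: "'a::topological_space set"
  assumes V: "open V" "V \<subseteq> D"
    and W: "\<And>x. x \<in> K \<Longrightarrow> open (W x) \<and> path_connected (W x) \<and> W x \<inter> V \<noteq> {}"
    and star: "\<And>x y. x \<in> K \<Longrightarrow> y \<in> K \<Longrightarrow> W x \<inter> W y \<noteq> {} \<Longrightarrow>
      \<exists>N\<subseteq>D. path_trivial N \<and> W x \<union> W y \<subseteq> N \<and>
        (\<forall>a\<in>(W x \<union> W y) \<inter> V. \<forall>b\<in>(W x \<union> W y) \<inter> V. path_component (N \<inter> V) a b)"
    and \<gamma>: "path \<gamma>" "path_image \<gamma> \<subseteq> V \<union> (\<Union>x\<in>K. W x)" "pathstart \<gamma> \<in> V" "pathfinish \<gamma> \<in> V"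
  shows "\<exists>h. path h \<and> path_image h \<subseteq> V \<and> homotopic_paths D \<gamma> h"
proof -
  have WD: "W x \<subseteq> D" if "x \<in> K" for x
  proof -
    have "W x \<inter> W x \<noteq> {}" using W[OF that] by auto
    with star[OF that that] show ?thesis by blast
  qed
  have \<gamma>D: "path_image \<gamma> \<subseteq> D"
    using \<gamma>(2) V(2) WD by blast
  define valid where "valid u \<beta> \<longleftrightarrow> path \<beta> \<and> pathstart \<beta> = \<gamma> u \<and> pathfinish \<beta> \<in> V \<and>
      (if \<gamma> u \<in> V then \<beta> = (\<lambda>_. \<gamma> u) else \<exists>x\<in>K. path_image \<beta> \<subseteq> W x)" for u \<beta>
  have validD: "path_image \<beta> \<subseteq> D" if "valid u \<beta>" for u \<beta>
    using that V(2) WD by (auto simp: valid_def path_const split: if_splits)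
  \<comment> \<open>\<open>\<beta> +++ \<eta>\<close> and \<open>\<gamma>|[u,v] +++ \<beta>'\<close> run from \<open>\<gamma> u\<close> to the free end of \<open>\<beta>'\<close>; this form composes without inverses\<close>
  define P where "P u v \<longleftrightarrow> (0 \<le> u \<and> u \<le> v \<and> v \<le> 1 \<longrightarrow> (\<forall>\<beta>. valid u \<beta> \<longrightarrow>
      (\<exists>\<beta>' \<eta>. valid v \<beta>' \<and> path \<eta> \<and> path_image \<eta> \<subseteq> V \<and> pathstart \<eta> = pathfinish \<beta> \<and>
        pathfinish \<eta> = pathfinish \<beta>' \<and> homotopic_paths D (\<beta> +++ \<eta>) (segment_of \<gamma> u v +++ \<beta>'))))" for u v
  have \<gamma>c: "continuous_on {u..v} \<gamma>" if "0 \<le> u" "v \<le> 1" for u v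
    using \<gamma>(1) that by (auto simp: path_def intro: continuous_on_subset)
  have sub: "path (segment_of \<gamma> u v)" "path_image (segment_of \<gamma> u v) \<subseteq> D"
    "pathstart (segment_of \<gamma> u v) = \<gamma> u" "pathfinish (segment_of \<gamma> u v) = \<gamma> v"
    if "0 \<le> u" "u \<le> v" "v \<le> 1" for u v
    using that segment_of_path[OF \<gamma>c, of u v] \<gamma>D by (auto simp: path_image_def)
  have "P 0 1"
  proof (induction rule: Bolzano[of 0 1, simplified, case_names trans local])
    case (trans u v w)
    show ?case
      unfolding P_def
    proof (intro impI allI)
      fix \<beta> assume uw: "0 \<le> u \<and> u \<le> w \<and> w \<le> 1" and \<beta>: "valid u \<beta>"
      obtain \<beta>1 \<eta>1 where 1: "valid v \<beta>1" "path \<eta>1" "path_image \<eta>1 \<subseteq> V" "pathstart \<eta>1 = pathfinish \<beta>"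
        "pathfinish \<eta>1 = pathfinish \<beta>1" "homotopic_paths D (\<beta> +++ \<eta>1) (segment_of \<gamma> u v +++ \<beta>1)"
        using trans(1,3,4) uw \<beta> unfolding P_def by (meson order_trans)
      obtain \<beta>2 \<eta>2 where 2: "valid w \<beta>2" "path \<eta>2" "path_image \<eta>2 \<subseteq> V" "pathstart \<eta>2 = pathfinish \<beta>1"
        "pathfinish \<eta>2 = pathfinish \<beta>2" "homotopic_paths D (\<beta>1 +++ \<eta>2) (segment_of \<gamma> v w +++ \<beta>2)"
        using trans(2,3,4) uw 1(1) unfolding P_def by (meson order_trans)
      have uvw: "0 \<le> u" "u \<le> v" "v \<le> w" "w \<le> 1" "v \<le> 1" "0 \<le> v" "u \<le> w"
        using uw trans by auto
      have \<gamma>uw: "\<gamma> ` {u..w} \<subseteq> D"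
        using \<gamma>D uvw by (auto simp: path_image_def)
      note im = validD[OF \<beta>] validD[OF 1(1)] validD[OF 2(1)]
      have p: "path \<beta>" "path \<beta>1" "path \<beta>2" "pathstart \<beta> = \<gamma> u" "pathstart \<beta>1 = \<gamma> v" "pathstart \<beta>2 = \<gamma> w"
        using \<beta> 1(1) 2(1) by (auto simp: valid_def)
      have e: "path_image \<eta>1 \<subseteq> D" "path_image \<eta>2 \<subseteq> D"
        using 1(3) 2(3) V(2) by auto
      note ps = p im e 1(2-5) 2(2-5) sub[OF uvw(1,2,5)] sub[OF uvw(6,3,4)] subset_path_image_join
      have j: "homotopic_paths D (a +++ b) (a' +++ b')"
        if "homotopic_paths D a a'" "homotopic_paths D b b'" "pathfinish a = pathstart b" for a a' b b'
        using that by (rule homotopic_paths_join)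
      have r: "homotopic_paths D q q" if "path q" "path_image q \<subseteq> D" for q
        using that by simp
      have "homotopic_paths D (\<beta> +++ (\<eta>1 +++ \<eta>2)) ((\<beta> +++ \<eta>1) +++ \<eta>2)"
        by (rule homotopic_paths_assoc) (simp_all add: ps)
      also have "homotopic_paths D \<dots> ((segment_of \<gamma> u v +++ \<beta>1) +++ \<eta>2)"
        by (intro j r 1(6)) (simp_all add: ps)
      also have "homotopic_paths D \<dots> (segment_of \<gamma> u v +++ (\<beta>1 +++ \<eta>2))"
        by (rule homotopic_paths_sym, rule homotopic_paths_assoc) (simp_all add: ps)
      also have "homotopic_paths D \<dots> (segment_of \<gamma> u v +++ (segment_of \<gamma> v w +++ \<beta>2))"
        by (intro j r 2(6)) (simp_all add: ps)
      also have "homotopic_paths D \<dots> ((segment_of \<gamma> u v +++ segment_of \<gamma> v w) +++ \<beta>2)"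
        by (rule homotopic_paths_assoc) (simp_all add: ps)
      also have "homotopic_paths D \<dots> (segment_of \<gamma> u w +++ \<beta>2)"
        by (intro j r segment_of_join) (use \<gamma>c \<gamma>uw uvw in \<open>simp_all add: ps\<close>)
      finally show "\<exists>\<beta>' \<eta>. valid w \<beta>' \<and> path \<eta> \<and> path_image \<eta> \<subseteq> V \<and> pathstart \<eta> = pathfinish \<beta> \<and>
        pathfinish \<eta> = pathfinish \<beta>' \<and> homotopic_paths D (\<beta> +++ \<eta>) (segment_of \<gamma> u w +++ \<beta>')"
        using 2(1) ps by (intro exI[of _ \<beta>2] exI[of _ "\<eta>1 +++ \<eta>2"]) (auto simp: subset_path_image_join)
    qed
  next
    case (local x)
    then have x: "x \<in> {0..1}" by simp
    have near: "\<exists>d>0. \<forall>t\<in>{0..1}. \<bar>t - x\<bar> < d \<longrightarrow> \<gamma> t \<in> Q" if Q: "open Q" "\<gamma> x \<in> Q" for Q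
    proof -
      have "continuous_on {0..1} \<gamma>" using \<gamma>(1) by (simp add: path_def)
      then obtain T where T: "open T" "x \<in> T" "\<forall>t\<in>{0..1}. t \<in> T \<longrightarrow> \<gamma> t \<in> Q"
        using Q x unfolding continuous_on_topological by meson
      then obtain d where "d > 0" "ball x d \<subseteq> T"
        using open_contains_ball by blast
      then show ?thesis using T
        by (intro exI[of _ d]) (auto simp: dist_real_def abs_minus_commute subset_iff)
    qed
    have img: "path_image (segment_of \<gamma> u v) \<subseteq> Q"
      if "\<forall>t\<in>{0..1}. \<bar>t - x\<bar> < d \<longrightarrow> \<gamma> t \<in> Q" "0 \<le> u" "u \<le> x" "x \<le> v" "v \<le> 1" "v - u < d" for d Q u v
      using that segment_of_path(2)[OF \<gamma>c, of u v] by (auto simp: abs_less_iff)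
    have "\<gamma> x \<in> V \<union> (\<Union>x\<in>K. W x)" using \<gamma>(2) x unfolding path_image_def by blast
    \<comment> \<open>near \<open>x\<close> the path stays in \<open>V\<close>, where nothing has to be done, or in a single \<open>W y\<close>\<close>
    then consider "\<gamma> x \<in> V" | y where "y \<in> K" "\<gamma> x \<in> W y" by blast
    then show ?case
    proof cases
      case 1
      then obtain d where d: "d > 0" "\<forall>t\<in>{0..1}. \<bar>t - x\<bar> < d \<longrightarrow> \<gamma> t \<in> V"
        using near[OF V(1)] by blast
      have "P u v" if uv: "u \<le> x" "x \<le> v" "v - u < d" for u v
        unfolding P_def
      proof (intro impI allI)
        fix \<beta> assume 01: "0 \<le> u \<and> u \<le> v \<and> v \<le> 1" and \<beta>: "valid u \<beta>"
        have V': "path_image (segment_of \<gamma> u v) \<subseteq> V"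
          using img[OF d(2)] uv 01 by simp
        have "\<gamma> u \<in> V" "\<gamma> v \<in> V" using d(2) uv 01 by auto
        then have \<beta>c: "\<beta> = (\<lambda>_. \<gamma> u)" and vv: "valid v (\<lambda>_. \<gamma> v)"
          using \<beta> by (auto simp: valid_def path_const)
        have s: "path (segment_of \<gamma> u v)" "path_image (segment_of \<gamma> u v) \<subseteq> D"
          "pathstart (segment_of \<gamma> u v) = \<gamma> u" "pathfinish (segment_of \<gamma> u v) = \<gamma> v"
          using sub 01 by auto
        have "homotopic_paths D (\<beta> +++ segment_of \<gamma> u v) (segment_of \<gamma> u v)"
          unfolding \<beta>c by (rule homotopic_paths_const_left) (use s in auto)
        also have "homotopic_paths D \<dots> (segment_of \<gamma> u v +++ (\<lambda>_. \<gamma> v))"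
          by (rule homotopic_paths_sym, rule homotopic_paths_const_right) (use s in auto)
        finally show "\<exists>\<beta>' \<eta>. valid v \<beta>' \<and> path \<eta> \<and> path_image \<eta> \<subseteq> V \<and> pathstart \<eta> = pathfinish \<beta> \<and>
        pathfinish \<eta> = pathfinish \<beta>' \<and> homotopic_paths D (\<beta> +++ \<eta>) (segment_of \<gamma> u v +++ \<beta>')"
          using vv s V' \<beta>c by (intro exI[of _ "\<lambda>_. \<gamma> v"] exI[of _ "segment_of \<gamma> u v"]) (auto simp: path_const)
      qed
      then show ?thesis using d(1) by blast
    next
      case 2
      then obtain d where d: "d > 0" "\<forall>t\<in>{0..1}. \<bar>t - x\<bar> < d \<longrightarrow> \<gamma> t \<in> W y"
        using near W by blast
      have "P u v" if uv: "u \<le> x" "x \<le> v" "v - u < d" for u v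
        unfolding P_def
      proof (intro impI allI)
        fix \<beta> assume 01: "0 \<le> u \<and> u \<le> v \<and> v \<le> 1" and \<beta>: "valid u \<beta>"
        have Wi: "path_image (segment_of \<gamma> u v) \<subseteq> W y"
          using img[OF d(2)] uv 01 by simp
        have uW: "\<gamma> u \<in> W y" and vW: "\<gamma> v \<in> W y" using d(2) uv 01 by auto
        have "\<exists>x\<in>K. path_image \<beta> \<subseteq> W x"
        proof (cases "\<gamma> u \<in> V")
          case True
          then have "path_image \<beta> = {\<gamma> u}" using \<beta> by (simp add: valid_def path_const)
          then show ?thesis using 2(1) uW by (intro bexI[of _ y]) auto
        next
          case False
          then show ?thesis using \<beta> by (simp add: valid_def)
        qed
        then obtain x' where x': "x' \<in> K" "path_image \<beta> \<subseteq> W x'" by blast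
        have "\<gamma> u \<in> path_image \<beta>"
          using \<beta> pathstart_in_path_image[of \<beta>] by (simp add: valid_def)
        then have "W x' \<inter> W y \<noteq> {}" using uW x'(2) by blast
        then obtain N where N: "N \<subseteq> D" "path_trivial N" "W x' \<union> W y \<subseteq> N"
          "\<And>a b. a \<in> (W x' \<union> W y) \<inter> V \<Longrightarrow> b \<in> (W x' \<union> W y) \<inter> V \<Longrightarrow> path_component (N \<inter> V) a b"
          using star[OF x'(1) 2(1)] by blast
        have "\<exists>\<beta>'. valid v \<beta>' \<and> path_image \<beta>' \<subseteq> W y"
        proof (cases "\<gamma> v \<in> V")
          case True
          then show ?thesis
            using vW by (intro exI[of _ "\<lambda>_. \<gamma> v"]) (auto simp: valid_def path_const)
        next
          case False
          obtain q where "q \<in> W y" "q \<in> V" using W[OF 2(1)] by blast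
          moreover then obtain \<beta>' where "path \<beta>'" "path_image \<beta>' \<subseteq> W y" "pathstart \<beta>' = \<gamma> v" "pathfinish \<beta>' = q"
            using W[OF 2(1)] vW unfolding path_connected_def by blast
          ultimately show ?thesis using False 2 by (auto simp: valid_def)
        qed
        then obtain \<beta>' where \<beta>': "valid v \<beta>'" "path_image \<beta>' \<subseteq> W y" by blast
        have q: "pathfinish \<beta> \<in> (W x' \<union> W y) \<inter> V" "pathfinish \<beta>' \<in> (W x' \<union> W y) \<inter> V"
          using \<beta> \<beta>' x'(2) pathfinish_in_path_image[of \<beta>] pathfinish_in_path_image[of \<beta>']
          by (auto simp: valid_def)
        from N(4)[OF this] obtain \<eta> where \<eta>: "path \<eta>" "path_image \<eta> \<subseteq> N \<inter> V" "pathstart \<eta> = pathfinish \<beta>" "pathfinish \<eta> = pathfinish \<beta>'"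
          unfolding path_component_def by blast
        have "path \<beta>" "path \<beta>'" "pathstart \<beta> = \<gamma> u" "pathstart \<beta>' = \<gamma> v"
          using \<beta> \<beta>' by (auto simp: valid_def)
        moreover have "path_image \<beta> \<subseteq> N" "path_image \<beta>' \<subseteq> N" "path_image (segment_of \<gamma> u v) \<subseteq> N"
          "path_image \<eta> \<subseteq> N"
          using x'(2) \<beta>'(2) Wi N(3) \<eta>(2) by blast+
        ultimately have "homotopic_paths D (\<beta> +++ \<eta>) (segment_of \<gamma> u v +++ \<beta>')"
          using \<eta>(1,3,4) sub[of u v] 01
          by (intro path_trivialD[OF N(2) _ _ _ _ _ _ N(1)] subset_path_image_join) simp_all
        then show "\<exists>\<beta>' \<eta>. valid v \<beta>' \<and> path \<eta> \<and> path_image \<eta> \<subseteq> V \<and> pathstart \<eta> = pathfinish \<beta> \<and>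
        pathfinish \<eta> = pathfinish \<beta>' \<and> homotopic_paths D (\<beta> +++ \<eta>) (segment_of \<gamma> u v +++ \<beta>')"
          using \<beta>'(1) \<eta> by (intro exI[of _ \<beta>'] exI[of _ \<eta>]) simp
      qed
      then show ?thesis using d(1) by blast
    qed
  qed
  moreover have "valid 0 (\<lambda>_. \<gamma> 0)"
    using \<gamma>(3) by (simp add: valid_def path_const pathstart_def)
  ultimately have "\<exists>\<beta> \<eta>. valid 1 \<beta> \<and> path \<eta> \<and> path_image \<eta> \<subseteq> V \<and> pathstart \<eta> = pathfinish (\<lambda>_::real. \<gamma> 0) \<and>
      pathfinish \<eta> = pathfinish \<beta> \<and> homotopic_paths D ((\<lambda>_. \<gamma> 0) +++ \<eta>) (segment_of \<gamma> 0 1 +++ \<beta>)"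
    unfolding P_def by simp
  then obtain \<beta> \<eta> where \<eta>: "valid 1 \<beta>" "path \<eta>" "path_image \<eta> \<subseteq> V" "pathstart \<eta> = \<gamma> 0"
    "homotopic_paths D ((\<lambda>_. \<gamma> 0) +++ \<eta>) (segment_of \<gamma> 0 1 +++ \<beta>)"
    unfolding path_const(4) by (elim exE conjE)
  have \<beta>: "\<beta> = (\<lambda>_. \<gamma> 1)"
    using \<eta>(1) \<gamma>(4) by (simp add: valid_def pathfinish_def)
  have "homotopic_paths D \<gamma> (\<gamma> +++ \<beta>)"
    unfolding \<beta> by (rule homotopic_paths_sym, rule homotopic_paths_const_right)
      (use \<gamma>(1) \<gamma>D in \<open>auto simp: pathfinish_def\<close>)
  also have "homotopic_paths D \<dots> ((\<lambda>_. \<gamma> 0) +++ \<eta>)"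
    using \<eta>(5) by (simp add: homotopic_paths_sym segment_of_def linepath_def comp_def)
  also have "homotopic_paths D \<dots> \<eta>"
    by (rule homotopic_paths_const_left) (use \<eta> V(2) in auto)
  finally show ?thesis using \<eta> by blast
qed

section \<open>Raising a path above a level\<close>

definition strict_local_max :: "('a::topological_space \<Rightarrow> real) \<Rightarrow> 'a \<Rightarrow> bool" where
  "strict_local_max \<phi> p \<longleftrightarrow> (\<exists>Q. open Q \<and> p \<in> Q \<and> (\<forall>x\<in>Q - {p}. \<phi> x < \<phi> p))"

text \<open>
  Connectedness of \<open>{x. \<phi> p < \<phi> x}\<close> near \<open>p\<close> is meant in the sense that suits neighborhood bases: points of
  a smaller neighborhood can be joined inside any prescribed one.
\<close>

definition connected_above :: "('a::topological_space \<Rightarrow> real) \<Rightarrow> 'a \<Rightarrow> bool" where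
  "connected_above \<phi> p \<longleftrightarrow> (\<forall>Q. open Q \<and> p \<in> Q \<longrightarrow>
     (\<exists>x\<in>Q. \<phi> p < \<phi> x) \<and>
     (\<exists>Q'. open Q' \<and> p \<in> Q' \<and> Q' \<subseteq> Q \<and>
        (\<forall>a\<in>Q'. \<forall>b\<in>Q'. \<phi> p < \<phi> a \<and> \<phi> p < \<phi> b \<longrightarrow> path_component (Q \<inter> {x. \<phi> p < \<phi> x}) a b)))"

text \<open>
  The compact \<open>F\<close> keeps closed sets inside \<open>Q\<close> at hand: the frontier of \<open>B\<close> is compact, and \<open>F\<close> is the
  middle set in \<open>star_refinement\<close>.
\<close>

definition has_cells_at :: "'a::topological_space \<Rightarrow> bool" where
  "has_cells_at p \<longleftrightarrow> (\<forall>Q. open Q \<and> p \<in> Q \<longrightarrow>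
     (\<exists>B F. open B \<and> p \<in> B \<and> B \<subseteq> F \<and> compact F \<and> F \<subseteq> Q \<and> path_connected B \<and> path_trivial B))"

lemma compact_less_gap:
  fixes \<phi> :: "'a::topological_space \<Rightarrow> real"
  assumes "compact E" "continuous_on E \<phi>" "\<And>x. x \<in> E \<Longrightarrow> \<phi> x < c"
  shows "\<exists>\<delta>>0. \<forall>x\<in>E. \<phi> x \<le> c - \<delta>"
proof (cases "E = {}")
  case True
  then show ?thesis by (intro exI[of _ 1]) auto
next
  case False
  then obtain y where "y \<in> E" "\<forall>x\<in>E. \<phi> x \<le> \<phi> y"
    using continuous_attains_sup[OF assms(1) _ assms(2)] by blast
  then show ?thesis using assms(3) by (intro exI[of _ "c - \<phi> y"]) auto
qed

text \<open>
  The points of level \<open>c\<close> in \<open>D\<close> form a compact set. Its part \<open>K\<close> in the closure of \<open>V = {x \<in> D. \<phi> x > c}\<close>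
  contains no strict local maxima, so \<open>V\<close> is connected near each of its points, and a star refinement
  of such neighborhoods meets the requirements of \<open>path_homotopic_into_open\<close>. The rest of the level
  consists of strict local maxima. Each has a neighborhood on whose frontier \<open>\<phi> \<le> c - \<delta>\<close>, so a path in
  \<open>{\<phi> > c - \<delta>}\<close> that starts above \<open>c\<close> never enters it. Finitely many of these neighborhoods suffice,
  and by compactness the points of \<open>D\<close> with level in \<open>{c - \<delta>..c}\<close> are all covered for small \<open>\<delta>\<close>.
\<close>

lemma raise_level:
  fixes \<phi> :: "'a::t2_space \<Rightarrow> real"
  assumes D: "open D" and \<phi>: "continuous_on UNIV \<phi>"
    and cpt: "\<And>a b. s < a \<Longrightarrow> compact (D \<inter> \<phi> -` {a..b})"
    and cells: "\<And>p. p \<in> D \<Longrightarrow> has_cells_at p"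
    and loc: "\<And>p. p \<in> D \<Longrightarrow> strict_local_max \<phi> p \<or> connected_above \<phi> p"
    and "s < c"
  shows "\<exists>\<delta>>0. \<forall>\<gamma>. path \<gamma> \<and> path_image \<gamma> \<subseteq> D \<inter> \<phi> -` {c - \<delta><..} \<and>
      c < \<phi> (pathstart \<gamma>) \<and> c < \<phi> (pathfinish \<gamma>) \<longrightarrow>
      (\<exists>h. path h \<and> path_image h \<subseteq> D \<inter> \<phi> -` {c<..} \<and> homotopic_paths D \<gamma> h)"
proof -
  define V where "V = D \<inter> \<phi> -` {c<..}"
  have V: "open V" "V \<subseteq> D"
    using D \<phi> by (auto simp: V_def intro!: open_Int open_vimage)
  define L where "L = D \<inter> \<phi> -` {c..c}"
  have L: "compact L" "\<And>p. p \<in> L \<longleftrightarrow> p \<in> D \<and> \<phi> p = c"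
    using cpt[OF \<open>s < c\<close>, of c] by (auto simp: L_def)
  define K where "K = L \<inter> closure V"
  have K: "compact K" unfolding K_def using L(1) by (intro compact_Int_closed) auto
  have KL: "p \<in> D" "\<phi> p = c" if "p \<in> K" for p
    using that L(2) by (auto simp: K_def)
  have meets: "Q \<inter> V \<noteq> {}" if "p \<in> K" "open Q" "p \<in> Q" for p Q
    using that unfolding K_def by (metis IntD2 open_Int_closure_eq_empty disjoint_iff)
  have "\<exists>N Q G F. open N \<and> N \<subseteq> D \<and> path_trivial N \<and> open Q \<and> Q \<subseteq> N \<and>
      (\<forall>a\<in>Q. \<forall>b\<in>Q. c < \<phi> a \<and> c < \<phi> b \<longrightarrow> path_component (N \<inter> {x. c < \<phi> x}) a b) \<and>
      p \<in> G \<and> open G \<and> G \<subseteq> F \<and> closed F \<and> F \<subseteq> Q" if p: "p \<in> K" for p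
  proof -
    have "\<not> strict_local_max \<phi> p"
    proof
      assume "strict_local_max \<phi> p"
      then obtain Q where "open Q" "p \<in> Q" "\<forall>x\<in>Q - {p}. \<phi> x < c"
        using KL[OF p] by (auto simp: strict_local_max_def)
      moreover obtain x where "x \<in> Q" "c < \<phi> x"
        using meets[OF p calculation(1,2)] by (auto simp: V_def)
      ultimately show False using KL(2)[OF p] by (cases "x = p") (simp, meson DiffI not_less_iff_gr_or_eq singletonD)
    qed
    then have ca: "connected_above \<phi> p" using loc KL[OF p] by blast
    obtain N where N: "open N" "p \<in> N" "N \<subseteq> D" "path_trivial N"
      using cells[OF KL(1)[OF p]] KL(1)[OF p] D unfolding has_cells_at_def by (meson order_trans)
    obtain Q where Q: "open Q" "p \<in> Q" "Q \<subseteq> N" 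
      "\<forall>a\<in>Q. \<forall>b\<in>Q. c < \<phi> a \<and> c < \<phi> b \<longrightarrow> path_component (N \<inter> {x. c < \<phi> x}) a b"
      using ca N KL(2)[OF p] unfolding connected_above_def by metis
    obtain G F where "open G" "p \<in> G" "G \<subseteq> F" "compact F" "F \<subseteq> Q"
      using cells[OF KL(1)[OF p]] Q unfolding has_cells_at_def by meson
    moreover then have "closed F" by (simp add: compact_imp_closed)
    ultimately show ?thesis using N Q
      by (intro exI[of _ N] exI[of _ Q] exI[of _ G] exI[of _ F] conjI) assumption+
  qed
  then obtain N Q G F where *: "\<And>p. p \<in> K \<Longrightarrow> open (N p) \<and> N p \<subseteq> D \<and> path_trivial (N p) \<and> open (Q p) \<and> Q p \<subseteq> N p \<and>
      (\<forall>a\<in>Q p. \<forall>b\<in>Q p. c < \<phi> a \<and> c < \<phi> b \<longrightarrow> path_component (N p \<inter> {x. c < \<phi> x}) a b) \<and>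
      p \<in> G p \<and> open (G p) \<and> G p \<subseteq> F p \<and> closed (F p) \<and> F p \<subseteq> Q p"
    by metis
  have nest: "p \<in> G p \<and> open (G p) \<and> G p \<subseteq> F p \<and> closed (F p) \<and> F p \<subseteq> Q p \<and> open (Q p)" if "p \<in> K" for p
    using *[OF that] by blast
  obtain W0 where W0: "\<And>x. x \<in> K \<Longrightarrow> open (W0 x) \<and> x \<in> W0 x"
    "\<And>x y. x \<in> K \<Longrightarrow> y \<in> K \<Longrightarrow> W0 x \<inter> W0 y \<noteq> {} \<Longrightarrow> \<exists>p\<in>K. W0 x \<union> W0 y \<subseteq> Q p"
    by (rule star_refinement[OF K, of G F Q, OF nest]) auto
  have "\<exists>W. open W \<and> x \<in> W \<and> W \<subseteq> W0 x \<and> path_connected W" if "x \<in> K" for x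
    using cells[OF KL(1)[OF that]] W0(1)[OF that] unfolding has_cells_at_def by (meson order_trans)
  then obtain W where W: "\<And>x. x \<in> K \<Longrightarrow> open (W x) \<and> x \<in> W x \<and> W x \<subseteq> W0 x \<and> path_connected (W x)"
    by metis
  have push: "\<exists>h. path h \<and> path_image h \<subseteq> V \<and> homotopic_paths D \<gamma> h"
    if "path \<gamma>" "path_image \<gamma> \<subseteq> V \<union> (\<Union>x\<in>K. W x)" "pathstart \<gamma> \<in> V" "pathfinish \<gamma> \<in> V" for \<gamma>
  proof (rule path_homotopic_into_open[OF V _ _ that])
    show "open (W x) \<and> path_connected (W x) \<and> W x \<inter> V \<noteq> {}" if "x \<in> K" for x
      using W[OF that] meets[OF that] by blast
    fix x y assume xy: "x \<in> K" "y \<in> K" "W x \<inter> W y \<noteq> {}"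
    then have "W0 x \<inter> W0 y \<noteq> {}" using W by blast
    then obtain p where p: "p \<in> K" "W x \<union> W y \<subseteq> Q p" using W0(2)[OF xy(1,2)] W xy by blast
    have "N p \<inter> {x. c < \<phi> x} = N p \<inter> V" using *[OF p(1)] by (auto simp: V_def)
    moreover have "path_component (N p \<inter> {x. c < \<phi> x}) a b"
      if "a \<in> (W x \<union> W y) \<inter> V" "b \<in> (W x \<union> W y) \<inter> V" for a b
    proof -
      have "a \<in> Q p" "b \<in> Q p" "c < \<phi> a" "c < \<phi> b" using that p(2) unfolding V_def by auto
      then show ?thesis using *[OF p(1)] by blast
    qed
    ultimately have "\<forall>a\<in>(W x \<union> W y) \<inter> V. \<forall>b\<in>(W x \<union> W y) \<inter> V. path_component (N p \<inter> V) a b"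
      by simp
    then show "\<exists>N\<subseteq>D. path_trivial N \<and> W x \<union> W y \<subseteq> N \<and>
        (\<forall>a\<in>(W x \<union> W y) \<inter> V. \<forall>b\<in>(W x \<union> W y) \<inter> V. path_component (N \<inter> V) a b)"
      using *[OF p(1)] p(2) by (intro exI[of _ "N p"] conjI) auto
  qed
  define M where "M = L - (\<Union>x\<in>K. W x)"
  have M: "compact M"
    unfolding M_def using L(1) W by (intro compact_diff) auto
  have "\<exists>B \<delta>. open B \<and> p \<in> B \<and> (\<forall>x\<in>B. \<phi> x \<le> c) \<and> \<delta> > 0 \<and> (\<forall>x\<in>frontier B. \<phi> x \<le> c - \<delta>)" if p: "p \<in> M" for p
  proof -
    have pD: "p \<in> D" "\<phi> p = c" and pK: "p \<notin> K" using p L(2) W by (auto simp: M_def)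
    then have "p \<notin> closure V" using p by (auto simp: K_def M_def)
    have "\<not> connected_above \<phi> p"
    proof
      assume "connected_above \<phi> p"
      moreover have "open (- closure V \<inter> D)" "p \<in> - closure V \<inter> D"
        using D pD \<open>p \<notin> closure V\<close> by auto
      ultimately obtain x where "x \<in> - closure V \<inter> D" "c < \<phi> x"
        unfolding connected_above_def pD(2) by meson
      moreover from this have "x \<in> V" by (simp add: V_def)
      ultimately show False using closure_subset[of V] by blast
    qed
    then obtain Q where Q: "open Q" "p \<in> Q" "\<forall>x\<in>Q - {p}. \<phi> x < c"
      using loc pD by (auto simp: strict_local_max_def)
    obtain B F where B: "open B" "p \<in> B" "B \<subseteq> F" "compact F" "F \<subseteq> Q"
      using cells[OF pD(1)] Q unfolding has_cells_at_def by meson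
    have "closure B \<subseteq> F" using B compact_imp_closed closure_minimal by blast
    then have fr: "frontier B \<subseteq> F - B" using B(1) by (auto simp: frontier_def interior_open)
    then have "compact (frontier B)"
      using B(4) by (metis Diff_subset closed_Int_compact frontier_closed inf.absorb_iff1 order_trans)
    moreover have "\<phi> x < c" if "x \<in> frontier B" for x using fr that Q(3) B by blast
    ultimately obtain \<delta> where "\<delta> > 0" "\<forall>x\<in>frontier B. \<phi> x \<le> c - \<delta>"
      using compact_less_gap[OF _ continuous_on_subset[OF \<phi> subset_UNIV]] by blast
    moreover have "\<forall>x\<in>B. \<phi> x \<le> c" using Q(3) B pD(2) by (metis Diff_iff less_eq_real_def singletonD subsetD)
    ultimately show ?thesis using B by blast
  qed
  then obtain B \<delta> where B: "\<And>p. p \<in> M \<Longrightarrow> open (B p) \<and> p \<in> B p \<and> (\<forall>x\<in>B p. \<phi> x \<le> c) \<and> \<delta> p > 0 \<and>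
      (\<forall>x\<in>frontier (B p). \<phi> x \<le> c - \<delta> p)"
    by metis
  obtain I where I: "I \<subseteq> M" "finite I" "M \<subseteq> (\<Union>p\<in>I. B p)"
    using compactE_image[OF M, of M B] B by blast
  \<comment> \<open>\<open>E\<close> is what the chosen neighborhoods miss just below \<open>c\<close>; the lower bound only has to lie above \<open>s\<close>\<close>
  define E where "E = D \<inter> \<phi> -` {(s + c) / 2..c} - (\<Union>x\<in>K. W x) - (\<Union>p\<in>I. B p)"
  have "open (\<Union>x\<in>K. W x)" "open (\<Union>p\<in>I. B p)"
    using W B I(1) by blast+
  then have "compact E"
    unfolding E_def using \<open>s < c\<close> by (intro compact_diff cpt) auto
  moreover have "\<phi> x < c" if "x \<in> E" for x
  proof -
    have "x \<notin> L" using that I(3) by (auto simp: E_def M_def)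
    then show ?thesis using that L(2) by (force simp: E_def)
  qed
  ultimately obtain \<delta>0 where \<delta>0: "\<delta>0 > 0" "\<forall>x\<in>E. \<phi> x \<le> c - \<delta>0"
    using compact_less_gap[OF _ continuous_on_subset[OF \<phi> subset_UNIV]] by blast
  have "\<exists>d>0. \<forall>p\<in>I. d \<le> \<delta> p"
  proof (cases "I = {}")
    case False
    then show ?thesis using I(1,2) B by (intro exI[of _ "Min (\<delta> ` I)"]) (auto simp: Min_gr_iff)
  qed (auto intro: exI[of _ 1])
  then obtain d where d: "d > 0" "\<And>p. p \<in> I \<Longrightarrow> d \<le> \<delta> p" by blast
  define \<delta>' where "\<delta>' = min d (min \<delta>0 ((c - s) / 2))"
  have \<delta>': "\<delta>' > 0" "\<delta>' \<le> \<delta>0" "\<delta>' \<le> (c - s) / 2"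
    unfolding \<delta>'_def using d(1) \<delta>0(1) \<open>s < c\<close>
    by (simp, blast intro: min.coboundedI2 min.cobounded1, blast intro: min.coboundedI2 min.cobounded2)
  have \<delta>'_le: "\<delta>' \<le> \<delta> p" if "p \<in> I" for p
    using d(2)[OF that] by (simp add: \<delta>'_def min_le_iff_disj)
  show ?thesis
  proof (rule exI[of _ \<delta>'], intro conjI allI impI)
    fix \<gamma> :: "real \<Rightarrow> 'a"
    assume "path \<gamma> \<and> path_image \<gamma> \<subseteq> D \<inter> \<phi> -` {c - \<delta>'<..} \<and> c < \<phi> (pathstart \<gamma>) \<and> c < \<phi> (pathfinish \<gamma>)"
    then have \<gamma>: "path \<gamma>" "path_image \<gamma> \<subseteq> D" "\<And>x. x \<in> path_image \<gamma> \<Longrightarrow> c - \<delta>' < \<phi> x"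
      "c < \<phi> (pathstart \<gamma>)" "c < \<phi> (pathfinish \<gamma>)" by auto
    have avoid: "y \<notin> B p" if "p \<in> I" "y \<in> path_image \<gamma>" for p y
    proof
      assume "y \<in> B p"
      moreover have "pathstart \<gamma> \<notin> B p" using B I \<gamma>(4) that(1) by force
      ultimately have "path_image \<gamma> \<inter> frontier (B p) \<noteq> {}"
        using that(2) pathstart_in_path_image[of \<gamma>] connected_path_image[OF \<gamma>(1)]
        by (intro connected_Int_frontier) auto
      then show False using B I that(1) \<delta>'_le[OF that(1)] \<gamma>(3) by fastforce
    qed
    have "y \<in> V \<union> (\<Union>x\<in>K. W x)" if y: "y \<in> path_image \<gamma>" for y
    proof (rule ccontr)
      assume n: "y \<notin> V \<union> (\<Union>x\<in>K. W x)"
      have "y \<in> D" using \<gamma> y by blast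
      then have "\<phi> y \<le> c" using n by (auto simp: V_def)
      then have "y \<in> E" using n avoid[OF _ y] \<open>y \<in> D\<close> \<gamma>(3)[OF y] \<delta>'(3) by (auto simp: E_def field_simps)
      then show False using \<delta>0(2) \<gamma>(3)[OF y] \<delta>'(2) by force
    qed
    then have sub: "path_image \<gamma> \<subseteq> V \<union> (\<Union>x\<in>K. W x)" by (rule subsetI)
    have ends: "pathstart \<gamma> \<in> V" "pathfinish \<gamma> \<in> V"
      using \<gamma>(2,4,5) pathstart_in_path_image[of \<gamma>] pathfinish_in_path_image[of \<gamma>] by (auto simp: V_def)
    show "\<exists>h. path h \<and> path_image h \<subseteq> D \<inter> \<phi> -` {c<..} \<and> homotopic_paths D \<gamma> h"
      using push[OF \<gamma>(1) sub ends] by (simp add: V_def)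
  qed (rule \<delta>'(1))
qed

text \<open>
  As its image is compact, the path lies above some level greater than \<open>s\<close>. The supremum of the levels above which
  it can be moved is itself reached, by \<open>raise_level\<close>, and the compactness of the moved path makes
  it exceed the supremum again unless that is \<open>s'\<close>.
\<close>

lemma path_homotopic_above_level:
  fixes \<phi> :: "'a::t2_space \<Rightarrow> real"
  assumes D: "open D" and \<phi>: "continuous_on UNIV \<phi>"
    and low: "D \<subseteq> \<phi> -` {s<..}"
    and cpt: "\<And>a b. s < a \<Longrightarrow> compact (D \<inter> \<phi> -` {a..b})"
    and cells: "\<And>p. p \<in> D \<Longrightarrow> has_cells_at p"
    and loc: "\<And>p. p \<in> D \<Longrightarrow> strict_local_max \<phi> p \<or> connected_above \<phi> p"
    and s': "s < s'"
    and \<gamma>: "path \<gamma>" "path_image \<gamma> \<subseteq> D" "s' < \<phi> (pathstart \<gamma>)" "s' < \<phi> (pathfinish \<gamma>)"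
  shows "\<exists>h. path h \<and> path_image h \<subseteq> D \<inter> \<phi> -` {s'<..} \<and> homotopic_paths D \<gamma> h"
proof -
  define A where "A = {c. s < c \<and> c \<le> s' \<and>
    (\<exists>h. path h \<and> path_image h \<subseteq> D \<inter> \<phi> -` {c<..} \<and> homotopic_paths D \<gamma> h)}"
  have slack: "\<exists>c'\<in>A. c < c'"
    if h: "path h" "path_image h \<subseteq> D \<inter> \<phi> -` {c<..}" "homotopic_paths D \<gamma> h" and c: "s \<le> c" "c < s'" for h c
  proof -
    obtain y where y: "y \<in> path_image h" "\<And>x. x \<in> path_image h \<Longrightarrow> \<phi> y \<le> \<phi> x"
      using continuous_attains_inf[OF compact_path_image[OF h(1)], of \<phi>] \<phi> path_image_nonempty[of h]
      by (meson continuous_on_subset subset_UNIV)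
    let ?c = "min ((c + \<phi> y) / 2) s'"
    have "c < \<phi> y" using y h by auto
    then have c': "c < ?c" "?c < \<phi> y" using c by (auto simp: min_def)
    then have "path_image h \<subseteq> D \<inter> \<phi> -` {?c<..}" using y(2) h(2) by fastforce
    then have "?c \<in> A" using h c c' by (auto simp: A_def simp del: min_less_iff_conj)
    then show ?thesis using c' by blast
  qed
  have "A \<noteq> {}"
    using slack[of \<gamma> s] \<gamma> low s' by (auto simp: homotopic_paths_refl)
  have bdd: "bdd_above A" by (auto simp: A_def intro: bdd_aboveI[of _ s'])
  define c where "c = Sup A"
  have c: "s < c" "c \<le> s'"
    using \<open>A \<noteq> {}\<close> bdd unfolding c_def
    by (auto simp: less_cSup_iff A_def intro!: cSup_least)
  obtain \<delta> where \<delta>: "\<delta> > 0" "\<forall>\<gamma>. path \<gamma> \<and> path_image \<gamma> \<subseteq> D \<inter> \<phi> -` {c - \<delta><..} \<and>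
      c < \<phi> (pathstart \<gamma>) \<and> c < \<phi> (pathfinish \<gamma>) \<longrightarrow>
      (\<exists>h. path h \<and> path_image h \<subseteq> D \<inter> \<phi> -` {c<..} \<and> homotopic_paths D \<gamma> h)"
    using raise_level[OF D \<phi> cpt cells loc c(1)] by blast
  have "\<exists>c1\<in>A. c - \<delta> < c1"
    using \<open>A \<noteq> {}\<close> bdd \<delta>(1) less_cSup_iff[of A "c - \<delta>"] by (simp add: c_def)
  then obtain c1 h1 where h1: "c - \<delta> < c1" "path h1" "path_image h1 \<subseteq> D \<inter> \<phi> -` {c1<..}" "homotopic_paths D \<gamma> h1"
    by (auto simp: A_def)
  have "path_image h1 \<subseteq> D \<inter> \<phi> -` {c - \<delta><..}" using h1(1,3) by fastforce
  moreover have "c < \<phi> (pathstart h1)" "c < \<phi> (pathfinish h1)"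
    using homotopic_paths_imp_pathstart[OF h1(4)] homotopic_paths_imp_pathfinish[OF h1(4)] \<gamma> c(2) by auto
  ultimately obtain h2 where h2: "path h2" "path_image h2 \<subseteq> D \<inter> \<phi> -` {c<..}" "homotopic_paths D h1 h2"
    using \<delta>(2) h1(2) by blast
  have h2': "homotopic_paths D \<gamma> h2" using h1(4) h2(3) by (rule homotopic_paths_trans)
  have "c = s'"
  proof (rule ccontr)
    assume "c \<noteq> s'"
    then obtain c' where "c' \<in> A" "c < c'" using slack[OF h2(1,2) h2'] c by auto
    then show False using bdd cSup_upper unfolding c_def by (metis linorder_not_less)
  qed
  then show ?thesis using h2 h2' by blast
qed

section \<open>Nondegenerate quadratic forms\<close>

lemma bilinear_zero:
  fixes H :: "'e::euclidean_space \<Rightarrow> 'e \<Rightarrow> real"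
  assumes "bilinear H"
  shows "H 0 y = 0" "H x 0 = 0"
  using assms by (simp_all add: bilinear_lzero bilinear_rzero)

text \<open>
  Sylvester's law in the form needed here. \<open>W\<close> is a negative definite subspace of maximal dimension \<open>k\<close>
  and \<open>P\<close> its orthogonal complement for \<open>H\<close>. Counting dimensions, \<open>W\<close> and \<open>P\<close> span the space. A vector \<open>y\<close>
  of \<open>P\<close> with \<open>H y y < 0\<close> could be added to \<open>W\<close>, so \<open>H\<close> is nonnegative on \<open>P\<close>; a nonzero \<open>y\<close> with \<open>H y y = 0\<close>
  would then be orthogonal to \<open>P\<close>, hence to everything.
\<close>

lemma definite_decomposition:
  fixes H :: "'e::euclidean_space \<Rightarrow> 'e \<Rightarrow> real"
  assumes H: "bilinear H" and sym: "\<And>x y. H x y = H y x"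
    and nondeg: "\<And>x. (\<And>y. H x y = 0) \<Longrightarrow> x = 0"
    and k: "k = Max {dim W | W. subspace W \<and> (\<forall>w\<in>W. w \<noteq> 0 \<longrightarrow> H w w < 0)}"
  obtains W P where "subspace W" "subspace P" "dim W = k" "dim P + k = DIM('e)"
    "\<And>x. \<exists>w\<in>W. \<exists>y\<in>P. x = w + y" "\<And>w y. w \<in> W \<Longrightarrow> y \<in> P \<Longrightarrow> H w y = 0"
    "\<And>w. w \<in> W \<Longrightarrow> w \<noteq> 0 \<Longrightarrow> H w w < 0" "\<And>y. y \<in> P \<Longrightarrow> y \<noteq> 0 \<Longrightarrow> 0 < H y y"
proof -
  let ?N = "{dim W | W. subspace W \<and> (\<forall>w\<in>W. w \<noteq> 0 \<longrightarrow> H w w < 0)}"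
  have fin: "finite ?N"
    by (rule finite_subset[of _ "{..DIM('e)}"]) (auto simp: dim_subset_UNIV)
  have "dim {0::'e} \<in> ?N" by (auto intro!: exI[of _ "{0::'e}"] subspace_single_0 simp del: dim_singleton)
  then have "k \<in> ?N" unfolding k using fin by (intro Max_in) auto
  then obtain W where W: "subspace W" "dim W = k" "\<And>w. w \<in> W \<Longrightarrow> w \<noteq> 0 \<Longrightarrow> H w w < 0"
    by blast
  have maxi: "dim W' \<le> k" if "subspace W'" "\<And>w. w \<in> W' \<Longrightarrow> w \<noteq> 0 \<Longrightarrow> H w w < 0" for W'
    unfolding k using fin that by (intro Max_ge) auto
  note bl = bilinear_ladd[OF H] bilinear_radd[OF H] bilinear_lmul[OF H] bilinear_rmul[OF H] bilinear_zero[OF H]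
  define P where "P = {x. \<forall>w\<in>W. H w x = 0}"
  have P: "subspace P" by (auto simp: P_def subspace_def bl)
  have WP: "W \<inter> P = {0}"
    using W subspace_0[OF W(1)] subspace_0[OF P] by (force simp: P_def)
  \<comment> \<open>the vector that represents the functional \<open>H x\<close>; it turns \<open>P\<close> into a Euclidean orthogonal complement\<close>
  define A where "A x = (\<Sum>b\<in>Basis. H x b *\<^sub>R b)" for x
  have A: "linear A"
    by (rule linearI) (simp_all add: A_def bl sum.distrib scaleR_left_distrib scaleR_sum_right)
  have HA: "H x y = A x \<bullet> y" for x y
  proof -
    have "H x y = H x (\<Sum>b\<in>Basis. (y \<bullet> b) *\<^sub>R b)" by (simp add: euclidean_representation)
    also have "\<dots> = (\<Sum>b\<in>Basis. (y \<bullet> b) * H x b)"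
    proof -
      have "linear (H x)" using H by (simp add: bilinear_def)
      from linear_sum[OF this, of "\<lambda>b. (y \<bullet> b) *\<^sub>R b" Basis] show ?thesis
        by (simp only: bilinear_rmul[OF H] real_scaleR_def)
    qed
    also have "\<dots> = A x \<bullet> y"
      unfolding A_def inner_sum_left inner_scaleR_left
      by (intro sum.cong refl) (simp add: inner_commute[of y] mult.commute)
    finally show ?thesis .
  qed
  have "P = {y \<in> UNIV. \<forall>x\<in>A ` W. orthogonal x y}"
    by (auto simp: P_def HA orthogonal_def)
  then have "dim P + dim (A ` W) = DIM('e)"
    using dim_subspace_orthogonal_to_vectors[of "A ` W" UNIV] linear_subspace_image[OF A W(1)] by simp
  moreover have "dim (A ` W) \<le> dim W" by (rule dim_image_le[OF A])
  moreover have sums: "dim {x + y |x y. x \<in> W \<and> y \<in> P} + dim (W \<inter> P) = dim W + dim P"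
    by (rule dim_sums_Int[OF W(1) P])
  moreover have "dim {x + y |x y. x \<in> W \<and> y \<in> P} \<le> DIM('e)" by (rule dim_subset_UNIV)
  ultimately have dims: "dim P + k = DIM('e)" "dim {x + y |x y. x \<in> W \<and> y \<in> P} = DIM('e)"
    using W(2) WP by auto
  have "{x + y |x y. x \<in> W \<and> y \<in> P} = UNIV"
    using dims(2) subspace_sums[OF W(1) P] by (simp add: dim_eq_full span_eq_iff[THEN iffD2])
  then have dec: "\<exists>w\<in>W. \<exists>y\<in>P. x = w + y" for x by blast
  have spW: "span W = W" using W(1) by (rule span_eq_iff[THEN iffD2])
  have nonneg: "0 \<le> H y y" if y: "y \<in> P" for y
  proof (rule ccontr)
    assume neg: "\<not> 0 \<le> H y y"
    then have "y \<noteq> 0" by (auto simp: bl)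
    then have "y \<notin> W" using y WP by blast
    then have "dim (insert y W) = k + 1"
      unfolding dim_insert spW using W(2) by simp
    moreover have "dim (span (insert y W)) \<le> k"
    proof (rule maxi)
      fix z assume z: "z \<in> span (insert y W)" "z \<noteq> 0"
      then obtain c where "z - c *\<^sub>R y \<in> W"
        unfolding span_insert spW by blast
      then obtain w where w: "w \<in> W" "z = w + c *\<^sub>R y" by (metis diff_add_cancel)
      have "H w y = 0" "H y w = 0" using y w(1) sym by (auto simp: P_def)
      then have Hz: "H z z = H w w + c * c * H y y" by (simp add: w(2) bl)
      have "H w w \<le> 0" using W(3)[OF w(1)] bl by (cases "w = 0") auto
      moreover have "c * c * H y y \<le> 0" using neg by (simp add: mult_nonneg_nonpos)
      moreover have "H w w < 0 \<or> c * c * H y y < 0"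
      proof (cases "w = 0")
        case True
        then have "0 < c * c" using z(2) w(2) by (auto simp: zero_less_mult_iff)
        then show ?thesis using neg by (simp add: mult_pos_neg)
      qed (use W(3)[OF w(1)] in simp)
      ultimately show "H z z < 0" using Hz by linarith
    qed simp
    ultimately show False by simp
  qed
  have pos: "0 < H y y" if y: "y \<in> P" "y \<noteq> 0" for y
  proof (rule ccontr)
    assume "\<not> 0 < H y y"
    then have y0: "H y y = 0" using nonneg[OF y(1)] by simp
    have "H y z = 0" if z: "z \<in> P" for z
    proof (rule ccontr)
      assume n: "H y z \<noteq> 0"
      \<comment> \<open>\<open>H z z + 2 t H y z\<close> takes the value \<open>-1\<close> at this \<open>t\<close>\<close>
      define t where "t = - (H z z + 1) / (2 * H y z)"
      have "z + t *\<^sub>R y \<in> P" using P y(1) z by (simp add: subspace_add subspace_scale)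
      from nonneg[OF this] have "0 \<le> H z z + 2 * t * H y z"
        using y0 sym[of z y] by (simp add: bl algebra_simps)
      then show False using n by (simp add: t_def field_simps)
    qed
    moreover have "H y w = 0" if "w \<in> W" for w using that y(1) sym by (auto simp: P_def)
    ultimately have "H y x = 0" for x using dec[of x] by (auto simp: bl)
    then show False using nondeg y(2) by blast
  qed
  show ?thesis
    by (rule that[OF W(1) P W(2) dims(1) dec _ W(3) pos]) (auto simp: P_def)
qed

lemma positive_on_subspace_bound:
  fixes H :: "'e::euclidean_space \<Rightarrow> 'e \<Rightarrow> real"
  assumes H: "bilinear H" and P: "subspace P" and pos: "\<And>y. y \<in> P \<Longrightarrow> y \<noteq> 0 \<Longrightarrow> 0 < H y y"
  shows "\<exists>m>0. \<forall>y\<in>P. m * (norm y)\<^sup>2 \<le> H y y"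
proof (cases "sphere 0 1 \<inter> P = {}")
  case True
  have "y = 0" if "y \<in> P" for y
  proof (rule ccontr)
    assume "y \<noteq> 0"
    then have "(1 / norm y) *\<^sub>R y \<in> sphere 0 1 \<inter> P" using that P by (simp add: subspace_scale)
    then show False using True by blast
  qed
  then have "1 * (norm y)\<^sup>2 \<le> H y y" if "y \<in> P" for y
    unfolding \<open>\<And>y. y \<in> P \<Longrightarrow> y = 0\<close>[OF that] by (simp add: bilinear_zero[OF H])
  then show ?thesis by (intro exI[of _ 1] conjI ballI) auto
next
  case False
  have "continuous_on (sphere 0 1 \<inter> P) (\<lambda>y. H y y)"
    by (rule bounded_bilinear.continuous_on[OF H[unfolded bilinear_conv_bounded_bilinear]])
      (rule continuous_on_id)+
  moreover have "compact (sphere 0 1 \<inter> P)"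
    using closed_subspace[OF P] by (simp add: compact_Int_closed)
  ultimately obtain u where u: "u \<in> sphere 0 1 \<inter> P" "\<And>y. y \<in> sphere 0 1 \<inter> P \<Longrightarrow> H u u \<le> H y y"
    using continuous_attains_inf[OF _ False, of "\<lambda>y. H y y"] by blast
  have "H u u * (norm y)\<^sup>2 \<le> H y y" if y: "y \<in> P" for y
  proof (cases "y = 0")
    case False
    then have "(1 / norm y) *\<^sub>R y \<in> sphere 0 1 \<inter> P" using y P by (simp add: subspace_scale)
    from u(2)[OF this] have "H u u \<le> H y y / (norm y)\<^sup>2"
      by (simp add: bilinear_lmul[OF H] bilinear_rmul[OF H] power2_eq_square)
    then show ?thesis using False by (simp add: field_simps)
  qed (simp add: bilinear_zero[OF H])
  moreover have "0 < H u u" using u(1) by (intro pos) auto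
  ultimately show ?thesis by blast
qed

text \<open>
  This is where the codimension of the index enters: in dimension 1 the sphere is disconnected.
\<close>

lemma path_connected_subspace_sphere:
  fixes P :: "'e::euclidean_space set"
  assumes "subspace P" "2 \<le> dim P" "0 < \<rho>"
  shows "path_connected {y \<in> P. norm y = \<rho>}"
proof -
  have "path_connected (P - {0})"
    using assms by (intro path_connected_punctured_convex) (auto simp: subspace_imp_convex aff_dim_subspace)
  moreover have "continuous_on (P - {0}) (\<lambda>x. (\<rho> / norm x) *\<^sub>R x)"
    by (intro continuous_intros) auto
  ultimately have "path_connected ((\<lambda>x. (\<rho> / norm x) *\<^sub>R x) ` (P - {0}))"
    by (rule path_connected_continuous_image[rotated])
  moreover have "(\<lambda>x. (\<rho> / norm x) *\<^sub>R x) ` (P - {0}) = {y \<in> P. norm y = \<rho>}"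
  proof safe
    fix y assume "y \<in> P" "\<rho> = norm y"
    then show "y \<in> (\<lambda>x. (norm y / norm x) *\<^sub>R x) ` (P - {0})"
      using assms(3) by (intro image_eqI[of _ _ y]) auto
  qed (use assms in \<open>auto simp: subspace_scale\<close>)
  ultimately show ?thesis by simp
qed

section \<open>Superlevel sets near critical and regular points\<close>

lemma has_derivative_along_line:
  fixes g :: "'e::real_normed_vector \<Rightarrow> real"
  assumes "(g has_derivative L) (at (a + t *\<^sub>R y))"
  shows "((\<lambda>t. g (a + t *\<^sub>R y)) has_real_derivative L y) (at t)"
proof -
  have "((\<lambda>t. g (a + t *\<^sub>R y)) has_derivative (\<lambda>h. L (h *\<^sub>R y))) (at t)"
    by (rule has_derivative_compose[of "\<lambda>t. a + t *\<^sub>R y" "\<lambda>h. h *\<^sub>R y" t UNIV g, simplified])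
      (auto intro!: derivative_eq_intros assms)
  moreover have "L (h *\<^sub>R y) = h * L y" for h
    using linear_cmul[OF has_derivative_linear[OF assms], of h y] by simp
  ultimately show ?thesis
    by (simp add: has_field_derivative_def mult.commute[of _ "L y"])
qed

lemma has_derivative_translate:
  assumes "(g has_derivative L) (at (x0 + x))"
  shows "((\<lambda>x. g (x0 + x)) has_derivative L) (at x)"
  by (rule has_derivative_compose[of "\<lambda>x. x0 + x" "\<lambda>v. v" x UNIV g L, simplified])
    (auto intro!: derivative_eq_intros assms)

lemma smooth_on_derivatives:
  assumes "smooth_on S g" "x \<in> S"
  shows "(g has_derivative frechet_derivative g (at x)) (at x)"
    and "(\<lambda>x. frechet_derivative g (at x) v) differentiable (at x)"
proof -
  have "Ck_on (Suc (Suc 0)) S g" using assms(1) unfolding smooth_on_def by (rule spec)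
  then show "(g has_derivative frechet_derivative g (at x)) (at x)"
    and "(\<lambda>x. frechet_derivative g (at x) v) differentiable (at x)"
    using assms(2) by (auto simp flip: frechet_derivative_works)
qed

text \<open>
  A function near a critical point at the origin, with \<open>H x v\<close> the first order term in \<open>x\<close> of the
  derivative \<open>g' x v\<close>. Symmetry of \<open>H\<close> is a consequence.
\<close>

locale critical_expansion =
  fixes g :: "'e::euclidean_space \<Rightarrow> real" and g' H :: "'e \<Rightarrow> 'e \<Rightarrow> real"
  assumes deriv: "\<exists>R>0. \<forall>x\<in>ball 0 R. (g has_derivative g' x) (at x)"
    and approx: "\<And>\<epsilon>. \<epsilon> > 0 \<Longrightarrow> \<exists>r>0. \<forall>x\<in>ball 0 r. \<forall>v. \<bar>g' x v - H x v\<bar> \<le> \<epsilon> * norm x * norm v"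
    and H: "bilinear H"
begin

lemmas bl = bilinear_ladd[OF H] bilinear_radd[OF H] bilinear_lmul[OF H] bilinear_rmul[OF H] bilinear_zero[OF H]

lemma good_radius:
  assumes "\<epsilon> > 0"
  obtains r where "r > 0" "\<And>x. x \<in> ball 0 r \<Longrightarrow> (g has_derivative g' x) (at x)"
    "\<And>x v. x \<in> ball 0 r \<Longrightarrow> \<bar>g' x v - H x v\<bar> \<le> \<epsilon> * norm x * norm v"
proof -
  obtain R where R: "R > 0" "\<forall>x\<in>ball 0 R. (g has_derivative g' x) (at x)" using deriv by blast
  obtain r where r: "r > 0" "\<forall>x\<in>ball 0 r. \<forall>v. \<bar>g' x v - H x v\<bar> \<le> \<epsilon> * norm x * norm v"
    using approx[OF assms] by blast
  show ?thesis using R r by (intro that[of "min r R"]) auto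
qed

lemma taylor:
  assumes "\<epsilon> > 0"
  obtains r where "r > 0" "\<And>x. x \<in> ball 0 r \<Longrightarrow> \<bar>g x - g 0 - H x x / 2\<bar> \<le> \<epsilon> * (norm x)\<^sup>2"
proof -
  obtain r where r: "r > 0" "\<And>x. x \<in> ball 0 r \<Longrightarrow> (g has_derivative g' x) (at x)"
    "\<And>x v. x \<in> ball 0 r \<Longrightarrow> \<bar>g' x v - H x v\<bar> \<le> \<epsilon> * norm x * norm v"
    using good_radius[OF assms] by blast
  show ?thesis
  proof (rule that[OF r(1)])
    fix x :: 'e assume x: "x \<in> ball 0 r"
    have tx: "t *\<^sub>R x \<in> ball 0 r" "norm (t *\<^sub>R x) \<le> norm x" if "0 \<le> t" "t \<le> 1" for t
    proof -
      show "norm (t *\<^sub>R x) \<le> norm x" using that by (simp add: mult_left_le_one_le)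
      then show "t *\<^sub>R x \<in> ball 0 r" using x by simp
    qed
    have d: "((\<lambda>t. g (t *\<^sub>R x) - t\<^sup>2 / 2 * H x x) has_real_derivative g' (t *\<^sub>R x) x - t * H x x) (at t)"
      if "0 \<le> t" "t \<le> 1" for t
      using has_derivative_along_line[of g "g' (t *\<^sub>R x)" 0 t x] r(2) tx(1)[OF that]
      by (auto intro!: derivative_eq_intros)
    obtain t where t: "0 < t" "t < 1"
      "(g (1 *\<^sub>R x) - 1\<^sup>2 / 2 * H x x) - (g (0 *\<^sub>R x) - 0\<^sup>2 / 2 * H x x) = (1 - 0) * (g' (t *\<^sub>R x) x - t * H x x)"
      using MVT2[of 0 1 "\<lambda>t. g (t *\<^sub>R x) - t\<^sup>2 / 2 * H x x" "\<lambda>t. g' (t *\<^sub>R x) x - t * H x x"] d by auto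
    then have "g x - g 0 - H x x / 2 = g' (t *\<^sub>R x) x - H (t *\<^sub>R x) x" by (simp add: bl)
    also have "\<bar>\<dots>\<bar> \<le> \<epsilon> * norm (t *\<^sub>R x) * norm x" using r(3)[OF tx(1)[of t], of x] t by simp
    also have "\<dots> \<le> \<epsilon> * norm x * norm x"
      using tx(2)[of t] t assms by (intro mult_right_mono mult_left_mono) auto
    finally show "\<bar>g x - g 0 - H x x / 2\<bar> \<le> \<epsilon> * (norm x)\<^sup>2" by (simp add: power2_eq_square mult.assoc)
  qed
qed

text \<open>
  The mean value theorem for \<open>t \<mapsto> g (s w + t v) - g (t v)\<close> expresses the second difference through
  \<open>g' (s w + t v) v - g' (t v) v\<close>, in which the terms depending on \<open>t\<close> cancel up to \<open>o(s)\<close>.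
\<close>

lemma second_difference:
  assumes "\<epsilon> > 0"
  shows "\<exists>r>0. \<forall>s. 0 < s \<and> s < r \<longrightarrow>
    \<bar>g (s *\<^sub>R v + s *\<^sub>R w) - g (s *\<^sub>R v) - g (s *\<^sub>R w) + g 0 - s\<^sup>2 * H w v\<bar> \<le> \<epsilon> * s\<^sup>2"
proof -
  \<comment> \<open>all points that occur have norm at most \<open>s * C\<close>; the summand 1 keeps \<open>C\<close> positive\<close>
  define C where "C = norm v + norm w + 1"
  have C: "C > 0" "norm v \<le> C" by (auto simp: C_def add_nonneg_pos)
  obtain r where r: "r > 0" "\<And>x. x \<in> ball 0 r \<Longrightarrow> (g has_derivative g' x) (at x)"
    "\<And>x v. x \<in> ball 0 r \<Longrightarrow> \<bar>g' x v - H x v\<bar> \<le> \<epsilon> / (2 * C * C) * norm x * norm v"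
    using good_radius[of "\<epsilon> / (2 * C * C)"] assms C by auto
  show ?thesis
  proof (intro exI[of _ "r / C"] conjI allI impI)
    show "r / C > 0" using r C by simp
    fix s :: real assume "0 < s \<and> s < r / C"
    then have s: "0 < s" "s < r / C" by auto
    then have sC: "s * C < r" using C by (simp add: field_simps)
    have nb: "norm (t *\<^sub>R v) \<le> s * C" "norm (s *\<^sub>R w + t *\<^sub>R v) \<le> s * C" if "0 \<le> t" "t \<le> s" for t
    proof -
      have tv: "norm (t *\<^sub>R v) \<le> s * norm v" using that s by (simp add: mult_right_mono)
      then show "norm (t *\<^sub>R v) \<le> s * C" using s mult_left_mono[OF C(2), of s] by linarith
      have "norm (s *\<^sub>R w + t *\<^sub>R v) \<le> s * norm w + s * norm v"
        using norm_triangle_ineq[of "s *\<^sub>R w" "t *\<^sub>R v"] tv s by simp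
      then show "norm (s *\<^sub>R w + t *\<^sub>R v) \<le> s * C" using s by (simp add: C_def distrib_left)
    qed
    then have ib: "t *\<^sub>R v \<in> ball 0 r" "s *\<^sub>R w + t *\<^sub>R v \<in> ball 0 r" if "0 \<le> t" "t \<le> s" for t
      using sC that by (simp_all, (meson le_less_trans)+)
    have d: "((\<lambda>t. g (s *\<^sub>R w + t *\<^sub>R v) - g (t *\<^sub>R v)) has_real_derivative
        g' (s *\<^sub>R w + t *\<^sub>R v) v - g' (t *\<^sub>R v) v) (at t)" if "0 \<le> t" "t \<le> s" for t
      using has_derivative_along_line[OF r(2), of "s *\<^sub>R w" t v] has_derivative_along_line[OF r(2), of 0 t v] ib[OF that]
      by (auto intro!: DERIV_diff)
    obtain t where t: "0 < t" "t < s"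
      "(g (s *\<^sub>R w + s *\<^sub>R v) - g (s *\<^sub>R v)) - (g (s *\<^sub>R w + 0 *\<^sub>R v) - g (0 *\<^sub>R v)) =
        (s - 0) * (g' (s *\<^sub>R w + t *\<^sub>R v) v - g' (t *\<^sub>R v) v)"
      using MVT2[OF s(1) d] by blast
    let ?e1 = "g' (s *\<^sub>R w + t *\<^sub>R v) v - H (s *\<^sub>R w + t *\<^sub>R v) v"
    let ?e2 = "g' (t *\<^sub>R v) v - H (t *\<^sub>R v) v"
    have e: "\<bar>g' x v - H x v\<bar> \<le> s * \<epsilon> / 2" if "x \<in> ball 0 r" "norm x \<le> s * C" for x
    proof -
      have "\<bar>g' x v - H x v\<bar> \<le> \<epsilon> / (2 * C * C) * norm x * norm v" by (rule r(3)[OF that(1)])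
      also have "\<dots> \<le> \<epsilon> / (2 * C * C) * (s * C) * C"
        using that C assms s by (intro mult_mono mult_nonneg_nonneg) auto
      also have "\<dots> = s * \<epsilon> / 2" using C by (simp add: field_simps)
      finally show ?thesis .
    qed
    have "\<bar>?e1 - ?e2\<bar> \<le> s * \<epsilon>"
      using e[of "s *\<^sub>R w + t *\<^sub>R v"] e[of "t *\<^sub>R v"] ib[of t] nb[of t] t(1,2) by linarith
    then have "\<bar>s * (?e1 - ?e2)\<bar> \<le> s * (s * \<epsilon>)"
      using s by (simp add: abs_mult)
    moreover have "g (s *\<^sub>R v + s *\<^sub>R w) - g (s *\<^sub>R v) - g (s *\<^sub>R w) + g 0 - s\<^sup>2 * H w v = s * (?e1 - ?e2)"
      using t(3) by (simp add: bl algebra_simps power2_eq_square)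
    ultimately show "\<bar>g (s *\<^sub>R v + s *\<^sub>R w) - g (s *\<^sub>R v) - g (s *\<^sub>R w) + g 0 - s\<^sup>2 * H w v\<bar> \<le> \<epsilon> * s\<^sup>2"
      by (simp add: power2_eq_square mult_ac)
  qed
qed

text \<open>
  The second difference of \<open>g\<close> is symmetric in \<open>v\<close> and \<open>w\<close>.
\<close>

lemma symmetric: "H v w = H w v"
proof -
  have "\<bar>H v w - H w v\<bar> \<le> \<epsilon>" if "\<epsilon> > 0" for \<epsilon>
  proof -
    have h: "\<epsilon> / 2 > 0" using that by simp
    obtain r1 where r1: "r1 > 0"
      "\<And>s. 0 < s \<and> s < r1 \<Longrightarrow> \<bar>g (s *\<^sub>R v + s *\<^sub>R w) - g (s *\<^sub>R v) - g (s *\<^sub>R w) + g 0 - s\<^sup>2 * H w v\<bar> \<le> \<epsilon> / 2 * s\<^sup>2"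
      using second_difference[OF h, of v w] by blast
    obtain r2 where r2: "r2 > 0"
      "\<And>s. 0 < s \<and> s < r2 \<Longrightarrow> \<bar>g (s *\<^sub>R w + s *\<^sub>R v) - g (s *\<^sub>R w) - g (s *\<^sub>R v) + g 0 - s\<^sup>2 * H v w\<bar> \<le> \<epsilon> / 2 * s\<^sup>2"
      using second_difference[OF h, of w v] by blast
    define s where "s = min r1 r2 / 2"
    have s: "0 < s" "s < r1" "s < r2" using r1(1) r2(1) by (auto simp: s_def)
    have vw: "g (s *\<^sub>R v + s *\<^sub>R w) = g (s *\<^sub>R w + s *\<^sub>R v)" by (simp only: add.commute)
    have "\<bar>s\<^sup>2 * H v w - s\<^sup>2 * H w v\<bar> \<le> \<epsilon> * s\<^sup>2"
      using r1(2)[OF conjI[OF s(1,2)], unfolded vw] r2(2)[OF conjI[OF s(1,3)]] by linarith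
    then have "s\<^sup>2 * \<bar>H v w - H w v\<bar> \<le> s\<^sup>2 * \<epsilon>"
      unfolding right_diff_distrib[symmetric] abs_mult by (simp add: mult.commute)
    then show ?thesis using s(1) by simp
  qed
  from this[of "\<bar>H v w - H w v\<bar> / 2"] show ?thesis
    by (cases "H v w = H w v") simp_all
qed

lemma negative_definite_strict_max:
  assumes neg: "\<And>x. x \<noteq> 0 \<Longrightarrow> H x x < 0"
  obtains r where "r > 0" "\<And>x. x \<in> ball 0 r \<Longrightarrow> x \<noteq> 0 \<Longrightarrow> g x < g 0"
proof -
  have "bilinear (\<lambda>x y. - H x y)"
    using H by (auto simp: bilinear_def intro: linear_compose_neg)
  then obtain m where m: "m > 0" "\<And>y. m * (norm y)\<^sup>2 \<le> - H y y"
    using positive_on_subspace_bound[of "\<lambda>x y. - H x y" UNIV] neg by auto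
  obtain r where r: "r > 0" "\<And>x. x \<in> ball 0 r \<Longrightarrow> \<bar>g x - g 0 - H x x / 2\<bar> \<le> m / 4 * (norm x)\<^sup>2"
    using taylor[of "m / 4"] m by auto
  show ?thesis
  proof (rule that[OF r(1)])
    fix x :: 'e assume "x \<in> ball 0 r" "x \<noteq> 0"
    moreover have "0 < m * (norm x)\<^sup>2" using m \<open>x \<noteq> 0\<close> by simp
    moreover have "g x - g 0 - H x x / 2 \<le> m / 4 * (norm x)\<^sup>2"
      using r(2)[OF \<open>x \<in> ball 0 r\<close>] by (rule abs_le_D1)
    ultimately show "g x < g 0" using m(2)[of x] by linarith
  qed
qed

text \<open>
  Where \<open>g > g 0\<close>, the quadratic part satisfies \<open>H w w + H y y \<ge> - \<epsilon> |w + y|\<^sup>2\<close>, so \<open>|w|\<close> is bounded by a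
  multiple of \<open>|y|\<close>. Within this cone the derivative of \<open>g\<close> in the direction \<open>y\<close> at \<open>w + l y\<close> is
  \<open>l (H y y)\<close> up to an error that is small against \<open>l |y|\<^sup>2\<close>, and therefore nonnegative. Scaling up
  the component \<open>y\<close> preserves the cone.
\<close>

lemma push_up_cone:
  assumes W: "\<And>w. w \<in> W \<Longrightarrow> mw * (norm w)\<^sup>2 \<le> - H w w" "mw > 0"
    and P: "\<And>y. y \<in> P \<Longrightarrow> mp * (norm y)\<^sup>2 \<le> H y y" "mp > 0"
    and orth: "\<And>w y. w \<in> W \<Longrightarrow> y \<in> P \<Longrightarrow> H w y = 0"
  shows "\<exists>\<kappa>\<ge>0. \<exists>r>0.
    (\<forall>w\<in>W. \<forall>y\<in>P. w + y \<in> ball 0 r \<and> g 0 < g (w + y) \<longrightarrow> norm w \<le> \<kappa> * norm y \<and> y \<noteq> 0) \<and>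
    (\<forall>w\<in>W. \<forall>y\<in>P. \<forall>l\<ge>1. y \<noteq> 0 \<and> norm w \<le> \<kappa> * norm y \<and> l * norm y * (\<kappa> + 1) < r \<longrightarrow>
      g (w + y) \<le> g (w + l *\<^sub>R y))"
proof -
  obtain M where M: "M > 0" "\<And>x y. \<bar>H x y\<bar> \<le> M * norm x * norm y"
    using bilinear_bounded_pos[OF H] by auto
  \<comment> \<open>an error of \<open>mw / 8\<close> in the Taylor formula costs at most \<open>mw / 2 * ((norm w)\<^sup>2 + (norm y)\<^sup>2)\<close> in \<open>H\<close>, which yields this slope\<close>
  define \<kappa> where "\<kappa> = sqrt ((2 * M + mw) / mw)"
  have \<kappa>: "\<kappa> \<ge> 0" "\<kappa>\<^sup>2 = (2 * M + mw) / mw" using M(1) W(2) by (auto simp: \<kappa>_def)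
  obtain r1 where r1: "r1 > 0" "\<And>x. x \<in> ball 0 r1 \<Longrightarrow> \<bar>g x - g 0 - H x x / 2\<bar> \<le> mw / 8 * (norm x)\<^sup>2"
    using taylor[of "mw / 8"] W(2) by auto
  obtain r2 where r2: "r2 > 0" "\<And>x. x \<in> ball 0 r2 \<Longrightarrow> (g has_derivative g' x) (at x)"
    "\<And>x v. x \<in> ball 0 r2 \<Longrightarrow> \<bar>g' x v - H x v\<bar> \<le> mp / (\<kappa> + 1) * norm x * norm v"
    using good_radius[of "mp / (\<kappa> + 1)"] P(2) \<kappa>(1) by auto
  have Hwy: "H w y = 0" "H (w + y) (w + y) = H w w + H y y" if "w \<in> W" "y \<in> P" for w y
    using orth[OF that] symmetric[of y w] by (simp_all add: bl)
  have cone: "norm w \<le> \<kappa> * norm y \<and> y \<noteq> 0"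
    if wy: "w \<in> W" "y \<in> P" and a: "w + y \<in> ball 0 (min r1 r2)" "g 0 < g (w + y)" for w y
  proof -
      have "- (mw / 8 * (norm (w + y))\<^sup>2) \<le> H (w + y) (w + y) / 2"
      proof -
        have "w + y \<in> ball 0 r1" using a(1) by auto
        from r1(2)[OF this] a(2) show ?thesis by linarith
      qed
      moreover have "(norm (w + y))\<^sup>2 \<le> 2 * ((norm w)\<^sup>2 + (norm y)\<^sup>2)"
      proof -
        have "(norm (w + y))\<^sup>2 \<le> (norm w + norm y)\<^sup>2" by (simp add: norm_triangle_ineq power_mono)
        also have "\<dots> \<le> 2 * ((norm w)\<^sup>2 + (norm y)\<^sup>2)"
          using sum_squares_bound[of "norm w" "norm y"] by (simp add: power2_sum)
        finally show ?thesis .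
      qed
      then have "mw * (norm (w + y))\<^sup>2 \<le> mw * (2 * ((norm w)\<^sup>2 + (norm y)\<^sup>2))"
        using W(2) by (intro mult_left_mono) auto
      moreover have "H y y \<le> M * (norm y)\<^sup>2" using M(2)[of y y] by (simp add: power2_eq_square)
      moreover note W(1)[OF wy(1)]
      ultimately have "mw * (norm w)\<^sup>2 \<le> (2 * M + mw) * (norm y)\<^sup>2"
        using Hwy(2)[OF wy] by (simp add: algebra_simps)
      also have "2 * M + mw = mw * \<kappa>\<^sup>2" using W(2) by (simp add: \<kappa>(2))
      finally have "(norm w)\<^sup>2 \<le> \<kappa>\<^sup>2 * (norm y)\<^sup>2" using W(2) by (simp only: mult.assoc mult_le_cancel_left_pos)
      then have "(norm w)\<^sup>2 \<le> (\<kappa> * norm y)\<^sup>2" by (simp add: power_mult_distrib)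
      then have le: "norm w \<le> \<kappa> * norm y" 
        by (rule power2_le_imp_le) (simp add: \<kappa>(1))
      have "y \<noteq> 0"
      proof
        assume "y = 0"
        then have "w + y = 0" using le by simp
        then show False using a(2) by (simp only: less_irrefl)
      qed
      then show "norm w \<le> \<kappa> * norm y \<and> y \<noteq> 0" using le by blast
  qed
  have up: "g (w + y) \<le> g (w + l *\<^sub>R y)"
    if wy: "w \<in> W" "y \<in> P"
      and a: "y \<noteq> 0" "norm w \<le> \<kappa> * norm y" "1 \<le> l" "l * norm y * (\<kappa> + 1) < min r1 r2" for w y l
  proof -
    have nb: "norm (w + t *\<^sub>R y) \<le> t * norm y * (\<kappa> + 1)" if "1 \<le> t" for t
    proof -
      have "norm (w + t *\<^sub>R y) \<le> norm w + norm (t *\<^sub>R y)" by (rule norm_triangle_ineq)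
      also have "\<dots> \<le> \<kappa> * norm y + t * norm y" using a(2) that by simp
      also have "\<dots> \<le> t * (\<kappa> * norm y) + t * norm y"
        using that \<kappa>(1) mult_right_mono[of 1 t "\<kappa> * norm y"] by simp
      finally show ?thesis by (simp add: algebra_simps)
    qed
    have ib: "w + t *\<^sub>R y \<in> ball 0 r2" if "1 \<le> t" "t \<le> l" for t
    proof -
      have "norm (w + t *\<^sub>R y) \<le> t * (norm y * (\<kappa> + 1))" using nb[OF that(1)] by (simp add: mult.assoc)
      also have "\<dots> \<le> l * (norm y * (\<kappa> + 1))" using that \<kappa>(1) by (intro mult_right_mono) auto
      finally show ?thesis using a(4) by (simp add: mult.assoc)
    qed
    have pos: "0 \<le> g' (w + t *\<^sub>R y) y" if t: "1 \<le> t" "t \<le> l" for t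
    proof -
      have "H (w + t *\<^sub>R y) y = t * H y y" using Hwy(1)[OF wy] by (simp add: bl)
      moreover have "t * (mp * (norm y)\<^sup>2) \<le> t * H y y" using P(1)[OF wy(2)] t by simp
      moreover have "mp / (\<kappa> + 1) * norm (w + t *\<^sub>R y) * norm y \<le> mp / (\<kappa> + 1) * (t * norm y * (\<kappa> + 1)) * norm y"
        using nb[OF t(1)] P(2) \<kappa>(1) by (intro mult_right_mono mult_left_mono) auto
      moreover have "mp / (\<kappa> + 1) * (t * norm y * (\<kappa> + 1)) * norm y = t * (mp * (norm y)\<^sup>2)"
        using \<kappa>(1) by (simp add: power2_eq_square)
      ultimately show ?thesis using r2(3)[OF ib[OF t], of y] by linarith
    qed
    show "g (w + y) \<le> g (w + l *\<^sub>R y)"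
    proof -
      have "g (w + 1 *\<^sub>R y) \<le> g (w + l *\<^sub>R y)"
      proof (rule DERIV_nonneg_imp_nondecreasing[OF a(3)])
        fix t assume "1 \<le> t" "t \<le> l"
        then show "\<exists>d. ((\<lambda>t. g (w + t *\<^sub>R y)) has_real_derivative d) (at t) \<and> 0 \<le> d"
          using has_derivative_along_line[OF r2(2)[OF ib]] pos by blast
      qed
      then show ?thesis by simp
    qed
  qed
  have "0 < min r1 r2" using r1(1) r2(1) by simp
  then show ?thesis
    using \<kappa>(1) cone up by (intro exI[of _ \<kappa>] exI[of _ "min r1 r2"] conjI) blast+
qed

text \<open>
  A point \<open>a = w + y\<close> near 0 with \<open>g a > g 0\<close> is first moved to \<open>w + \<Lambda> y\<close> with \<open>|\<Lambda> y| = \<rho>\<close>, along which \<open>g\<close>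
  does not decrease, and then to \<open>\<Lambda> y\<close>. The sphere of radius \<open>\<rho>\<close> in \<open>P\<close> lies in \<open>{x. g x > g 0}\<close>. It is
  connected, and it has a neighborhood of some width \<open>\<eta>\<close> in that open set, which absorbs the second move when
  \<open>a\<close> is close enough to 0.
\<close>

lemma connected_above_critical:
  assumes W: "subspace W" "\<And>w. w \<in> W \<Longrightarrow> w \<noteq> 0 \<Longrightarrow> H w w < 0"
    and P: "subspace P" "2 \<le> dim P" "\<And>y. y \<in> P \<Longrightarrow> y \<noteq> 0 \<Longrightarrow> 0 < H y y"
    and orth: "\<And>w y. w \<in> W \<Longrightarrow> y \<in> P \<Longrightarrow> H w y = 0"
    and dec: "\<And>x. \<exists>w\<in>W. \<exists>y\<in>P. x = w + y"
    and e: "e > 0"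
  shows "(\<exists>x\<in>ball 0 e. g 0 < g x) \<and>
    (\<exists>r>0. r \<le> e \<and> (\<forall>a\<in>ball 0 r. \<forall>b\<in>ball 0 r. g 0 < g a \<and> g 0 < g b \<longrightarrow>
      path_component (ball 0 e \<inter> {x. g 0 < g x}) a b))"
proof -
  have "bilinear (\<lambda>x y. - H x y)"
    using H by (auto simp: bilinear_def intro: linear_compose_neg)
  then obtain mw where mw: "mw > 0" "\<And>w. w \<in> W \<Longrightarrow> mw * (norm w)\<^sup>2 \<le> - H w w"
    using positive_on_subspace_bound[of "\<lambda>x y. - H x y" W] W by auto
  obtain mp where mp: "mp > 0" "\<And>y. y \<in> P \<Longrightarrow> mp * (norm y)\<^sup>2 \<le> H y y"
    using positive_on_subspace_bound[OF H P(1,3)] by blast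
  obtain M where M: "M > 0" "\<And>x y. \<bar>H x y\<bar> \<le> M * norm x * norm y"
    using bilinear_bounded_pos[OF H] by auto
  have "\<exists>\<kappa>\<ge>0. \<exists>r>0.
    (\<forall>w\<in>W. \<forall>y\<in>P. w + y \<in> ball 0 r \<and> g 0 < g (w + y) \<longrightarrow> norm w \<le> \<kappa> * norm y \<and> y \<noteq> 0) \<and>
    (\<forall>w\<in>W. \<forall>y\<in>P. \<forall>l\<ge>1. y \<noteq> 0 \<and> norm w \<le> \<kappa> * norm y \<and> l * norm y * (\<kappa> + 1) < r \<longrightarrow>
      g (w + y) \<le> g (w + l *\<^sub>R y))"
    by (rule push_up_cone[of W mw P mp]) (simp_all add: mw mp orth)
  then obtain \<kappa> r0 where cone: "\<kappa> \<ge> 0" "r0 > 0"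
    "\<And>w y. w \<in> W \<Longrightarrow> y \<in> P \<Longrightarrow> w + y \<in> ball 0 r0 \<Longrightarrow> g 0 < g (w + y) \<Longrightarrow> norm w \<le> \<kappa> * norm y \<and> y \<noteq> 0"
    "\<And>w y l. w \<in> W \<Longrightarrow> y \<in> P \<Longrightarrow> y \<noteq> 0 \<Longrightarrow> norm w \<le> \<kappa> * norm y \<Longrightarrow> 1 \<le> l \<Longrightarrow>
      l * norm y * (\<kappa> + 1) < r0 \<Longrightarrow> g (w + y) \<le> g (w + l *\<^sub>R y)"
    by blast
  obtain r1 where r1: "r1 > 0" "\<And>x. x \<in> ball 0 r1 \<Longrightarrow> \<bar>g x - g 0 - H x x / 2\<bar> \<le> mp / 4 * (norm x)\<^sup>2"
    using taylor[of "mp / 4"] mp(1) by auto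
  obtain r2 where r2: "r2 > 0" "\<And>x. x \<in> ball 0 r2 \<Longrightarrow> (g has_derivative g' x) (at x)"
    using deriv by blast
  define R where "R = Min {r0, r1, r2, e}"
  have R: "R > 0" "R \<le> r0" "R \<le> r1" "R \<le> r2" "R \<le> e" using cone(2) r1(1) r2(1) e by (auto simp: R_def)
  \<comment> \<open>points \<open>w + y\<close> of the cone with \<open>|y| \<le> \<rho>\<close> have norm below \<open>R\<close>\<close>
  define \<rho> where "\<rho> = R / (2 * (\<kappa> + 1))"
  have \<rho>: "\<rho> > 0" using R(1) cone(1) by (simp add: \<rho>_def)
  have \<rho>R: "\<rho> * (\<kappa> + 1) < R" 
  proof -
    have "\<rho> * (\<kappa> + 1) = R / 2" using cone(1) by (simp add: \<rho>_def field_simps)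
    then show ?thesis using R(1) by simp
  qed
  have \<rho>R': "\<rho> < R" using \<rho>R[unfolded distrib_left] mult_nonneg_nonneg[OF less_imp_le[OF \<rho>] cone(1)] by linarith
  define \<Omega> where "\<Omega> = ball 0 R \<inter> {x. g 0 < g x}"
  have \<Omega>e: "\<Omega> \<subseteq> ball 0 e \<inter> {x. g 0 < g x}" using R by (auto simp: \<Omega>_def)
  have "continuous_on (ball 0 R) g"
  proof (intro continuous_at_imp_continuous_on ballI)
    fix x :: 'e assume "x \<in> ball 0 R"
    then have "x \<in> ball 0 r2" using R(4) by simp
    then show "isCont g x" by (rule has_derivative_continuous[OF r2(2)])
  qed
  then have "open (g -` {g 0<..} \<inter> ball 0 R)"
    by (rule continuous_on_open_vimage[OF open_ball, THEN iffD1, rule_format]) simp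
  moreover have "g -` {g 0<..} \<inter> ball 0 R = \<Omega>" by (auto simp: \<Omega>_def)
  ultimately have "open \<Omega>" by simp
  define S where "S = {y \<in> P. norm y = \<rho>}"
  have S: "path_connected S" "S \<subseteq> \<Omega>"
  proof -
    show "path_connected S" unfolding S_def by (rule path_connected_subspace_sphere[OF P(1,2) \<rho>])
    show "S \<subseteq> \<Omega>"
    proof
      fix y assume y: "y \<in> S"
      then have "y \<in> ball 0 R" "y \<in> P" "y \<noteq> 0" using \<rho>R' \<rho> by (auto simp: S_def)
      moreover have "0 < mp * (norm y)\<^sup>2" using mp(1) \<open>y \<noteq> 0\<close> by simp
      moreover have "- (mp / 4 * (norm y)\<^sup>2) \<le> g y - g 0 - H y y / 2"
      proof -
        have "y \<in> ball 0 r1" using \<open>y \<in> ball 0 R\<close> R(3) by auto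
        from r1(2)[OF this] show ?thesis by linarith
      qed
      moreover note mp(2)[OF \<open>y \<in> P\<close>]
      ultimately have "g 0 < g y" by linarith
      then show "y \<in> \<Omega>" using \<open>y \<in> ball 0 R\<close> by (simp add: \<Omega>_def)
    qed
  qed
  have "S \<noteq> {}"
  proof -
    have "P \<noteq> {0}" using P(2) by auto
    then obtain y where "y \<in> P" "y \<noteq> 0" using subspace_0[OF P(1)] by blast
    then have "(\<rho> / norm y) *\<^sub>R y \<in> S" using P(1) \<rho> by (simp add: S_def subspace_scale)
    then show ?thesis by blast
  qed
  have "compact S"
  proof -
    have "S = sphere 0 \<rho> \<inter> P" by (auto simp: S_def)
    then show ?thesis using closed_subspace[OF P(1)] by (simp add: compact_Int_closed)
  qed
  then obtain \<eta> where \<eta>: "\<eta> > 0" "(\<Union>x\<in>S. ball x \<eta>) \<subseteq> \<Omega>"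
    using compact_subset_open_imp_ball_epsilon_subset[OF _ \<open>open \<Omega>\<close> S(2)] by blast
  \<comment> \<open>since \<open>mp * norm y \<le> M * norm a\<close>, this gives \<open>norm y < \<rho>\<close> and \<open>norm w < \<eta>\<close> for \<open>a = w + y\<close> in the ball\<close>
  define r where "r = Min {R, mp * \<rho> / M, mp * \<eta> / (2 * M * (\<kappa> + 1))}"
  have r: "r > 0" "r \<le> R" "r \<le> mp * \<rho> / M" "r \<le> mp * \<eta> / (2 * M * (\<kappa> + 1))"
    using R(1) mp(1) M(1) \<rho> \<eta>(1) cone(1) by (auto simp: r_def)
  have reach: "\<exists>s\<in>S. path_component \<Omega> a s" if a: "a \<in> ball 0 r" "g 0 < g a" for a
  proof -
    obtain w y where wy: "w \<in> W" "y \<in> P" "a = w + y" using dec[of a] by blast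
    have "a \<in> ball 0 r0" using a(1) r(2) R(2) by auto
    then have c: "norm w \<le> \<kappa> * norm y" "y \<noteq> 0" using cone(3)[OF wy(1,2)] a(2) wy(3) by auto
    have "mp * (norm y)\<^sup>2 \<le> H a y" using mp(2)[OF wy(2)] orth[OF wy(1,2)] wy(3) by (simp add: bl)
    also have "\<dots> \<le> M * norm a * norm y" using M(2)[of a y] by simp
    finally have "mp * norm y \<le> M * norm a" using c(2) by (simp add: power2_eq_square)
    also have "\<dots> < M * r" using a(1) M(1) by simp
    finally have ny: "mp * norm y < M * r" .
    have "M * r \<le> mp * \<rho>" using r(3) M(1) by (simp add: field_simps)
    then have y\<rho>: "norm y < \<rho>" using ny mp(1) by (meson less_le_trans mult_less_cancel_left_pos)
    have "M * r * (2 * (\<kappa> + 1)) \<le> mp * \<eta>" 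
    proof -
      have q: "0 < 2 * M * (\<kappa> + 1)" using M(1) cone(1) by simp
      have "r * (2 * M * (\<kappa> + 1)) \<le> mp * \<eta>" using r(4) by (simp only: pos_le_divide_eq[OF q])
      then show ?thesis by (simp only: mult_ac)
    qed
    moreover have "mp * norm y * (2 * (\<kappa> + 1)) < M * r * (2 * (\<kappa> + 1))"
      using ny cone(1) by (intro mult_strict_right_mono) auto
    ultimately have "mp * (norm y * (2 * (\<kappa> + 1))) < mp * \<eta>" by (simp add: mult.assoc)
    then have "norm y * (2 * (\<kappa> + 1)) < \<eta>" using mp(1) by simp
    moreover have "\<kappa> * norm y \<le> norm y * (2 * (\<kappa> + 1))"
      using mult_right_mono[of \<kappa> "2 * (\<kappa> + 1)" "norm y"] cone(1) by (simp add: mult.commute)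
    ultimately have w\<eta>: "norm w < \<eta>" using c(1) by linarith
    define \<Lambda> where "\<Lambda> = \<rho> / norm y"
    have \<Lambda>: "1 \<le> \<Lambda>" "\<Lambda> * norm y = \<rho>" using y\<rho> c(2) by (auto simp: \<Lambda>_def)
    have \<Lambda>S: "\<Lambda> *\<^sub>R y \<in> S" using \<Lambda> wy(2) P(1) by (auto simp: S_def subspace_scale)
    have "closed_segment a (w + \<Lambda> *\<^sub>R y) \<subseteq> \<Omega>"
    proof
      fix z assume "z \<in> closed_segment a (w + \<Lambda> *\<^sub>R y)"
      then obtain u where u: "0 \<le> u" "u \<le> 1" "z = (1 - u) *\<^sub>R a + u *\<^sub>R (w + \<Lambda> *\<^sub>R y)"
        by (auto simp: closed_segment_def)
      define t where "t = 1 + u * (\<Lambda> - 1)"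
      have z: "z = w + t *\<^sub>R y" by (simp add: u(3) wy(3) t_def algebra_simps)
      have "u * (\<Lambda> - 1) \<le> \<Lambda> - 1" using u \<Lambda>(1) by (simp add: mult_left_le_one_le)
      then have t: "1 \<le> t" "t \<le> \<Lambda>" using u \<Lambda>(1) by (auto simp: t_def)
      have ty: "t * norm y \<le> \<rho>" using t(2) mult_right_mono[of t \<Lambda> "norm y"] \<Lambda>(2) by simp
      have "0 \<le> \<kappa> + 1" using cone(1) by simp
      then have ty': "t * norm y * (\<kappa> + 1) < R"
        by (rule le_less_trans[OF mult_right_mono[OF ty] \<rho>R])
      have "norm y \<le> t * norm y" using mult_right_mono[OF t(1), of "norm y"] by simp
      then have ky: "\<kappa> * norm y \<le> \<kappa> * (t * norm y)" by (rule mult_left_mono) (rule cone(1))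
      have "norm z \<le> norm w + t * norm y" using norm_triangle_ineq[of w "t *\<^sub>R y"] t(1) by (simp add: z)
      also have "\<dots> \<le> \<kappa> * (t * norm y) + t * norm y" using c(1) ky by linarith
      also have "\<dots> = t * norm y * (\<kappa> + 1)" by (simp add: algebra_simps)
      finally have "z \<in> ball 0 R" using ty' by simp
      moreover have "g a \<le> g z"
        unfolding z wy(3) using ty' R(2) by (intro cone(4)[OF wy(1,2) c(2,1) t(1)]) simp
      ultimately show "z \<in> \<Omega>" using a(2) by (simp add: \<Omega>_def)
    qed
    then have 1: "path_component \<Omega> a (w + \<Lambda> *\<^sub>R y)"
      by (rule path_component_linepath)
    have "ball (\<Lambda> *\<^sub>R y) \<eta> \<subseteq> \<Omega>" using \<eta>(2) \<Lambda>S by blast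
    moreover have "closed_segment (w + \<Lambda> *\<^sub>R y) (\<Lambda> *\<^sub>R y) \<subseteq> ball (\<Lambda> *\<^sub>R y) \<eta>"
      using w\<eta> \<eta>(1) by (intro closed_segment_subset) (auto simp: dist_norm)
    ultimately have 2: "path_component \<Omega> (w + \<Lambda> *\<^sub>R y) (\<Lambda> *\<^sub>R y)"
      by (intro path_component_linepath) blast
    show ?thesis using path_component_trans[OF 1 2] \<Lambda>S by blast
  qed
  have "path_component (ball 0 e \<inter> {x. g 0 < g x}) a b"
    if ab: "a \<in> ball 0 r" "b \<in> ball 0 r" "g 0 < g a" "g 0 < g b" for a b
  proof -
    obtain s where s: "s \<in> S" "path_component \<Omega> a s" using reach[OF ab(1,3)] by blast
    obtain t where t: "t \<in> S" "path_component \<Omega> b t" using reach[OF ab(2,4)] by blast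
    have "path_component S s t" using S(1) s(1) t(1) path_connected_component by blast
    then have "path_component \<Omega> s t" using S(2) path_component_of_subset by blast
    then have "path_component \<Omega> a b"
      using s(2) t(2) path_component_trans path_component_sym by metis
    then show ?thesis using \<Omega>e path_component_of_subset by blast
  qed
  moreover have "\<exists>x\<in>ball 0 e. g 0 < g x" using \<open>S \<noteq> {}\<close> S(2) \<Omega>e by blast
  ultimately show ?thesis using r(1,2) R(5) by (intro conjI exI[of _ r]) auto
qed

end

text \<open>
  Adding \<open>\<tau> v\<close> for a fixed small \<open>\<tau>\<close> increases \<open>g\<close> on the way, and it moves a small ball around 0 into a
  ball around \<open>\<tau> v\<close> on which \<open>g > g 0\<close>. There points are joined by segments.
\<close>

lemma connected_above_regular:
  fixes g :: "'e::euclidean_space \<Rightarrow> real"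
  assumes R: "R > 0" "\<And>x. x \<in> ball 0 R \<Longrightarrow> (g has_derivative g' x) (at x)"
    and cont: "continuous (at 0) (\<lambda>x. g' x v)" and pos: "0 < g' 0 v" and e: "e > 0"
  shows "(\<exists>x\<in>ball 0 e. g 0 < g x) \<and>
    (\<exists>r>0. r \<le> e \<and> (\<forall>a\<in>ball 0 r. \<forall>b\<in>ball 0 r. g 0 < g a \<and> g 0 < g b \<longrightarrow>
      path_component (ball 0 e \<inter> {x. g 0 < g x}) a b))"
proof -
  have "v \<noteq> 0" using pos linear_0[OF has_derivative_linear[OF R(2)[of 0]]] R(1) by auto
  obtain r1 where r1: "r1 > 0" "\<And>x. x \<in> ball 0 r1 \<Longrightarrow> 0 < g' x v"
  proof -
    obtain d where "d > 0" "\<forall>x. dist x 0 < d \<longrightarrow> dist (g' x v) (g' 0 v) < g' 0 v"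
      using cont pos unfolding continuous_at_eps_delta by blast
    then show ?thesis by (intro that[of d]) (fastforce simp: dist_real_def)+
  qed
  define R' where "R' = Min {R, r1, e}"
  have R': "R' > 0" "R' \<le> R" "R' \<le> r1" "R' \<le> e" using R(1) r1(1) e by (auto simp: R'_def)
  have up: "g x < g (x + t *\<^sub>R v)" if "0 < t" "\<And>u. 0 \<le> u \<Longrightarrow> u \<le> t \<Longrightarrow> x + u *\<^sub>R v \<in> ball 0 R'" for x t
  proof -
    have "g (x + 0 *\<^sub>R v) < g (x + t *\<^sub>R v)"
    proof (rule DERIV_pos_imp_increasing[OF that(1)])
      fix u assume u: "0 \<le> u" "u \<le> t"
      then have xu: "x + u *\<^sub>R v \<in> ball 0 R'" using that(2) by blast
      then have d: "(g has_derivative g' (x + u *\<^sub>R v)) (at (x + u *\<^sub>R v))" using R(2) R'(2) by auto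
      have "((\<lambda>t. g (x + t *\<^sub>R v)) has_real_derivative g' (x + u *\<^sub>R v) v) (at u)"
        by (rule has_derivative_along_line[OF d])
      moreover have "0 < g' (x + u *\<^sub>R v) v" using r1(2) xu R'(3) by auto
      ultimately show "\<exists>y. ((\<lambda>t. g (x + t *\<^sub>R v)) has_real_derivative y) (at u) \<and> 0 < y" by blast
    qed
    then show ?thesis by simp
  qed
  define \<tau> where "\<tau> = R' / (2 * norm v)"
  have \<tau>: "\<tau> > 0" "\<tau> * norm v = R' / 2" using \<open>v \<noteq> 0\<close> R'(1) by (auto simp: \<tau>_def)
  have stay: "x + u *\<^sub>R v \<in> ball 0 R'" if "norm x < R' / 2" "0 \<le> u" "u \<le> \<tau>" for x u
  proof -
    have "norm (u *\<^sub>R v) \<le> \<tau> * norm v" using that by (simp add: mult_right_mono)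
    then show ?thesis using norm_triangle_ineq[of x "u *\<^sub>R v"] that(1) \<tau>(2) by simp
  qed
  have top: "g 0 < g (\<tau> *\<^sub>R v)" using up[OF \<tau>(1), of 0] stay[of 0] R'(1) by simp
  have "isCont g (\<tau> *\<^sub>R v)"
    using R(2)[of "\<tau> *\<^sub>R v"] stay[of 0 \<tau>] R' \<tau> by (intro has_derivative_continuous) auto
  then obtain d where d: "d > 0" "\<And>x. dist x (\<tau> *\<^sub>R v) < d \<Longrightarrow> g 0 < g x"
  proof -
    assume "isCont g (\<tau> *\<^sub>R v)" and *: "\<And>d. 0 < d \<Longrightarrow> (\<And>x. dist x (\<tau> *\<^sub>R v) < d \<Longrightarrow> g 0 < g x) \<Longrightarrow> thesis"
    then obtain d where "d > 0" "\<forall>x. dist x (\<tau> *\<^sub>R v) < d \<longrightarrow> dist (g x) (g (\<tau> *\<^sub>R v)) < g (\<tau> *\<^sub>R v) - g 0"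
      using top unfolding continuous_at_eps_delta by (metis diff_gt_0_iff_gt)
    then show thesis by (intro *[of d]) (fastforce simp: dist_real_def)+
  qed
  define r where "r = min (R' / 2) d"
  have r: "r > 0" "r \<le> R' / 2" "r \<le> d" using R'(1) d(1) by (auto simp: r_def)
  let ?X = "ball 0 e \<inter> {x. g 0 < g x}"
  have lift: "path_component ?X a (a + \<tau> *\<^sub>R v)" if a: "a \<in> ball 0 r" "g 0 < g a" for a
  proof (rule path_component_linepath, rule subsetI)
    fix z assume "z \<in> closed_segment a (a + \<tau> *\<^sub>R v)"
    then obtain u where u: "0 \<le> u" "u \<le> 1" "z = (1 - u) *\<^sub>R a + u *\<^sub>R (a + \<tau> *\<^sub>R v)"
      by (auto simp: closed_segment_def)
    then have z: "z = a + (u * \<tau>) *\<^sub>R v" by (simp add: algebra_simps)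
    have ut: "0 \<le> u * \<tau>" "u * \<tau> \<le> \<tau>" using u \<tau>(1) by (auto simp: mult_left_le_one_le)
    have na: "norm a < R' / 2" using a(1) r(2) by simp
    have "z \<in> ball 0 e" using stay[OF na ut] R'(4) by (auto simp: z)
    moreover have "g a \<le> g z"
    proof (cases "u * \<tau> = 0")
      case False
      then have "0 < u * \<tau>" using ut(1) by linarith
      from up[OF this, of a] stay[OF na] ut(2) show ?thesis by (simp add: z)
    qed (auto simp: z)
    ultimately show "z \<in> ?X" using a(2) by simp
  qed
  have "path_component ?X a b" if ab: "a \<in> ball 0 r" "b \<in> ball 0 r" "g 0 < g a" "g 0 < g b" for a b
  proof -
    have "closed_segment (a + \<tau> *\<^sub>R v) (b + \<tau> *\<^sub>R v) \<subseteq> ball (\<tau> *\<^sub>R v) r"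
      using ab by (intro closed_segment_subset) (auto simp: dist_norm)
    also have "\<dots> \<subseteq> ?X"
    proof
      fix z assume z: "z \<in> ball (\<tau> *\<^sub>R v) r"
      then have "norm (z - \<tau> *\<^sub>R v) < R' / 2" using r(2) by (simp add: dist_norm norm_minus_commute)
      from stay[OF this, of \<tau>] have "z \<in> ball 0 R'" using \<tau>(1) by simp
      then have "z \<in> ball 0 e" using R'(4) by simp
      moreover have "g 0 < g z" using z r(3) by (intro d(2)) (simp add: dist_commute)
      ultimately show "z \<in> ?X" by simp
    qed
    finally have "path_component ?X (a + \<tau> *\<^sub>R v) (b + \<tau> *\<^sub>R v)" by (rule path_component_linepath)
    then show ?thesis
      using path_component_trans[OF lift[OF ab(1,3)]] path_component_trans[OF _ path_component_sym[OF lift[OF ab(2,4)]]]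
      by blast
  qed
  moreover have "\<tau> *\<^sub>R v \<in> ball 0 e" using stay[of 0 \<tau>] R' \<tau>(1) by auto
  then have "\<exists>x\<in>ball 0 e. g 0 < g x" using top by blast
  moreover have "r \<le> e" using r(2) R'(1,4) by linarith
  ultimately show ?thesis using r(1) by (intro conjI exI[of _ r]) blast+
qed

section \<open>Charts\<close>

locale coordinate_chart =
  fixes D :: "'a::{t2_space} set" and f :: "'a \<Rightarrow> 'e::euclidean_space" and h p
  assumes D: "open D" "open (f ` D)" "homeomorphism D (f ` D) f h" and p: "p \<in> D"
begin

lemma inverse: "x \<in> D \<Longrightarrow> h (f x) = x" "y \<in> f ` D \<Longrightarrow> f (h y) = y" "y \<in> f ` D \<Longrightarrow> h y \<in> D"
  using D(3) by (auto simp: homeomorphism_def)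

lemma cont: "continuous_on D f" "continuous_on (f ` D) h"
  using D(3) by (auto simp: homeomorphism_def)

lemma open_image_chart: "open Q \<Longrightarrow> open (f ` (D \<inter> Q))"
proof -
  assume "open Q"
  then have "open (h -` Q \<inter> f ` D)"
    using continuous_on_open_vimage[OF D(2)] cont(2) by blast
  moreover have "h -` Q \<inter> f ` D = f ` (D \<inter> Q)" by (auto simp: inverse)
  ultimately show ?thesis by simp
qed

lemma open_image_inverse: "open V \<Longrightarrow> V \<subseteq> f ` D \<Longrightarrow> open (h ` V)"
proof -
  assume V: "open V" "V \<subseteq> f ` D"
  then have "open (f -` V \<inter> D)"
    using continuous_on_open_vimage[OF D(1)] cont(1) by blast
  moreover have "x \<in> h ` V" if "x \<in> f -` V \<inter> D" for x
    using that inverse(1)[of x] by (intro image_eqI[of _ _ "f x"]) auto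
  then have "f -` V \<inter> D = h ` V" using V(2) inverse(2,3) by (auto simp: subset_iff)
  ultimately show ?thesis by simp
qed

lemma small_ball:
  assumes "open Q" "p \<in> Q"
  obtains e where "e > 0" "cball (f p) e \<subseteq> f ` (D \<inter> Q)"
  using open_image_chart[OF assms(1)] assms(2) p open_contains_cball by blast

lemma has_cells: "has_cells_at p"
  unfolding has_cells_at_def
proof (intro allI impI)
  fix Q assume "open Q \<and> p \<in> Q"
  then obtain e where e: "e > 0" "cball (f p) e \<subseteq> f ` (D \<inter> Q)" using small_ball by blast
  let ?b = "ball (f p) e" and ?c = "cball (f p) e"
  have b: "?b \<subseteq> f ` D" and c: "?c \<subseteq> f ` D" using e(2) ball_subset_cball[of "f p" e] by blast+
  have hc: "continuous_on ?c h" "continuous_on ?b h" using cont(2) b c continuous_on_subset by blast+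
  show "\<exists>B F. open B \<and> p \<in> B \<and> B \<subseteq> F \<and> compact F \<and> F \<subseteq> Q \<and> path_connected B \<and> path_trivial B"
  proof (intro exI conjI)
    show "open (h ` ?b)" by (rule open_image_inverse[OF open_ball b])
    show "p \<in> h ` ?b" using inverse(1)[OF p] e(1) by (intro image_eqI[of _ _ "f p"]) auto
    show "h ` ?b \<subseteq> h ` ?c" by (intro image_mono ball_subset_cball)
    show "compact (h ` ?c)" by (rule compact_continuous_image[OF hc(1) compact_cball])
    show "h ` ?c \<subseteq> Q" using e(2) inverse(1) by auto
    show "path_connected (h ` ?b)"
      by (rule path_connected_continuous_image[OF hc(2)]) (simp add: convex_imp_path_connected)
    show "path_trivial (h ` ?b)"
      unfolding path_trivial_def
    proof (intro allI impI, elim conjE)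
      fix u v assume uv: "path u" "path_image u \<subseteq> h ` ?b" "path v" "path_image v \<subseteq> h ` ?b"
        "pathstart u = pathstart v" "pathfinish u = pathfinish v"
      have hb: "h ` ?b \<subseteq> D" "f ` h ` ?b \<subseteq> ?b" using b inverse by (auto simp: subset_iff)
      then have cf: "continuous_on (h ` ?b) f" using cont(1) continuous_on_subset by blast
      have pth: "path (f \<circ> w)" "\<And>t. t \<in> {0..1} \<Longrightarrow> (f \<circ> w) t \<in> ?b" "\<And>t. t \<in> {0..1} \<Longrightarrow> (h \<circ> (f \<circ> w)) t = w t"
        if w: "path w" "path_image w \<subseteq> h ` ?b" for w
      proof -
        show "path (f \<circ> w)" using w cf continuous_on_subset by (intro path_continuous_image) blast+
        fix t :: real assume "t \<in> {0..1}"
        then have "w t \<in> h ` ?b" using w(2) by (auto simp: path_image_def)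
        then show "(f \<circ> w) t \<in> ?b" "(h \<circ> (f \<circ> w)) t = w t" using hb inverse(1) by (auto simp del: mem_ball)
      qed
      have "homotopic_paths ?b (f \<circ> u) (f \<circ> v)"
      proof (rule homotopic_paths_linear)
        show "closed_segment ((f \<circ> u) t) ((f \<circ> v) t) \<subseteq> ?b" if "t \<in> {0..1}" for t
          using pth(2)[OF uv(1,2) that] pth(2)[OF uv(3,4) that] by (intro closed_segment_subset convex_ball)
      qed (use uv pth(1) in \<open>auto simp: pathstart_compose pathfinish_compose\<close>)
      then have "homotopic_paths (h ` ?b) (h \<circ> (f \<circ> u)) (h \<circ> (f \<circ> v))"
        using hc(2) by (rule homotopic_paths_continuous_image) auto
      moreover have "homotopic_paths (h ` ?b) u (h \<circ> (f \<circ> u))"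
        using pth(3)[OF uv(1,2)] uv(1,2) by (intro homotopic_paths_eq) auto
      moreover have "homotopic_paths (h ` ?b) v (h \<circ> (f \<circ> v))"
        using pth(3)[OF uv(3,4)] uv(3,4) by (intro homotopic_paths_eq) auto
      ultimately show "homotopic_paths (h ` ?b) u v"
        by (meson homotopic_paths_trans homotopic_paths_sym)
    qed
  qed
qed

lemma connected_above_from_chart:
  fixes \<phi> :: "'a \<Rightarrow> real"
  defines "G \<equiv> \<lambda>x. \<phi> (h (f p + x))"
  assumes loc: "\<And>e. e > 0 \<Longrightarrow> (\<exists>x\<in>ball 0 e. G 0 < G x) \<and>
    (\<exists>r>0. r \<le> e \<and> (\<forall>a\<in>ball 0 r. \<forall>b\<in>ball 0 r. G 0 < G a \<and> G 0 < G b \<longrightarrow>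
      path_component (ball 0 e \<inter> {x. G 0 < G x}) a b))"
  shows "connected_above \<phi> p"
  unfolding connected_above_def
proof (intro allI impI)
  fix Q assume Q: "open Q \<and> p \<in> Q"
  then obtain e where e: "e > 0" "cball (f p) e \<subseteq> f ` (D \<inter> Q)" using small_ball by blast
  define k where "k x = h (f p + x)" for x
  have G: "G x = \<phi> (k x)" for x by (simp add: G_def k_def)
  have k0: "k 0 = p" using inverse(1)[OF p] by (simp add: k_def)
  have sh: "f p + x \<in> f ` (D \<inter> Q)" if "x \<in> ball 0 e" for x
    using that e(2) by (auto simp: dist_norm)
  have kQ: "k x \<in> Q" if "x \<in> ball 0 e" for x
    using sh[OF that] inverse(1) by (auto simp: k_def)
  have kc: "continuous_on (ball 0 e) k"
    unfolding k_def
  proof (rule continuous_on_compose2[OF cont(2)])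
    show "(+) (f p) ` ball 0 e \<subseteq> f ` D" using sh by blast
  qed (intro continuous_intros)
  obtain r where r: "r > 0" "r \<le> e" "\<And>a b. a \<in> ball 0 r \<Longrightarrow> b \<in> ball 0 r \<Longrightarrow> G 0 < G a \<Longrightarrow> G 0 < G b \<Longrightarrow>
      path_component (ball 0 e \<inter> {x. G 0 < G x}) a b"
    using loc[OF e(1)] by blast
  have rb: "ball (f p) r \<subseteq> f ` (D \<inter> Q)" using e(2) r(2) by (auto simp: subset_iff)
  show "(\<exists>x\<in>Q. \<phi> p < \<phi> x) \<and> (\<exists>Q'. open Q' \<and> p \<in> Q' \<and> Q' \<subseteq> Q \<and>
      (\<forall>a\<in>Q'. \<forall>b\<in>Q'. \<phi> p < \<phi> a \<and> \<phi> p < \<phi> b \<longrightarrow> path_component (Q \<inter> {x. \<phi> p < \<phi> x}) a b))"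
  proof (intro conjI exI[of _ "h ` ball (f p) r"] ballI impI)
    show "\<exists>x\<in>Q. \<phi> p < \<phi> x" using loc[OF e(1)] kQ k0 by (auto simp: G simp del: mem_ball)
    show "open (h ` ball (f p) r)" using rb by (intro open_image_inverse) auto
    show "p \<in> h ` ball (f p) r" using inverse(1)[OF p] r(1) by (intro image_eqI[of _ _ "f p"]) auto
    show "h ` ball (f p) r \<subseteq> Q" using rb inverse(1) by (force simp del: mem_ball)
    fix a b assume "a \<in> h ` ball (f p) r" "b \<in> h ` ball (f p) r" and gt: "\<phi> p < \<phi> a \<and> \<phi> p < \<phi> b"
    then obtain a' b' where ab': "a' \<in> ball (f p) r" "a = h a'" "b' \<in> ball (f p) r" "b = h b'" by blast
    define u v where "u = a' - f p" and "v = b' - f p"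
    have uv: "u \<in> ball 0 r" "v \<in> ball 0 r" "k u = a" "k v = b"
      using ab' by (auto simp: u_def v_def k_def dist_norm norm_minus_commute)
    obtain \<gamma> where \<gamma>: "path \<gamma>" "path_image \<gamma> \<subseteq> ball 0 e \<inter> {x. G 0 < G x}" "pathstart \<gamma> = u" "pathfinish \<gamma> = v"
      using r(3)[OF uv(1,2)] gt uv(3,4) k0 unfolding G path_component_def by auto
    have "path (k \<circ> \<gamma>)" using \<gamma>(1,2) kc continuous_on_subset by (intro path_continuous_image) blast+
    moreover have "path_image (k \<circ> \<gamma>) \<subseteq> Q \<inter> {x. \<phi> p < \<phi> x}"
      using \<gamma>(2) kQ k0 unfolding path_image_compose G by auto
    ultimately show "path_component (Q \<inter> {x. \<phi> p < \<phi> x}) a b"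
      unfolding path_component_def using \<gamma>(3,4) uv(3,4)
      by (intro exI[of _ "k \<circ> \<gamma>"]) (simp add: pathstart_compose pathfinish_compose)
  qed
qed

lemma strict_local_max_from_chart:
  fixes \<phi> :: "'a \<Rightarrow> real"
  assumes "r > 0" "\<And>x. x \<in> ball 0 r \<Longrightarrow> x \<noteq> 0 \<Longrightarrow> \<phi> (h (f p + x)) < \<phi> (h (f p + 0))"
  shows "strict_local_max \<phi> p"
proof -
  obtain e where e: "e > 0" "cball (f p) e \<subseteq> f ` (D \<inter> UNIV)" using small_ball[of UNIV] by auto
  let ?r = "min r e"
  have sub: "ball (f p) ?r \<subseteq> f ` D" using e(2) by (auto simp: subset_iff)
  have "\<phi> x < \<phi> p" if x: "x \<in> h ` ball (f p) ?r - {p}" for x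
  proof -
    obtain y where y: "y \<in> ball (f p) ?r" "x = h y" using x by blast
    have "y \<noteq> f p" using x y inverse(1)[OF p] by auto
    moreover have "y - f p \<in> ball 0 r" using y(1) by (auto simp: dist_norm norm_minus_commute)
    ultimately show ?thesis using assms(2)[of "y - f p"] y(2) inverse(1)[OF p] by simp
  qed
  moreover have "open (h ` ball (f p) ?r)" by (rule open_image_inverse[OF open_ball sub])
  moreover have "p \<in> h ` ball (f p) ?r"
    using inverse(1)[OF p] assms(1) e(1) by (intro image_eqI[of _ _ "f p"]) auto
  ultimately show ?thesis unfolding strict_local_max_def by blast
qed

end

lemma chart_at_mem:
  assumes "smooth_atlas A"
  shows "chart_at A p \<in> A" "p \<in> fst (chart_at A p)"
proof -
  have "p \<in> (\<Union>c\<in>A. fst c)" using assms unfolding smooth_atlas_def by blast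
  then have "\<exists>c. c \<in> A \<and> p \<in> fst c" by blast
  then have "chart_at A p \<in> A \<and> p \<in> fst (chart_at A p)" unfolding chart_at_def by (rule someI_ex)
  then show "chart_at A p \<in> A" "p \<in> fst (chart_at A p)" by auto
qed

lemma coordinate_chart_at:
  assumes "smooth_atlas (A :: ('a::t2_space, 'e::euclidean_space) chart set)"
  shows "coordinate_chart (fst (chart_at A p)) (snd (chart_at A p))
    (inv_into (fst (chart_at A p)) (snd (chart_at A p))) p"
proof -
  have "is_chart (chart_at A p)" using chart_at_mem(1)[OF assms] assms unfolding smooth_atlas_def by blast
  then show ?thesis using chart_at_mem(2)[OF assms, of p]
    by unfold_locales (auto simp: is_chart_def split: prod.splits)
qed

lemma smooth_local_rep:
  assumes "smooth_atlas A" "smooth_function A \<phi>"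
  shows "smooth_on (snd (chart_at A p) ` fst (chart_at A p)) (local_rep A \<phi> p)"
  using chart_at_mem(1)[OF assms(1), of p] assms(2)
  by (auto simp: smooth_function_def local_rep_def split: prod.splits)

lemma smooth_function_continuous:
  fixes A :: "('a::t2_space, 'e::euclidean_space) chart set"
  assumes "smooth_atlas A" "smooth_function A \<phi>"
  shows "continuous_on UNIV \<phi>"
proof (rule continuous_at_imp_continuous_on, rule ballI)
  fix p
  let ?D = "fst (chart_at A p)" and ?f = "snd (chart_at A p)"
  interpret coordinate_chart ?D ?f "inv_into ?D ?f" p by (rule coordinate_chart_at[OF assms(1)])
  have "Ck_on 0 (?f ` ?D) (local_rep A \<phi> p)"
    using smooth_local_rep[OF assms] unfolding smooth_on_def by (rule spec)
  then have "continuous_on ?D (\<lambda>x. local_rep A \<phi> p (?f x))"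
    unfolding Ck_on.simps(1) by (rule continuous_on_compose2[OF _ cont(1)]) (rule subset_refl)
  moreover have "local_rep A \<phi> p (?f x) = \<phi> x" if "x \<in> ?D" for x
    using inverse(1)[OF that] by (simp add: local_rep_def)
  ultimately have "continuous_on ?D \<phi>" using continuous_on_cong by (metis (no_types, lifting))
  then show "isCont \<phi> p" using D(1) p by (simp add: continuous_on_eq_continuous_at)
qed

text \<open>
  Each \<open>x \<mapsto> g' x b\<close> is differentiable at \<open>x0\<close> and vanishes there. Expanding the direction \<open>v\<close> in the
  standard basis makes the resulting estimates uniform in \<open>v\<close>, at the cost of the factor \<open>DIM('e)\<close>.
\<close>

lemma second_derivative_expansion:
  fixes g :: "'e::euclidean_space \<Rightarrow> real" and x0 :: 'e
  defines "g' \<equiv> \<lambda>x v. frechet_derivative g (at x) v"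
  defines "H \<equiv> \<lambda>v w. frechet_derivative (\<lambda>x. g' x w) (at x0) v"
  assumes S: "open S" "x0 \<in> S" and g: "smooth_on S g" and crit: "(g has_derivative (\<lambda>v. 0)) (at x0)"
  shows "critical_expansion (\<lambda>x. g (x0 + x)) (\<lambda>x. g' (x0 + x)) H"
proof
  have der: "(g has_derivative g' x) (at x)" and d2: "(\<lambda>x. g' x v) differentiable (at x)" if "x \<in> S" for x v
    using smooth_on_derivatives[OF g that] by (simp_all add: g'_def)
  obtain R where R: "R > 0" "ball x0 R \<subseteq> S" using S open_contains_ball by blast
  show "\<exists>R>0. \<forall>x\<in>ball 0 R. ((\<lambda>x. g (x0 + x)) has_derivative g' (x0 + x)) (at x)"
  proof (intro exI[of _ R] conjI ballI R(1))
    fix x :: 'e assume "x \<in> ball 0 R"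
    then have "x0 + x \<in> S" using R(2) by (auto simp: dist_norm subset_iff)
    then have d: "(g has_derivative g' (x0 + x)) (at (x0 + x))" by (rule der)
    show "((\<lambda>x. g (x0 + x)) has_derivative g' (x0 + x)) (at x)"
      by (rule has_derivative_translate[OF d])
  qed
  have H: "((\<lambda>x. g' x v) has_derivative (\<lambda>w. H w v)) (at x0)" for v
    using d2[OF S(2), of v] unfolding H_def frechet_derivative_works by simp
  have lin: "linear (g' x)" if "x \<in> S" for x using der[OF that] has_derivative_linear by blast
  show bil: "bilinear H"
    unfolding bilinear_def
  proof (intro conjI allI)
    show "linear (\<lambda>w. H w v)" for v using H has_derivative_linear by blast
    fix w
    have uniq: "F = (\<lambda>w. H w v)" if "((\<lambda>x. g' x v) has_derivative F) (at x0)" for F v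
      using that H by (rule has_derivative_unique)
    show "linear (H w)"
    proof (rule linearI)
      fix u v
      have "((\<lambda>x. g' x u + g' x v) has_derivative (\<lambda>w. H w u + H w v)) (at x0)"
        by (intro has_derivative_add H)
      then have "((\<lambda>x. g' x (u + v)) has_derivative (\<lambda>w. H w u + H w v)) (at x0)"
        by (rule has_derivative_transform_within_open[OF _ S]) (simp add: linear_add[OF lin])
      from fun_cong[OF uniq[OF this], of w] show "H w (u + v) = H w u + H w v" by (rule sym)
    next
      fix c u
      have "((\<lambda>x. c *\<^sub>R g' x u) has_derivative (\<lambda>w. c *\<^sub>R H w u)) (at x0)"
        by (intro has_derivative_scaleR_right H)
      then have "((\<lambda>x. g' x (c *\<^sub>R u)) has_derivative (\<lambda>w. c *\<^sub>R H w u)) (at x0)"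
        by (rule has_derivative_transform_within_open[OF _ S]) (simp add: linear_cmul[OF lin])
      from fun_cong[OF uniq[OF this], of w] show "H w (c *\<^sub>R u) = c *\<^sub>R H w u" by (rule sym)
    qed
  qed
  have g'0: "g' x0 v = 0" for v
    using has_derivative_unique[OF der[OF S(2)] crit] by simp
  fix \<epsilon> :: real assume \<epsilon>: "\<epsilon> > 0"
  have "\<exists>r>0. \<forall>x\<in>ball 0 r. \<bar>g' (x0 + x) b - H x b\<bar> \<le> \<epsilon> / DIM('e) * norm x" for b
  proof -
    have "\<epsilon> / DIM('e) > 0" using \<epsilon> by simp
    then obtain r where "r > 0" "\<forall>y. norm (y - x0) < r \<longrightarrow>
        norm (g' y b - g' x0 b - H (y - x0) b) \<le> \<epsilon> / DIM('e) * norm (y - x0)"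
      using H[of b] unfolding has_derivative_at_alt by blast
    then show ?thesis using g'0 by (intro exI[of _ r] conjI ballI) (auto dest!: spec[of _ "x0 + _"])
  qed
  then obtain r where r: "\<And>b. r b > 0"
    "\<And>b x. x \<in> ball 0 (r b) \<Longrightarrow> \<bar>g' (x0 + x) b - H x b\<bar> \<le> \<epsilon> / DIM('e) * norm x"
    by metis
  define r0 where "r0 = min R (Min (r ` Basis))"
  have r0: "r0 > 0" "r0 \<le> R" "\<And>b. b \<in> Basis \<Longrightarrow> r0 \<le> r b"
    using r(1) R(1) by (auto simp: r0_def min_le_iff_disj)
  show "\<exists>r>0. \<forall>x\<in>ball 0 r. \<forall>v. \<bar>g' (x0 + x) v - H x v\<bar> \<le> \<epsilon> * norm x * norm v"
  proof (intro exI[of _ r0] conjI ballI allI r0(1))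
    fix x v :: 'e assume x: "x \<in> ball 0 r0"
    then have "x0 + x \<in> S" using R(2) r0(2) by (auto simp: dist_norm subset_iff)
    have expand: "F v = (\<Sum>b\<in>Basis. (v \<bullet> b) * F b)" if "linear F" for F :: "'e \<Rightarrow> real"
    proof -
      have "F v = F (\<Sum>b\<in>Basis. (v \<bullet> b) *\<^sub>R b)" by (simp add: euclidean_representation)
      then show ?thesis unfolding linear_sum[OF that] linear_cmul[OF that] by simp
    qed
    have "linear (\<lambda>v. g' (x0 + x) v - H x v)"
      using lin[OF \<open>x0 + x \<in> S\<close>] bil by (intro linear_compose_sub) (auto simp: bilinear_def)
    then have "g' (x0 + x) v - H x v = (\<Sum>b\<in>Basis. (v \<bullet> b) * (g' (x0 + x) b - H x b))"
      by (rule expand)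
    then have "\<bar>g' (x0 + x) v - H x v\<bar> \<le> (\<Sum>b\<in>Basis. \<bar>(v \<bullet> b) * (g' (x0 + x) b - H x b)\<bar>)"
      by (simp only: sum_abs)
    also have "\<dots> \<le> (\<Sum>b\<in>(Basis::'e set). norm v * (\<epsilon> / DIM('e) * norm x))"
    proof (rule sum_mono)
      fix b :: 'e assume b: "b \<in> Basis"
      have "x \<in> ball 0 (r b)" using x r0(3)[OF b] by simp
      then show "\<bar>(v \<bullet> b) * (g' (x0 + x) b - H x b)\<bar> \<le> norm v * (\<epsilon> / DIM('e) * norm x)"
        unfolding abs_mult by (intro mult_mono r(2) Basis_le_norm b) auto
    qed
    also have "\<dots> = \<epsilon> * norm x * norm v" by simp
    finally show "\<bar>g' (x0 + x) v - H x v\<bar> \<le> \<epsilon> * norm x * norm v" .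
  qed
qed

text \<open>
  The trichotomy behind the theorem. With \<open>P\<close> a maximal positive definite subspace for the Hessian,
  \<open>dim P\<close> is the dimension minus the index, so that excluding the index \<open>DIM('e) - 1\<close> excludes
  \<open>dim P = 1\<close>.
\<close>

lemma connected_above_or_strict_local_max:
  fixes A :: "('a::t2_space, 'e::euclidean_space) chart set"
  assumes A: "smooth_atlas A" and \<phi>: "morse_function A \<phi>"
    and p: "p \<notin> critical_points_of_index A \<phi> (DIM('e) - 1)"
  shows "strict_local_max \<phi> p \<or> connected_above \<phi> p"
proof -
  let ?D = "fst (chart_at A p)" and ?f = "snd (chart_at A p)"
  let ?h = "inv_into ?D ?f"
  interpret coordinate_chart ?D ?f ?h p by (rule coordinate_chart_at[OF A])
  define g where "g = local_rep A \<phi> p"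
  define x0 where "x0 = coords_at A p"
  define g' where "g' = (\<lambda>x v. frechet_derivative g (at x) v)"
  have x0: "x0 = ?f p" "x0 \<in> ?f ` ?D" using p by (auto simp: x0_def coords_at_def \<open>p \<in> ?D\<close>)
  have G: "\<phi> (?h (?f p + x)) = g (x0 + x)" for x by (simp add: g_def local_rep_def x0)
  have smooth: "smooth_on (?f ` ?D) g"
    unfolding g_def using \<phi> smooth_local_rep[OF A] by (simp add: morse_function_def)
  show ?thesis
  proof (cases "critical_point A \<phi> p")
    case True
    define H where "H = (\<lambda>v w. frechet_derivative (\<lambda>x. g' x w) (at x0) v)"
    have Hh: "hessian A \<phi> p = H"
      by (intro ext) (simp add: hessian_def H_def g'_def g_def x0_def)
    interpret critical_expansion "\<lambda>x. g (x0 + x)" "\<lambda>x. g' (x0 + x)" H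
      using second_derivative_expansion[OF D(2) x0(2) smooth] True
      by (simp add: critical_point_def g_def x0_def g'_def H_def)
    have "nondegenerate A \<phi> p" using \<phi> True by (simp add: morse_function_def)
    then have nondeg: "x = 0" if "\<And>y. H x y = 0" for x
      using that unfolding nondegenerate_def Hh by blast
    obtain W P where WP: "subspace W" "subspace P" "dim W = morse_index A \<phi> p" "dim P + morse_index A \<phi> p = DIM('e)"
      "\<And>x. \<exists>w\<in>W. \<exists>y\<in>P. x = w + y" "\<And>w y. w \<in> W \<Longrightarrow> y \<in> P \<Longrightarrow> H w y = 0"
      "\<And>w. w \<in> W \<Longrightarrow> w \<noteq> 0 \<Longrightarrow> H w w < 0" "\<And>y. y \<in> P \<Longrightarrow> y \<noteq> 0 \<Longrightarrow> 0 < H y y"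
      by (rule definite_decomposition[OF H symmetric nondeg, of "morse_index A \<phi> p"])
        (simp_all add: morse_index_def Hh)
    have "morse_index A \<phi> p \<noteq> DIM('e) - 1"
      using assms(3) True by (simp add: critical_points_of_index_def)
    then consider "dim P = 0" | "2 \<le> dim P" using WP(4) by linarith
    then show ?thesis
    proof cases
      case 1
      then have "P \<subseteq> {0}" by (simp add: dim_eq_0)
      then have "x \<in> W" for x using WP(5)[of x] by auto
      then have neg: "H x x < 0" if "x \<noteq> 0" for x using WP(7) that by blast
      have "\<exists>r>0. \<forall>x\<in>ball 0 r. x \<noteq> 0 \<longrightarrow> g (x0 + x) < g (x0 + 0)"
        by (rule negative_definite_strict_max[OF neg]) blast+
      then obtain r where "r > 0" "\<And>x. x \<in> ball 0 r \<Longrightarrow> x \<noteq> 0 \<Longrightarrow> g (x0 + x) < g (x0 + 0)"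
        by blast
      then have "strict_local_max \<phi> p"
        by (rule strict_local_max_from_chart[of r \<phi>, unfolded G])
      then show ?thesis ..
    next
      case 2
      have "connected_above \<phi> p"
        by (rule connected_above_from_chart)
          (unfold G, rule connected_above_critical[OF WP(1,7,2) 2 WP(8,6,5)])
      then show ?thesis ..
    qed
  next
    case False
    have der: "(g has_derivative g' x) (at x)" and d2: "(\<lambda>x. g' x v) differentiable (at x)" if "x \<in> ?f ` ?D" for x v
      using smooth_on_derivatives[OF smooth that] by (simp_all add: g'_def)
    obtain R where R: "R > 0" "ball x0 R \<subseteq> ?f ` ?D" using x0 D(2) open_contains_ball by blast
    have d: "((\<lambda>x. g (x0 + x)) has_derivative g' (x0 + x)) (at x)" if "x \<in> ball 0 R" for x
    proof -
      have "x0 + x \<in> ?f ` ?D" using R(2) that by (auto simp: dist_norm subset_iff)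
      then have d: "(g has_derivative g' (x0 + x)) (at (x0 + x))" by (rule der)
      show "((\<lambda>x. g (x0 + x)) has_derivative g' (x0 + x)) (at x)"
        by (rule has_derivative_translate[OF d])
    qed
    have "g' x0 \<noteq> (\<lambda>v. 0)" using False der[OF x0(2)] by (auto simp: critical_point_def g_def x0_def)
    then obtain v0 where "g' x0 v0 \<noteq> 0" by auto
    moreover have "g' x0 (- v0) = - g' x0 v0"
      using linear_neg[OF has_derivative_linear[OF der[OF x0(2)]]] .
    ultimately obtain v where v: "0 < g' (x0 + 0) v"
      by (metis add.right_neutral linorder_neqE_linordered_idom neg_0_less_iff_less)
    have "isCont (\<lambda>x. g' x v) (x0 + 0)" using differentiable_imp_continuous_within[OF d2[OF x0(2)]] by simp
    then have c: "isCont (\<lambda>x. g' (x0 + x) v) 0"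
      by (rule isCont_o2[rotated]) (intro continuous_intros)
    have "connected_above \<phi> p"
      by (rule connected_above_from_chart)
        (unfold G, rule connected_above_regular[OF R(1) d c v])
    then show ?thesis ..
  qed
qed

section \<open>Neighborhoods of infinity and superlevel sets\<close>

lemma compact_sublevel:
  assumes "exhausting \<phi>"
  shows "compact (\<phi> -` {a..b})" "compact (\<phi> -` {..b})"
proof -
  have c: "compact (\<phi> -` {a..b})" for a b
    using compactin_proper_map_preimage[of euclidean euclidean \<phi> "{a..b}"] assms
    by (simp add: exhausting_def vimage_def)
  then show "compact (\<phi> -` {a..b})" .
  obtain m where "\<And>x. m \<le> \<phi> x" using assms by (auto simp: exhausting_def bdd_below_def)
  then have "\<phi> -` {..b} = \<phi> -` {m..b}" by auto
  then show "compact (\<phi> -` {..b})" using c by simp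
qed

lemma neighborhood_system_antimono:
  assumes "neighborhood_system U" "i \<le> j"
  shows "U j \<subseteq> U i"
  using assms(2) by (rule lift_Suc_antimono_le[rotated]) (use assms(1) in \<open>simp add: neighborhood_system_def\<close>)

lemma neighborhood_disjoint_compact:
  fixes U :: "nat \<Rightarrow> 'a::t2_space set"
  assumes U: "neighborhood_system U" and K: "compact K"
  shows "\<exists>i. U i \<inter> K = {}"
proof -
  have "x \<in> (\<Union>i\<in>UNIV. - closure (U i))" for x
  proof -
    have "x \<notin> (\<Inter>i. U i)" using U by (simp add: neighborhood_system_def)
    then obtain i where "x \<notin> U i" by blast
    then have "x \<notin> closure (U (Suc i))" using U by (auto simp: neighborhood_system_def)
    then show ?thesis by blast
  qed
  then have cover: "K \<subseteq> (\<Union>i\<in>UNIV. - closure (U i))" by blast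
  have "\<exists>I. finite I \<and> K \<subseteq> (\<Union>i\<in>I. - closure (U i))"
    by (rule compactE_image[OF K _ cover]) (rule open_Compl, rule closed_closure, blast)
  then obtain I where I: "finite I" "K \<subseteq> (\<Union>i\<in>I. - closure (U i))" by blast
  have False if x: "x \<in> U (Max (insert 0 I))" "x \<in> K" for x
  proof -
    obtain i where i: "i \<in> I" "x \<notin> closure (U i)" using I(2) x(2) by blast
    have "i \<le> Max (insert 0 I)" using I(1) i(1) by simp
    then have "x \<in> U i" using neighborhood_system_antimono[OF U] x(1) by blast
    then show False using i(2) closure_subset by blast
  qed
  then show ?thesis by blast
qed

lemma superlevel_inside_neighborhood:
  fixes \<phi> :: "'a::topological_space \<Rightarrow> real"
  assumes "compact (- S)" "continuous_on UNIV \<phi>"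
  shows "\<exists>s>t. \<phi> -` {s<..} \<subseteq> S"
proof -
  have "bounded (\<phi> ` (- S))"
    using assms compact_continuous_image continuous_on_subset compact_imp_bounded by (metis subset_UNIV)
  then obtain B where "\<And>x. x \<in> - S \<Longrightarrow> \<phi> x \<le> B"
    by (auto simp: bounded_real abs_le_iff)
  then show ?thesis by (intro exI[of _ "max B (t + 1)"]) force
qed

lemma open_components_of_cells:
  fixes S :: "'a::topological_space set"
  assumes "\<And>p::'a. has_cells_at p" "open S" "C \<in> components S"
  shows "open C"
proof (subst open_subopen, rule ballI)
  fix x assume x: "x \<in> C"
  then have "x \<in> S" using assms(3) in_components_subset by blast
  then obtain B F where B: "open B" "x \<in> B" "B \<subseteq> F" "F \<subseteq> S" "path_connected B"
    using assms(1)[of x] assms(2) unfolding has_cells_at_def by metis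
  have "B \<subseteq> C"
    using B x by (intro components_maximal[OF assms(3) path_connected_imp_connected]) auto
  then show "\<exists>T. open T \<and> x \<in> T \<and> T \<subseteq> C" using B by blast
qed

lemma end_component_exists:
  fixes S :: "'a::topological_space set"
  assumes "\<And>p::'a. has_cells_at p" "open S" "V \<in> ends U" "U i \<subseteq> S"
  shows "\<exists>C. end_component V S C"
proof -
  have V: "V i \<in> components (U i)" using assms(3) by (simp add: ends_def)
  have ne: "V i \<noteq> {}" using in_components_nonempty[OF V] .
  have "connected (V i)" "V i \<subseteq> S"
    using in_components_connected[OF V] in_components_subset[OF V] assms(4) by auto
  then obtain C where C: "C \<in> components S" "V i \<subseteq> C"
    using exists_component_superset[of "V i" S] ne by blast
  have "open C" by (rule open_components_of_cells[OF assms(1,2) C(1)])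
  then have "end_component V S C" using C by (auto simp: end_component_def end_neighborhood_def)
  then show ?thesis ..
qed

section \<open>The progroup along a ray\<close>

definition conjugate_path :: "(real \<Rightarrow> 'a::topological_space) \<Rightarrow> (real \<Rightarrow> 'a) \<Rightarrow> real \<Rightarrow> 'a" where
  "conjugate_path c g = c +++ (g +++ reversepath c)"

lemma conjugate_path_loop:
  assumes "g \<in> loops_at S y" "path c" "path_image c \<subseteq> S" "pathstart c = x" "pathfinish c = y"
  shows "conjugate_path c g \<in> loops_at S x"
  using assms by (simp add: loops_at_def conjugate_path_def subset_path_image_join)

lemma conjugate_path_cong:
  assumes "homotopic_paths S c c'" "homotopic_paths S g g'" "pathfinish c = pathstart g" "pathfinish g = pathfinish c"
  shows "homotopic_paths S (conjugate_path c g) (conjugate_path c' g')"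
  unfolding conjugate_path_def using assms
  by (intro homotopic_paths_join) (simp_all add: homotopic_paths_reversepath)

lemma conjugate_path_join:
  assumes "g \<in> loops_at S y" "path c" "path_image c \<subseteq> S" "path b" "path_image b \<subseteq> S"
    "pathfinish b = pathstart c" "pathfinish c = y"
  shows "homotopic_paths S (conjugate_path b (conjugate_path c g)) (conjugate_path (b +++ c) g)"
proof -
  have g: "path g" "path_image g \<subseteq> S" "pathstart g = y" "pathfinish g = y"
    using assms(1) by (auto simp: loops_at_def)
  note ps = g assms(2-) subset_path_image_join
  let ?c = "reversepath c" and ?b = "reversepath b"
  have j: "homotopic_paths S (p +++ q) (p' +++ q')"
    if "homotopic_paths S p p'" "homotopic_paths S q q'" "pathfinish p = pathstart q" for p p' q q'
    using that by (rule homotopic_paths_join)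
  have r: "homotopic_paths S q q" if "path q" "path_image q \<subseteq> S" for q
    using that by simp
  have "homotopic_paths S (b +++ ((c +++ (g +++ ?c)) +++ ?b)) (b +++ (c +++ ((g +++ ?c) +++ ?b)))"
    by (intro j r homotopic_paths_sym[OF homotopic_paths_assoc]) (simp_all add: ps)
  also have "homotopic_paths S \<dots> (b +++ (c +++ (g +++ (?c +++ ?b))))"
    by (intro j r homotopic_paths_sym[OF homotopic_paths_assoc]) (simp_all add: ps)
  also have "homotopic_paths S \<dots> ((b +++ c) +++ (g +++ (?c +++ ?b)))"
    by (rule homotopic_paths_assoc) (simp_all add: ps)
  finally show ?thesis
    unfolding conjugate_path_def using assms(6) by (simp add: reversepath_joinpaths)
qed

lemma conjugate_path_const:
  assumes "g \<in> loops_at S x"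
  shows "homotopic_paths S (conjugate_path (\<lambda>_. x) g) g"
proof -
  have g: "path g" "path_image g \<subseteq> S" "pathstart g = x" "pathfinish g = x"
    using assms by (auto simp: loops_at_def)
  then have xS: "x \<in> S" using pathstart_in_path_image[of g] by auto
  have r: "reversepath (\<lambda>_. x) = (\<lambda>_::real. x)" by (auto simp: reversepath_def)
  have "homotopic_paths S ((\<lambda>_. x) +++ (g +++ (\<lambda>_. x))) (g +++ (\<lambda>_. x))"
    using g xS by (intro homotopic_paths_const_left) (auto simp: path_const subset_path_image_join)
  also have "homotopic_paths S \<dots> g"
    using g by (intro homotopic_paths_const_right) auto
  finally show ?thesis by (simp add: conjugate_path_def r)
qed

lemma conjugate_path_reverse:
  assumes "g \<in> loops_at S x" "path c" "path_image c \<subseteq> S" "pathstart c = x"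
  shows "homotopic_paths S (conjugate_path c (conjugate_path (reversepath c) g)) g"
proof -
  have g: "path g" "path_image g \<subseteq> S" "pathstart g = x" "pathfinish g = x"
    using assms by (auto simp: loops_at_def)
  have "homotopic_paths S (conjugate_path c (conjugate_path (reversepath c) g)) (conjugate_path (c +++ reversepath c) g)"
    using assms by (intro conjugate_path_join) auto
  also have "homotopic_paths S \<dots> (conjugate_path (\<lambda>_. x) g)"
    using assms g by (intro conjugate_path_cong homotopic_paths_right_inverse) auto
  also have "homotopic_paths S \<dots> g" by (rule conjugate_path_const[OF assms(1)])
  finally show ?thesis .
qed

locale ray =
  fixes U :: "nat \<Rightarrow> 'a::topological_space set" and \<gamma> :: "real \<Rightarrow> 'a"
  assumes U: "neighborhood_system U" and cont: "continuous_on {0..} \<gamma>"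
    and inside: "\<And>i. \<gamma> ` {real i..} \<subseteq> U i"
begin

lemma cont_on: "0 \<le> a \<Longrightarrow> continuous_on {a..b} \<gamma>"
  using cont by (rule continuous_on_subset) auto

lemma segment:
  assumes "0 \<le> a" "a \<le> b"
  shows "path (segment_of \<gamma> a b)" "pathstart (segment_of \<gamma> a b) = \<gamma> a" "pathfinish (segment_of \<gamma> a b) = \<gamma> b"
    "path_image (segment_of \<gamma> a b) = \<gamma> ` {a..b}"
  using segment_of_path[OF cont_on assms(2)] assms(1) by auto

lemma segment_inside: "real i \<le> a \<Longrightarrow> a \<le> b \<Longrightarrow> path_image (segment_of \<gamma> a b) \<subseteq> U i"
proof -
  assume a: "real i \<le> a" "a \<le> b"
  then have "\<gamma> ` {a..b} \<subseteq> \<gamma> ` {real i..}" by auto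
  moreover have "0 \<le> a" using a(1) of_nat_0_le_iff order_trans by blast
  ultimately show ?thesis using segment(4)[OF _ a(2)] inside[of i] by auto
qed

lemma conjugate_segments:
  assumes "g \<in> loops_at S (\<gamma> c)" "\<gamma> ` {a..c} \<subseteq> S" "0 \<le> a" "a \<le> b" "b \<le> c"
  shows "homotopic_paths S (conjugate_path (segment_of \<gamma> a b) (conjugate_path (segment_of \<gamma> b c) g))
    (conjugate_path (segment_of \<gamma> a c) g)"
proof -
  have le: "a \<le> c" "0 \<le> b" using assms by auto
  note s = segment[OF assms(3,4)] segment[OF le(2) assms(5)] segment[OF assms(3) le(1)]
  have im: "\<gamma> ` {a..b} \<subseteq> S" "\<gamma> ` {b..c} \<subseteq> S" using assms by (auto simp: image_subset_iff)
  have g: "path g" "path_image g \<subseteq> S" "pathstart g = \<gamma> c" "pathfinish g = \<gamma> c"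
    using assms(1) by (auto simp: loops_at_def)
  have "homotopic_paths S (conjugate_path (segment_of \<gamma> a b) (conjugate_path (segment_of \<gamma> b c) g))
      (conjugate_path (segment_of \<gamma> a b +++ segment_of \<gamma> b c) g)"
    by (rule conjugate_path_join[OF assms(1)]) (simp_all add: s im)
  also have "homotopic_paths S \<dots> (conjugate_path (segment_of \<gamma> a c) g)"
    using g by (intro conjugate_path_cong segment_of_join[OF cont_on assms(2,4,5)]) (simp_all add: s assms(3))
  finally show ?thesis .
qed

text \<open>
  The composite of the bonding maps is transport along the whole segment of the ray. The homotopies take place
  in \<open>U i\<close>, which contains the ray from \<open>i\<close> on and all later neighborhoods.
\<close>

lemma bonding_progroup:
  "g \<in> loops_at (U (i + d)) (\<gamma> (real (i + d))) \<Longrightarrow>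
    bonding (progroup_bond U \<gamma>) i d (path_class (U (i + d)) g) =
    path_class (U i) (conjugate_path (segment_of \<gamma> (real i) (real (i + d))) g)"
proof (induction d arbitrary: g)
  case 0
  have "segment_of \<gamma> (real i) (real i) = (\<lambda>_. \<gamma> (real i))"
    by (auto simp: segment_of_def linepath_def algebra_simps)
  then show ?case
    using 0 by (auto intro!: path_class_eqI homotopic_paths_sym[OF conjugate_path_const])
next
  case (Suc d)
  let ?a = "real i" and ?b = "real (i + d)" and ?c = "real (i + Suc d)"
  have shift: "(\<lambda>s. \<gamma> (?b + s)) = segment_of \<gamma> ?b ?c"
    by (auto simp: segment_of_def linepath_def algebra_simps)
  have sub: "U (i + Suc d) \<subseteq> U (i + d)" "U (i + Suc d) \<subseteq> U i"
    using neighborhood_system_antimono[OF U] by simp_all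
  have g: "g \<in> loops_at (U (i + d)) (\<gamma> ?c)" "g \<in> loops_at (U i) (\<gamma> ?c)"
    using Suc.prems sub by (auto simp: loops_at_def)
  have "progroup_bond U \<gamma> (i + d) (path_class (U (i + Suc d)) g) =
      path_class (U (i + d)) (conjugate_path (segment_of \<gamma> ?b ?c) g)"
    unfolding progroup_bond_def shift conjugate_path_def
    by (rule transport_path_class[OF Suc.prems sub(1)]) (use segment segment_inside[of "i + d"] in simp_all)
  then have "bonding (progroup_bond U \<gamma>) i (Suc d) (path_class (U (i + Suc d)) g) =
      bonding (progroup_bond U \<gamma>) i d (path_class (U (i + d)) (conjugate_path (segment_of \<gamma> ?b ?c) g))"
    by simp
  also have "\<dots> = path_class (U i) (conjugate_path (segment_of \<gamma> ?a ?b) (conjugate_path (segment_of \<gamma> ?b ?c) g))"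
    by (rule Suc.IH, rule conjugate_path_loop[OF g(1)]) (use segment segment_inside[of "i + d"] in simp_all)
  also have "\<dots> = path_class (U i) (conjugate_path (segment_of \<gamma> ?a ?c) g)"
  proof (rule path_class_eqI, rule conjugate_segments[OF g(2)])
    show "\<gamma> ` {?a..?c} \<subseteq> U i" using inside[of i] by (auto simp: image_subset_iff)
  qed simp_all
  finally show ?case .
qed

lemma image_bonding:
  assumes "i \<le> k"
  shows "bonding (progroup_bond U \<gamma>) i (k - i) ` carrier (progroup U \<gamma> k) =
    (\<lambda>g. path_class (U i) (conjugate_path (segment_of \<gamma> (real i) (real k)) g)) ` loops_at (U k) (\<gamma> (real k))"
  using bonding_progroup[of _ i "k - i"] assms
  unfolding progroup_def fundamental_group_def by (simp add: image_image cong: image_cong_simp)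

text \<open>
  Only the inclusion of the image of \<open>\<pi>\<^sub>1 (U j)\<close> in that of \<open>\<pi>\<^sub>1 (U k)\<close> is at stake. It suffices that loops in
  \<open>U j\<close> can be deformed, within the larger \<open>U i\<close>, to loops that come from \<open>U k\<close>.
\<close>

lemma mittag_leffler_if_loops_lift:
  assumes lift: "\<And>i. \<exists>j\<ge>i. \<forall>k\<ge>j. \<forall>g\<in>loops_at (U j) (\<gamma> (real j)).
    \<exists>h\<in>loops_at (U k) (\<gamma> (real k)). homotopic_paths (U i) (conjugate_path (segment_of \<gamma> (real j) (real k)) h) g"
  shows "mittag_leffler (progroup U \<gamma>) (progroup_bond U \<gamma>)"
  unfolding mittag_leffler_def
proof
  fix i
  obtain j where j: "j \<ge> i" and lift_j: "\<And>k g. k \<ge> j \<Longrightarrow> g \<in> loops_at (U j) (\<gamma> (real j)) \<Longrightarrow>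
    \<exists>h\<in>loops_at (U k) (\<gamma> (real k)). homotopic_paths (U i) (conjugate_path (segment_of \<gamma> (real j) (real k)) h) g"
    using lift by blast
  have "bonding (progroup_bond U \<gamma>) i (k - i) ` carrier (progroup U \<gamma> k) =
      bonding (progroup_bond U \<gamma>) i (j - i) ` carrier (progroup U \<gamma> j)" if k: "k \<ge> j" for k
  proof -
    have ik: "i \<le> k" using j k by simp
    let ?c = "\<lambda>a b. segment_of \<gamma> (real a) (real b)"
    have Uj: "U k \<subseteq> U j" "U j \<subseteq> U i" "U k \<subseteq> U i"
      using neighborhood_system_antimono[OF U] j k ik by simp_all
    have compose: "path_class (U i) (conjugate_path (?c i k) h) = path_class (U i) (conjugate_path (?c i j) (conjugate_path (?c j k) h))"
      if "h \<in> loops_at (U k) (\<gamma> (real k))" for h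
    proof (rule path_class_eqI, rule homotopic_paths_sym, rule conjugate_segments)
      show "h \<in> loops_at (U i) (\<gamma> (real k))" using that Uj by (auto simp: loops_at_def)
      show "\<gamma> ` {real i..real k} \<subseteq> U i" using inside[of i] by (auto simp: image_subset_iff)
    qed (use j k in simp_all)
    have down: "conjugate_path (?c j k) h \<in> loops_at (U j) (\<gamma> (real j))"
      if "h \<in> loops_at (U k) (\<gamma> (real k))" for h
    proof (rule conjugate_path_loop)
      show "h \<in> loops_at (U j) (\<gamma> (real k))" using that Uj by (auto simp: loops_at_def)
    qed (use segment[of "real j" "real k"] segment_inside[of j "real j" "real k"] k in simp_all)
    have "\<exists>h\<in>loops_at (U k) (\<gamma> (real k)). path_class (U i) (conjugate_path (?c i j) g) = path_class (U i) (conjugate_path (?c i k) h)"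
      if g: "g \<in> loops_at (U j) (\<gamma> (real j))" for g
    proof -
      obtain h where h: "h \<in> loops_at (U k) (\<gamma> (real k))" "homotopic_paths (U i) (conjugate_path (?c j k) h) g"
        using lift_j[OF k g] by blast
      have "homotopic_paths (U i) (conjugate_path (?c i j) (conjugate_path (?c j k) h)) (conjugate_path (?c i j) g)"
        using h(2) down[OF h(1)] segment[of "real i" "real j"] segment_inside[of i "real i" "real j"] j
        by (intro conjugate_path_cong) (simp_all add: loops_at_def)
      then show ?thesis using compose[OF h(1)] h(1) path_class_eqI by metis
    qed
    then show ?thesis
      unfolding image_bonding[OF ik] image_bonding[OF j] using compose down by (auto simp: image_iff)
  qed
  then show "\<exists>j\<ge>i. \<forall>k\<ge>j. bonding (progroup_bond U \<gamma>) i (k - i) ` carrier (progroup U \<gamma> k) =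
      bonding (progroup_bond U \<gamma>) i (j - i) ` carrier (progroup U \<gamma> j)"
    using j by blast
qed

end

section \<open>Non-Mittag-Leffler ends\<close>

text \<open>
  The pushing takes place in the component \<open>D\<close> of \<open>{\<phi> > s}\<close> that contains the tail of the ray. It is
  contained in \<open>C\<close>, and it is relatively closed in \<open>{\<phi> > s}\<close>, which makes its parts between two levels
  compact. The base point \<open>\<gamma> k\<close> need not lie above the level \<open>s'\<close> to which loops are pushed. So the loop
  is transported further, to a point \<open>\<gamma> l\<close> above \<open>s'\<close>, pushed there, and then transported back to \<open>\<gamma> k\<close>.
\<close>

lemma end_mittag_leffler_if_no_critical_points:
  fixes A :: "('a::t2_space, 'e::euclidean_space) chart set"
  assumes A: "smooth_atlas A" and \<phi>: "morse_function A \<phi>" "exhausting \<phi>"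
    and U: "neighborhood_system U" and V: "V \<in> ends U"
    and C: "end_component V (\<phi> -` {t<..}) C"
    and none: "C \<inter> critical_points_of_index A \<phi> (DIM('e) - 1) = {}"
  shows "end_mittag_leffler U V"
  unfolding end_mittag_leffler_def
proof (intro allI impI, elim conjE)
  fix \<gamma> assume \<gamma>: "singular_ray \<gamma>" "\<forall>i. \<gamma> ` {real i..} \<subseteq> U i" "determines_end \<gamma> V"
  interpret ray U \<gamma>
    by unfold_locales (use U \<gamma> in \<open>auto simp: singular_ray_def\<close>)
  have \<phi>c: "continuous_on UNIV \<phi>"
    using smooth_function_continuous[OF A] \<phi>(1) by (simp add: morse_function_def)
  have opn: "open (\<phi> -` {s<..})" for s using \<phi>c by (intro open_vimage) auto
  have cells: "has_cells_at p" for p :: 'a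
    using coordinate_chart.has_cells[OF coordinate_chart_at[OF A]] .
  have below: "\<exists>i. U i \<subseteq> \<phi> -` {s<..}" for s
  proof -
    obtain i where "U i \<inter> \<phi> -` {..s} = {}"
      using neighborhood_disjoint_compact[OF U compact_sublevel(2)[OF \<phi>(2)]] by blast
    then have "U i \<subseteq> \<phi> -` {s<..}" by (auto simp: disjoint_iff)
    then show ?thesis ..
  qed
  show "mittag_leffler (progroup U \<gamma>) (progroup_bond U \<gamma>)"
  proof (rule mittag_leffler_if_loops_lift)
    fix i
    have "compact (- U i)" using U by (simp add: neighborhood_system_def)
    then obtain s where s: "t < s" "\<phi> -` {s<..} \<subseteq> U i"
      using superlevel_inside_neighborhood[OF _ \<phi>c] by blast
    obtain j0 where "U j0 \<subseteq> \<phi> -` {s<..}" using below by blast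
    then have "U (max i j0) \<subseteq> \<phi> -` {s<..}" using neighborhood_system_antimono[OF U, of j0 "max i j0"] by auto
    then obtain j where j: "j \<ge> i" "U j \<subseteq> \<phi> -` {s<..}" by (meson max.cobounded1)
    have \<gamma>j: "\<gamma> ` {real j..} \<subseteq> \<phi> -` {s<..}" using inside[of j] j(2) by blast
    define D where "D = connected_component_set (\<phi> -` {s<..}) (\<gamma> (real j))"
    have \<gamma>js: "\<gamma> (real j) \<in> \<phi> -` {s<..}" using \<gamma>j by auto
    have D: "D \<in> components (\<phi> -` {s<..})" unfolding D_def using \<gamma>js by (rule componentsI)
    have jD: "\<gamma> (real j) \<in> D" using \<gamma>js by (simp add: D_def)
    have into_D: "T \<subseteq> D" if "connected T" "T \<subseteq> \<phi> -` {s<..}" "\<gamma> (real j) \<in> T" for T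
      using components_maximal[OF D that(1,2)] jD that(3) by blast
    have \<gamma>D: "\<gamma> ` {real j..} \<subseteq> D"
    proof (rule into_D[OF _ \<gamma>j])
      show "connected (\<gamma> ` {real j..})"
        by (rule connected_continuous_image[OF continuous_on_subset[OF cont]]) auto
    qed auto
    have "D \<subseteq> C"
    proof -
      have Cc: "C \<in> components (\<phi> -` {t<..})" using C by (simp add: end_component_def)
      obtain m where "V m \<subseteq> C" using C by (auto simp: end_component_def end_neighborhood_def)
      moreover obtain \<kappa> where "\<gamma> ` {\<kappa>..} \<subseteq> V m" using \<gamma>(3) by (auto simp: determines_end_def)
      moreover have "\<gamma> (max \<kappa> (real j)) \<in> \<gamma> ` {\<kappa>..}" "\<gamma> (max \<kappa> (real j)) \<in> \<gamma> ` {real j..}" by auto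
      ultimately have "\<gamma> (max \<kappa> (real j)) \<in> C \<inter> D" using \<gamma>D by blast
      moreover have "D \<subseteq> \<phi> -` {t<..}" using in_components_subset[OF D] s(1) by auto
      ultimately show ?thesis
        using components_maximal[OF Cc in_components_connected[OF D]] by blast
    qed
    have Ds: "D \<subseteq> \<phi> -` {s<..}" using in_components_subset[OF D] .
    have Dopen: "open D" by (rule open_components_of_cells[OF cells opn D])
    obtain T where T: "closed T" "D = \<phi> -` {s<..} \<inter> T"
      using closedin_component[OF D] unfolding closedin_closed by blast
    have Dcpt: "compact (D \<inter> \<phi> -` {a..b})" if "s < a" for a b
    proof -
      have "D \<inter> \<phi> -` {a..b} = \<phi> -` {a..b} \<inter> T" using T(2) that by auto
      then show ?thesis using compact_sublevel(1)[OF \<phi>(2)] T(1) by (simp add: compact_Int_closed)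
    qed
    have loc: "strict_local_max \<phi> p \<or> connected_above \<phi> p" if "p \<in> D" for p
      using that \<open>D \<subseteq> C\<close> none by (intro connected_above_or_strict_local_max[OF A \<phi>(1)]) blast
    have "\<exists>h\<in>loops_at (U k) (\<gamma> (real k)).
        homotopic_paths (U i) (conjugate_path (segment_of \<gamma> (real j) (real k)) h) g"
      if k: "k \<ge> j" and g: "g \<in> loops_at (U j) (\<gamma> (real j))" for k g
    proof -
      have "compact (- U k)" using U by (simp add: neighborhood_system_def)
      then obtain s' where s': "s < s'" "\<phi> -` {s'<..} \<subseteq> U k"
        using superlevel_inside_neighborhood[OF _ \<phi>c] by blast
      obtain l0 where l0: "U l0 \<subseteq> \<phi> -` {s'<..}" using below by blast
      define l where "l = max k l0"
      have l: "k \<le> l" "j \<le> l" "\<gamma> (real l) \<in> \<phi> -` {s'<..}"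
        using inside[of l] neighborhood_system_antimono[OF U, of l0 l] l0 k by (auto simp: l_def)
      have gp: "path g" "path_image g \<subseteq> U j" "pathstart g = \<gamma> (real j)" "pathfinish g = \<gamma> (real j)"
        using g by (auto simp: loops_at_def)
      have gD: "path_image g \<subseteq> D"
        using gp j(2) pathstart_in_path_image[of g]
        by (intro into_D connected_path_image) auto
      then have gloop: "g \<in> loops_at D (\<gamma> (real j))" using gp by (simp add: loops_at_def)
      let ?c = "\<lambda>a b. segment_of \<gamma> (real a) (real b)"
      have c: "path (?c j l)" "path_image (?c j l) \<subseteq> D" "pathstart (?c j l) = \<gamma> (real j)" "pathfinish (?c j l) = \<gamma> (real l)"
        using segment[of "real j" "real l"] l(2) \<gamma>D by auto
      define e where "e = conjugate_path (reversepath (?c j l)) g"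
      have e: "e \<in> loops_at D (\<gamma> (real l))"
        unfolding e_def using c by (intro conjugate_path_loop[OF gloop]) simp_all
      then obtain h where h: "path h" "path_image h \<subseteq> D \<inter> \<phi> -` {s'<..}" "homotopic_paths D e h"
        using path_homotopic_above_level[OF Dopen \<phi>c Ds Dcpt cells loc s'(1), of e] l(3)
        by (auto simp: loops_at_def)
      have hl: "h \<in> loops_at D (\<gamma> (real l))" "h \<in> loops_at (U k) (\<gamma> (real l))"
        using h s'(2) e homotopic_paths_imp_pathstart[OF h(3)] homotopic_paths_imp_pathfinish[OF h(3)]
        by (auto simp: loops_at_def)
      have "conjugate_path (?c k l) h \<in> loops_at (U k) (\<gamma> (real k))"
        by (rule conjugate_path_loop[OF hl(2)])
          (use segment[of "real k" "real l"] segment_inside[of k "real k" "real l"] l(1) in simp_all)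
      moreover have "homotopic_paths D (conjugate_path (?c j k) (conjugate_path (?c k l) h)) (conjugate_path (?c j l) h)"
        using \<gamma>D k l(1) by (intro conjugate_segments[OF hl(1)]) (auto simp: image_subset_iff)
      moreover have "homotopic_paths D (conjugate_path (?c j l) h) (conjugate_path (?c j l) e)"
        using h(3) c hl(1) by (intro conjugate_path_cong) (simp_all add: homotopic_paths_sym loops_at_def)
      moreover have "homotopic_paths D (conjugate_path (?c j l) e) g"
        unfolding e_def using c by (intro conjugate_path_reverse[OF gloop])
      ultimately have "homotopic_paths D (conjugate_path (?c j k) (conjugate_path (?c k l) h)) g"
        by (meson homotopic_paths_trans)
      then have "homotopic_paths (U i) (conjugate_path (?c j k) (conjugate_path (?c k l) h)) g"
        by (rule homotopic_paths_subset) (use Ds s(2) in blast)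
      then show ?thesis using \<open>conjugate_path (?c k l) h \<in> loops_at (U k) (\<gamma> (real k))\<close> by blast
    qed
    then show "\<exists>j\<ge>i. \<forall>k\<ge>j. \<forall>g\<in>loops_at (U j) (\<gamma> (real j)).
      \<exists>h\<in>loops_at (U k) (\<gamma> (real k)). homotopic_paths (U i) (conjugate_path (segment_of \<gamma> (real j) (real k)) h) g"
      using j(1) by blast
  qed
qed

theorem proposition4p3:
  fixes A :: "('a::{t2_space,second_countable_topology}, 'e::euclidean_space) chart set"
    and U :: "nat \<Rightarrow> 'a set"
    and n :: nat
  assumes "smooth_open_manifold A" and "n = DIM('e)"
    and "neighborhood_system U"
  shows "(\<forall>V\<in>ends U. \<not> end_mittag_leffler U V \<longrightarrow>
            (\<forall>\<phi>. morse_function A \<phi> \<and> exhausting \<phi> \<longrightarrow>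
              (\<forall>t. \<exists>C. end_component V (\<phi> -` {t<..}) C \<and>
                 infinite (C \<inter> critical_points_of_index A \<phi> (n - 1))))) \<and>
         ((\<exists>\<phi>. morse_function A \<phi> \<and> exhausting \<phi> \<and>
              finite (critical_points_of_index A \<phi> (n - 1))) \<longrightarrow>
            (\<forall>V\<in>ends U. end_mittag_leffler U V))"
proof -
  have A: "smooth_atlas A" using assms(1) by (simp add: smooth_open_manifold_def)
  have cells: "has_cells_at p" for p :: 'a
    using coordinate_chart.has_cells[OF coordinate_chart_at[OF A]] .
  have inf: "\<exists>C. end_component V (\<phi> -` {t<..}) C \<and> infinite (C \<inter> critical_points_of_index A \<phi> (n - 1))"
    if V: "V \<in> ends U" and ml: "\<not> end_mittag_leffler U V" and \<phi>: "morse_function A \<phi>" "exhausting \<phi>" for V \<phi> t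
  proof -
    have \<phi>c: "continuous_on UNIV \<phi>"
      using smooth_function_continuous[OF A] \<phi>(1) by (simp add: morse_function_def)
    have ex: "\<exists>C. end_component V (\<phi> -` {s<..}) C" for s
    proof -
      obtain i where "U i \<inter> \<phi> -` {..s} = {}"
        using neighborhood_disjoint_compact[OF assms(3) compact_sublevel(2)[OF \<phi>(2)]] by blast
      then have "U i \<subseteq> \<phi> -` {s<..}" by (auto simp: disjoint_iff)
      moreover have "open (\<phi> -` {s<..})" using \<phi>c by (intro open_vimage) auto
      ultimately show ?thesis using end_component_exists[OF cells _ V] by blast
    qed
    obtain C where C: "end_component V (\<phi> -` {t<..}) C" using ex by blast
    have "infinite (C \<inter> critical_points_of_index A \<phi> (n - 1))"
    proof
      let ?K = "C \<inter> critical_points_of_index A \<phi> (n - 1)"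
      assume fin: "finite ?K"
      \<comment> \<open>no critical point in question lies above the level \<open>t'\<close>\<close>
      define t' where "t' = Max (insert t (\<phi> ` ?K))"
      have t': "t \<le> t'" "\<And>p. p \<in> ?K \<Longrightarrow> \<phi> p \<le> t'" using fin by (auto simp: t'_def intro!: Max_ge)
      obtain C' where C': "end_component V (\<phi> -` {t'<..}) C'" using ex by blast
      have cc: "C \<in> components (\<phi> -` {t<..})" "C' \<in> components (\<phi> -` {t'<..})"
        using C C' by (auto simp: end_component_def)
      have sub: "C' \<subseteq> \<phi> -` {t'<..}" using in_components_subset[OF cc(2)] .
      obtain i j where ij: "V i \<subseteq> C" "V j \<subseteq> C'"
        using C C' by (auto simp: end_component_def end_neighborhood_def)
      have "V (max i j) \<subseteq> V i \<inter> V j"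
        using V lift_Suc_antimono_le[of V] by (auto simp: ends_def)
      moreover have "V (max i j) \<noteq> {}"
        using V in_components_nonempty by (fastforce simp: ends_def)
      ultimately have "C \<inter> C' \<noteq> {}" using ij by blast
      then have "C' \<subseteq> C"
        using components_maximal[OF cc(1) in_components_connected[OF cc(2)]] sub t'(1) by force
      then have "C' \<inter> critical_points_of_index A \<phi> (DIM('e) - 1) = {}"
        using t'(2) sub assms(2) by fastforce
      then show False
        using end_mittag_leffler_if_no_critical_points[OF A \<phi> assms(3) V C'] ml by blast
    qed
    then show ?thesis using C by blast
  qed
  have "\<forall>V\<in>ends U. end_mittag_leffler U V"
    if "morse_function A \<phi>" "exhausting \<phi>" "finite (critical_points_of_index A \<phi> (n - 1))" for \<phi>
    using inf[OF _ _ that(1,2)] that(3) by (meson finite_Int)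
  then show ?thesis using inf by blast
qed

end
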